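(* Let $\{V_{k_1}\}_{k_1 \in \mathcal{K}_1}$ be a set of $[[m+t,m]]$ quantum error-correcting codes (each $V_{k_1}$ a unitary mapping Paulis to Paulis under conjugation, up to phase) that is strong purity testing with error $\varepsilon$. Then the encryption scheme obtained from the canonical encode-encrypt construction, with key $(k_1,k_2)$ uniform in $\mathcal{K}_1\times\{0,1\}^{2(m+t)}$, encryption unitary $U_{k_1,k_2}=P_{k_2}V_{k_1}$ and tag state $\sigma_{k_1,k_2}=|0^t\rangle\langle 0^t|$, is quantum ciphertext $\left(\sqrt{\varepsilon}+\tfrac32\varepsilon\right)$-authenticating with key recycling (QCA-R), with key recycling function $f(k_1,k_2):=k_1$.
   Context: **Paulis and norms.** $\mathbb{P}_n$ is the $n$-qubit Pauli group modulo phases, with elements $P_\ell$ indexed by $\ell\in\{0,1\}^{2n}$ (bit-flip and phase-flip positions), $P_0=\mathsf{I}^{\otimes n}$. $\|\cdot\|_{\mathrm{tr}}$ is the trace norm and $\|\Psi\|_\diamond=\sup_\rho\|(\mathbb{I}\otimes\Psi)(\rho)\|_{\mathrm{tr}}$ (supremum over density matrices, with arbitrary ancilla); the diamond-norm distance of $\Psi,\Psi'$ is $\frac12\|\Psi-\Psi'\|_\diamond$. All keys are uniformly random, and $\mathbb{E}_k$ is the corresponding average. Unitaries and maps act as the identity on registers not mentioned. **Codes.** An $[[m+t,m]]$ code is given by a unitary $V$ encoding an $m$-qubit state $\rho$ as $V(\rho\otimes|0^t\rangle\langle 0^t|)V^\dagger$. All codes considered satisfy: for every $P_\ell\in\mathbb{P}_{m+t}$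 there are $P_{\ell'}\in\mathbb{P}_{m+t}$ and $\theta\in\mathbb{R}$ with $P_\ell V=e^{i\theta}VP_{\ell'}$. Membership of $V^\dagger P_\ell V$ in a set of Paulis is understood up to phase. A set $\{V_k\}_{k\in\mathcal{K}}$ is *strong purity testing* with error $\varepsilon$ if for every $P_\ell\in\mathbb{P}_{m+t}\setminus\{\mathsf{I}^{\otimes(m+t)}\}$, $$\Pr_k\left[V_k^\dagger P_\ell V_k\in\mathbb{P}_m\otimes\{\mathsf{I},\mathsf{Z}\}^{\otimes t}\right]\le\varepsilon .$$ **Encryption schemes.** A scheme $\{(U_k,\sigma_k)\}_{k\in\mathcal{K}}$ consists of unitaries $U_k$ on a message register $M$ and tag register $T$, and tag states $\sigma_k=\sum_r p_{k,r}|\varphi_{k,r}\rangle\langle\varphi_{k,r}|$ on $T$. Encryption is $\rho\mapsto U_k(\rho\otimes\sigma_k)U_k^\dagger$. $\Pi_k^{\mathsf{acc}}$ is the projector (on $T$) onto the support of $\sigma_k$, and $\Pi_k^{\mathsf{rej}}=\mathbb{I}-\Pi_k^{\mathsf{acc}}$; decryption undoes $U_k$, measures $\{\Pi_k^{\mathsf{acc}},\Pi_k^{\mathsf{rej}}\}$, outputs $M$ on accept, and on reject discards $MT$ and outputs a dummy state $|\bot\rangle$ orthogonal to all messages (the output register $M$ is enlarged to contain it). **Canonical construction.** Key: $k_1\in\mathcal{K}_1$ and $k_2\in\{0,1\}^{2(m+t)}$, uniform and independent. Encryption: $\rho^M\mapsto P_{k_2}V_{k_1}(\rho\otimes|0^t\rangle\langle0^t|^T)V_{k_1}^\dagger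 P_{k_2}^\dagger$. Here $\Pi^{\mathsf{acc}}=|0^t\rangle\langle0^t|$ and $\Pi^{\mathsf{rej}}=\mathbb{I}-|0^t\rangle\langle0^t|$. **QCA-R.** The scheme is ciphertext $\delta$-authenticating with key recycling ($\delta$-QCA-R), with recycling function $f$ on $\mathcal{K}$, if for every completely positive trace-preserving map $\mathcal{A}$ on $M,T$ and a side-information register $R$ there is a CP map $\mathcal{S}_{\mathsf{rej}}$ on $R$ such that the real channel $$\mathfrak{R}:\rho^{MR}\mapsto\mathbb{E}_k\Big[\mathrm{Tr}_T\big(\Pi_k^{\mathsf{acc}}U_k^\dagger\mathcal{A}(U_k(\rho\otimes\sigma_k)U_k^\dagger)U_k\Pi_k^{\mathsf{acc}}\big)\otimes|k\rangle\langle k|+|\bot\rangle\langle\bot|^M\otimes\mathrm{Tr}_{MT}\big(\Pi_k^{\mathsf{rej}}U_k^\dagger\mathcal{A}(U_k(\rho\otimes\sigma_k)U_k^\dagger)U_k\Pi_k^{\mathsf{rej}}\big)\otimes|f(k)\rangle\langle f(k)|\Big]$$ is $\delta$-close in diamond-norm distance to the ideal channel $$\mathfrak{I}:\rho^{MR}\mapsto(\mathbb{I}^M\otimes\mathcal{S}_{\mathsf{acc}})(\rho^{MR})\otimes\tau_{\mathcal{K}}+|\bot\rangle\langle\bot|^M\otimes\mathcal{S}_{\mathsf{rej}}(\rho^R)\otimes\mathbb{E}_k\big[|f(k)\rangle\langle f(k)|\big],$$ where $\rho^R=\mathrm{Tr}_M\rho^{MR}$, $\tau_{\mathcal{K}}=\mathbb{E}_k[|k\rangle\langle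 k|]$ is the maximally mixed state on the key register, $\mathcal{S}_{\mathsf{acc}}+\mathcal{S}_{\mathsf{rej}}$ is trace preserving, and $$\mathcal{S}_{\mathsf{acc}}:\rho^R\mapsto\mathbb{E}_{k',r}\Big[\langle\varphi_{k',r}|^T\langle\Phi^+|^{M_1M_2}\,U_{k'}^\dagger\,\mathcal{A}^{M_1TR}\big(U_{k'}^{M_1T}\rho_{k',r}U_{k'}^\dagger\big)U_{k'}\,|\varphi_{k',r}\rangle|\Phi^+\rangle\Big],$$ $$\rho_{k',r}=\rho^R\otimes|\Phi^+\rangle\langle\Phi^+|^{M_1M_2}\otimes|\varphi_{k',r}\rangle\langle\varphi_{k',r}|^T,$$ with $k'$ uniform, $r$ distributed according to $p_{k',r}$, $M_1,M_2$ copies of $M$, and $|\Phi^+\rangle$ the maximally entangled state (EPR pairs) of $M_1M_2$. *)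

theory Defs
  imports "HOL-Analysis.Analysis"
begin

text \<open>
  Registers are finite index sets, so that their dimension may be an arbitrary number and tensor
  products are Cartesian products of index sets. An operator from the space with basis \<open>B\<close> to the
  space with basis \<open>A\<close> is its matrix, a function of a row and a column index which vanishes
  outside \<open>A \<times> B\<close>; hence operators on fixed registers are equal iff the functions are.
\<close>

type_synonym ('a, 'b) opr = "'a \<Rightarrow> 'b \<Rightarrow> complex"
type_synonym ('a, 'b) superop = "('a, 'a) opr \<Rightarrow> ('b, 'b) opr"


subsection \<open>Operators\<close>

definition ops :: "'a set \<Rightarrow> 'b set \<Rightarrow> ('a, 'b) opr set" where
  "ops A B = {X. \<forall>i j. i \<notin> A \<or> j \<notin> B \<longrightarrow> X i j = 0}"

definition id_op :: "'a set \<Rightarrow> ('a, 'a) opr" where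
  "id_op A = (\<lambda>i j. of_bool (i \<in> A \<and> i = j))"

text \<open>The product \<open>X Y\<close>, where \<open>B\<close> indexes the columns of \<open>X\<close> and the rows of \<open>Y\<close>.\<close>

definition mul :: "'b set \<Rightarrow> ('a, 'b) opr \<Rightarrow> ('b, 'c) opr \<Rightarrow> ('a, 'c) opr" where
  "mul B X Y = (\<lambda>i k. \<Sum>j\<in>B. X i j * Y j k)"

definition dagger :: "('a, 'b) opr \<Rightarrow> ('b, 'a) opr" where
  "dagger X = (\<lambda>i j. cnj (X j i))"

definition scale :: "complex \<Rightarrow> ('a, 'b) opr \<Rightarrow> ('a, 'b) opr" where
  "scale c X = (\<lambda>i j. c * X i j)"

definition conj_op :: "'a set \<Rightarrow> ('a, 'a) opr \<Rightarrow> ('a, 'a) opr \<Rightarrow> ('a, 'a) opr" where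
  "conj_op A K X = mul A (mul A K X) (dagger K)"

definition tensor :: "('a, 'b) opr \<Rightarrow> ('c, 'd) opr \<Rightarrow> ('a \<times> 'c, 'b \<times> 'd) opr" where
  "tensor X Y = (\<lambda>(i, k) (j, l). X i j * Y k l)"

definition trace_op :: "'a set \<Rightarrow> ('a, 'a) opr \<Rightarrow> complex" where
  "trace_op A X = (\<Sum>i\<in>A. X i i)"

text \<open>Partial trace over the first of two registers.\<close>

definition ptrace1 :: "'a set \<Rightarrow> ('a \<times> 'b, 'a \<times> 'b) opr \<Rightarrow> ('b, 'b) opr" where
  "ptrace1 A X = (\<lambda>i j. \<Sum>a\<in>A. X (a, i) (a, j))"

definition unitary_op :: "'a set \<Rightarrow> ('a, 'a) opr \<Rightarrow> bool" where
  "unitary_op A U \<longleftrightarrow>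
     U \<in> ops A A \<and> mul A U (dagger U) = id_op A \<and> mul A (dagger U) U = id_op A"

definition psd :: "'a set \<Rightarrow> ('a, 'a) opr \<Rightarrow> bool" where
  "psd A X \<longleftrightarrow>
     X \<in> ops A A \<and> (\<forall>v. (\<Sum>i\<in>A. \<Sum>j\<in>A. cnj (v i) * X i j * v j) \<in> \<real>\<^sub>\<ge>\<^sub>0)"

definition density :: "'a set \<Rightarrow> ('a, 'a) opr \<Rightarrow> bool" where
  "density A \<rho> \<longleftrightarrow> psd A \<rho> \<and> trace_op A \<rho> = 1"

text \<open>The trace norm \<open>Tr \<surd>(X\<^sup>\<dagger> X)\<close>, for the unique positive semidefinite square root.\<close>

definition trace_norm :: "'a set \<Rightarrow> ('a, 'a) opr \<Rightarrow> real" where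
  "trace_norm A X = Re (trace_op A (THE S. psd A S \<and> mul A S S = mul A (dagger X) X))"

definition kets :: "'a set \<Rightarrow> ('a \<Rightarrow> complex) set" where
  "kets A = {v. \<forall>i. i \<notin> A \<longrightarrow> v i = 0}"

definition inner_ket :: "'a set \<Rightarrow> ('a \<Rightarrow> complex) \<Rightarrow> ('a \<Rightarrow> complex) \<Rightarrow> complex" where
  "inner_ket A v w = (\<Sum>i\<in>A. cnj (v i) * w i)"

definition app_ket :: "'a set \<Rightarrow> ('b, 'a) opr \<Rightarrow> ('a \<Rightarrow> complex) \<Rightarrow> 'b \<Rightarrow> complex" where
  "app_ket A X v = (\<lambda>i. \<Sum>j\<in>A. X i j * v j)"

definition ketbra :: "('a \<Rightarrow> complex) \<Rightarrow> ('a, 'a) opr" where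
  "ketbra v = (\<lambda>i j. v i * cnj (v j))"

definition basis_ket :: "'a \<Rightarrow> 'a \<Rightarrow> complex" where
  "basis_ket a = (\<lambda>i. of_bool (i = a))"

definition support_op :: "'a set \<Rightarrow> ('a, 'a) opr \<Rightarrow> ('a \<Rightarrow> complex) set" where
  "support_op A X =
     {v \<in> kets A. \<forall>w \<in> kets A. app_ket A X w = (\<lambda>_. 0) \<longrightarrow> inner_ket A w v = 0}"

definition support_proj :: "'a set \<Rightarrow> ('a, 'a) opr \<Rightarrow> ('a, 'a) opr" where
  "support_proj A X =
     (THE P. P \<in> ops A A \<and> dagger P = P \<and> mul A P P = P \<and> app_ket A P ` kets A = support_op A X)"


subsection \<open>Channels and the diamond norm\<close>

text \<open>
  \<open>ampl \<Psi>\<close> is the map \<open>id \<otimes> \<Psi>\<close> with the ancilla as first register: \<open>\<Psi>\<close> is applied to each block.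
\<close>

definition ampl :: "('a, 'b) superop \<Rightarrow> ('e \<times> 'a, 'e \<times> 'b) superop" where
  "ampl \<Psi> X = (\<lambda>(e, i) (f, j). \<Psi> (\<lambda>k l. X (e, k) (f, l)) i j)"

definition linear_superop :: "'a set \<Rightarrow> 'b set \<Rightarrow> ('a, 'b) superop \<Rightarrow> bool" where
  "linear_superop A B \<Psi> \<longleftrightarrow>
     (\<forall>X \<in> ops A A. \<Psi> X \<in> ops B B) \<and>
     (\<forall>X \<in> ops A A. \<forall>Y \<in> ops A A. \<Psi> (\<lambda>i j. X i j + Y i j) = (\<lambda>i j. \<Psi> X i j + \<Psi> Y i j)) \<and>
     (\<forall>c. \<forall>X \<in> ops A A. \<Psi> (scale c X) = scale c (\<Psi> X))"

definition cp_map :: "'a set \<Rightarrow> 'b set \<Rightarrow> ('a, 'b) superop \<Rightarrow> bool" where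
  "cp_map A B \<Psi> \<longleftrightarrow>
     linear_superop A B \<Psi> \<and>
     (\<forall>d::nat. \<forall>X. psd ({..<d} \<times> A) X \<longrightarrow> psd ({..<d} \<times> B) (ampl \<Psi> X))"

definition trace_preserving :: "'a set \<Rightarrow> 'b set \<Rightarrow> ('a, 'b) superop \<Rightarrow> bool" where
  "trace_preserving A B \<Psi> \<longleftrightarrow> (\<forall>X \<in> ops A A. trace_op B (\<Psi> X) = trace_op A X)"

definition cptp_map :: "'a set \<Rightarrow> 'b set \<Rightarrow> ('a, 'b) superop \<Rightarrow> bool" where
  "cptp_map A B \<Psi> \<longleftrightarrow> cp_map A B \<Psi> \<and> trace_preserving A B \<Psi>"

definition diamond_norm :: "'a set \<Rightarrow> 'b set \<Rightarrow> ('a, 'b) superop \<Rightarrow> real" where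
  "diamond_norm A B \<Psi> =
     Sup {trace_norm ({..<d} \<times> B) (ampl \<Psi> \<rho>) | (d::nat) \<rho>. density ({..<d} \<times> A) \<rho>}"

definition diamond_dist ::
    "'a set \<Rightarrow> 'b set \<Rightarrow> ('a, 'b) superop \<Rightarrow> ('a, 'b) superop \<Rightarrow> real" where
  "diamond_dist A B \<Psi> \<Psi>' = (1/2) * diamond_norm A B (\<lambda>X i j. \<Psi> X i j - \<Psi>' X i j)"


subsection \<open>Paulis and purity testing codes\<close>

definition bits :: "nat \<Rightarrow> bool list set" where
  "bits n = {xs. length xs = n}"

text \<open>The matrix entry of \<open>X\<^sup>x Z\<^sup>z\<close> in row \<open>a\<close> and column \<open>b\<close>.\<close>

definition pauli1 :: "bool \<Rightarrow> bool \<Rightarrow> bool \<Rightarrow> bool \<Rightarrow> complex" where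
  "pauli1 x z a b = of_bool (a = (b \<noteq> x)) * (if z \<and> b then -1 else 1)"

text \<open>
  The first \<open>n\<close> bits of \<open>l \<in> bits (2 * n)\<close> are the bit-flip positions, the last \<open>n\<close> the phase-flip
  positions. The representative of each Pauli modulo phases is the tensor product of the
  matrices \<open>X\<^sup>x Z\<^sup>z\<close>.
\<close>

definition pauli :: "nat \<Rightarrow> bool list \<Rightarrow> (bool list, bool list) opr" where
  "pauli n l = (\<lambda>a b. if a \<in> bits n \<and> b \<in> bits n
      then \<Prod>q<n. pauli1 (l ! q) (l ! (n + q)) (a ! q) (b ! q) else 0)"

text \<open>
  The indices of the Paulis in \<open>\<P>\<^sub>m \<otimes> {I, Z}\<^sup>\<otimes>\<^sup>t\<close>: no bit flip on any of the last \<open>t\<close> qubits.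
\<close>

definition undetected :: "nat \<Rightarrow> nat \<Rightarrow> bool list set" where
  "undetected m t = {l \<in> bits (2 * (m + t)). \<forall>q \<in> {m..<m + t}. \<not> l ! q}"

definition pauli_code :: "nat \<Rightarrow> nat \<Rightarrow> (bool list, bool list) opr \<Rightarrow> bool" where
  "pauli_code m t V \<longleftrightarrow>
     unitary_op (bits (m + t)) V \<and>
     (\<forall>l \<in> bits (2 * (m + t)). \<exists>l' \<in> bits (2 * (m + t)). \<exists>\<theta>::real.
        mul (bits (m + t)) (pauli (m + t) l) V
          = scale (cis \<theta>) (mul (bits (m + t)) V (pauli (m + t) l')))"

definition strong_purity_testing ::
    "nat \<Rightarrow> nat \<Rightarrow> 'k set \<Rightarrow> ('k \<Rightarrow> (bool list, bool list) opr) \<Rightarrow> real \<Rightarrow> bool" where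
  "strong_purity_testing m t K V \<epsilon> \<longleftrightarrow>
     (\<forall>l \<in> bits (2 * (m + t)). l \<noteq> replicate (2 * (m + t)) False \<longrightarrow>
        real (card {k \<in> K. \<exists>l' \<in> undetected m t. \<exists>\<theta>::real.
            mul (bits (m + t)) (dagger (V k)) (mul (bits (m + t)) (pauli (m + t) l) (V k))
              = scale (cis \<theta>) (pauli (m + t) l')})
          / real (card K) \<le> \<epsilon>)"


subsection \<open>Encryption schemes\<close>

text \<open>
  The tag state for key \<open>k\<close> is given by its ensemble: the vectors \<open>TagKet S k r\<close> with
  probabilities \<open>Prob S k r\<close>, for \<open>r \<in> Idx S k\<close>.
\<close>

record ('k, 'm, 't, 'i) scheme =
  Keys :: "'k set"
  Msg :: "'m set"
  Tag :: "'t set"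
  Enc :: "'k \<Rightarrow> ('m \<times> 't, 'm \<times> 't) opr"
  Idx :: "'k \<Rightarrow> 'i set"
  Prob :: "'k \<Rightarrow> 'i \<Rightarrow> real"
  TagKet :: "'k \<Rightarrow> 'i \<Rightarrow> 't \<Rightarrow> complex"

definition encryption_scheme :: "('k, 'm, 't, 'i) scheme \<Rightarrow> bool" where
  "encryption_scheme S \<longleftrightarrow>
     finite (Keys S) \<and> Keys S \<noteq> {} \<and> finite (Msg S) \<and> Msg S \<noteq> {} \<and> finite (Tag S) \<and>
     (\<forall>k \<in> Keys S. unitary_op (Msg S \<times> Tag S) (Enc S k) \<and>
        finite (Idx S k) \<and> (\<forall>r \<in> Idx S k. 0 \<le> Prob S k r) \<and> (\<Sum>r\<in>Idx S k. Prob S k r) = 1 \<and>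
        (\<forall>r \<in> Idx S k. TagKet S k r \<in> kets (Tag S) \<and>
           inner_ket (Tag S) (TagKet S k r) (TagKet S k r) = 1))"

definition tag_state :: "('k, 'm, 't, 'i) scheme \<Rightarrow> 'k \<Rightarrow> ('t, 't) opr" where
  "tag_state S k = (\<lambda>a b. \<Sum>r\<in>Idx S k. complex_of_real (Prob S k r) * ketbra (TagKet S k r) a b)"

definition proj_acc :: "('k, 'm, 't, 'i) scheme \<Rightarrow> 'k \<Rightarrow> ('t, 't) opr" where
  "proj_acc S k = support_proj (Tag S) (tag_state S k)"

definition proj_rej :: "('k, 'm, 't, 'i) scheme \<Rightarrow> 'k \<Rightarrow> ('t, 't) opr" where
  "proj_rej S k = (\<lambda>a b. id_op (Tag S) a b - proj_acc S k a b)"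

text \<open>
  The side information is a register \<open>R\<close>; the registers \<open>M\<close>, \<open>T\<close>, \<open>R\<close> are arranged as
  \<open>(M \<times> T) \<times> R\<close>, and \<open>add_tag\<close> inserts the tag state into an operator on \<open>M \<times> R\<close>.
\<close>

definition add_tag ::
    "('t, 't) opr \<Rightarrow> ('m \<times> 'r, 'm \<times> 'r) opr \<Rightarrow> (('m \<times> 't) \<times> 'r, ('m \<times> 't) \<times> 'r) opr" where
  "add_tag \<sigma> \<rho> = (\<lambda>((m, t), r) ((m', t'), r'). \<rho> (m, r) (m', r') * \<sigma> t t')"

definition ptrace_tag ::
    "'t set \<Rightarrow> (('m \<times> 't) \<times> 'r, ('m \<times> 't) \<times> 'r) opr \<Rightarrow> ('m \<times> 'r, 'm \<times> 'r) opr" where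
  "ptrace_tag T X = (\<lambda>(m, r) (m', r'). \<Sum>t\<in>T. X ((m, t), r) ((m', t), r'))"

text \<open>The state after encryption with key \<open>k\<close>, the attack \<open>\<A>\<close>, and undoing the encryption.\<close>

definition attacked ::
    "('k, 'm, 't, 'i) scheme \<Rightarrow> 'r set \<Rightarrow> (('m \<times> 't) \<times> 'r, ('m \<times> 't) \<times> 'r) superop \<Rightarrow> 'k \<Rightarrow>
     ('m \<times> 'r, 'm \<times> 'r) opr \<Rightarrow> (('m \<times> 't) \<times> 'r, ('m \<times> 't) \<times> 'r) opr" where
  "attacked S R \<A> k \<rho> =
     (let U = tensor (Enc S k) (id_op R); MTR = (Msg S \<times> Tag S) \<times> R
      in conj_op MTR (dagger U) (\<A> (conj_op MTR U (add_tag (tag_state S k) \<rho>))))"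

definition measured ::
    "('k, 'm, 't, 'i) scheme \<Rightarrow> 'r set \<Rightarrow> ('t, 't) opr \<Rightarrow>
     (('m \<times> 't) \<times> 'r, ('m \<times> 't) \<times> 'r) opr \<Rightarrow> (('m \<times> 't) \<times> 'r, ('m \<times> 't) \<times> 'r) opr" where
  "measured S R P X =
     conj_op ((Msg S \<times> Tag S) \<times> R) (tensor (tensor (id_op (Msg S)) P) (id_op R)) X"

text \<open>
  The output message register has basis \<open>insert None (Some ` M)\<close>, with \<open>None\<close> for the dummy state.
\<close>

definition embed_msg :: "('m \<times> 'r, 'm \<times> 'r) opr \<Rightarrow> ('m option \<times> 'r, 'm option \<times> 'r) opr" where
  "embed_msg X = (\<lambda>(a, r) (a', r'). case (a, a') of
      (Some m, Some m') \<Rightarrow> X (m, r) (m', r') | _ \<Rightarrow> 0)"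

definition bot_msg :: "('r, 'r) opr \<Rightarrow> ('m option \<times> 'r, 'm option \<times> 'r) opr" where
  "bot_msg X = tensor (ketbra (basis_ket None)) X"

text \<open>
  The key register has an orthonormal basis consisting of the keys \<open>k\<close> (as \<open>Inl k\<close>) and the recycled
  keys \<open>f k\<close> (as \<open>Inr (f k)\<close>).
\<close>

definition out_reg ::
    "('k, 'm, 't, 'i) scheme \<Rightarrow> ('k \<Rightarrow> 'l) \<Rightarrow> 'r set \<Rightarrow> (('m option \<times> 'r) \<times> ('k + 'l)) set" where
  "out_reg S f R = (insert None (Some ` Msg S) \<times> R) \<times> (Keys S <+> f ` Keys S)"

definition real_channel ::
    "('k, 'm, 't, 'i) scheme \<Rightarrow> ('k \<Rightarrow> 'l) \<Rightarrow> 'r set \<Rightarrow>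
     (('m \<times> 't) \<times> 'r, ('m \<times> 't) \<times> 'r) superop \<Rightarrow>
     ('m \<times> 'r, ('m option \<times> 'r) \<times> ('k + 'l)) superop" where
  "real_channel S f R \<A> \<rho> = (\<lambda>i j.
     (\<Sum>k\<in>Keys S.
        tensor (embed_msg (ptrace_tag (Tag S) (measured S R (proj_acc S k) (attacked S R \<A> k \<rho>))))
          (ketbra (basis_ket (Inl k))) i j
      + tensor (bot_msg (ptrace1 (Msg S \<times> Tag S)
            (measured S R (proj_rej S k) (attacked S R \<A> k \<rho>))))
          (ketbra (basis_ket (Inr (f k)))) i j)
     / of_nat (card (Keys S)))"

definition epr :: "'m set \<Rightarrow> 'm \<times> 'm \<Rightarrow> complex" where
  "epr M = (\<lambda>(a, b). of_bool (a \<in> M \<and> a = b) / complex_of_real (sqrt (real (card M))))"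

text \<open>
  The ideal accepting map. The registers are arranged as \<open>M\<^sub>2 \<times> ((M\<^sub>1 \<times> T) \<times> R)\<close>; \<open>epr_tag_ket\<close> is
  the vector \<open>|\<Phi>\<^sup>+\<rangle>|\<phi>\<rangle>\<close> on the first three of them.
\<close>

definition epr_tag_ket :: "'m set \<Rightarrow> ('t \<Rightarrow> complex) \<Rightarrow> 'm \<times> ('m \<times> 't) \<Rightarrow> complex" where
  "epr_tag_ket M \<phi> = (\<lambda>(m2, m1, t). epr M (m1, m2) * \<phi> t)"

definition sim_acc_term ::
    "('k, 'm, 't, 'i) scheme \<Rightarrow> 'r set \<Rightarrow> (('m \<times> 't) \<times> 'r, ('m \<times> 't) \<times> 'r) superop \<Rightarrow>
     'k \<Rightarrow> ('t \<Rightarrow> complex) \<Rightarrow> ('r, 'r) superop" where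
  "sim_acc_term S R \<A> k \<phi> \<rho> =
     (let MTR = Msg S \<times> ((Msg S \<times> Tag S) \<times> R);
          U = tensor (id_op (Msg S)) (tensor (Enc S k) (id_op R));
          \<psi> = epr_tag_ket (Msg S) \<phi>;
          \<rho>\<^sub>0 = (\<lambda>(m2, x, r) (m2', x', r'). ketbra \<psi> (m2, x) (m2', x') * \<rho> r r');
          Y = conj_op MTR (dagger U) (ampl \<A> (conj_op MTR U \<rho>\<^sub>0))
      in (\<lambda>r r'. \<Sum>(m2, x) \<in> Msg S \<times> (Msg S \<times> Tag S). \<Sum>(m2', x') \<in> Msg S \<times> (Msg S \<times> Tag S).
           cnj (\<psi> (m2, x)) * Y (m2, x, r) (m2', x', r') * \<psi> (m2', x')))"

definition sim_acc ::
    "('k, 'm, 't, 'i) scheme \<Rightarrow> 'r set \<Rightarrow> (('m \<times> 't) \<times> 'r, ('m \<times> 't) \<times> 'r) superop \<Rightarrow>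
     ('r, 'r) superop" where
  "sim_acc S R \<A> \<rho> = (\<lambda>i j.
     (\<Sum>k\<in>Keys S. \<Sum>r\<in>Idx S k.
        complex_of_real (Prob S k r) * sim_acc_term S R \<A> k (TagKet S k r) \<rho> i j)
     / of_nat (card (Keys S)))"

definition ideal_channel ::
    "('k, 'm, 't, 'i) scheme \<Rightarrow> ('k \<Rightarrow> 'l) \<Rightarrow> 'r set \<Rightarrow> ('r, 'r) superop \<Rightarrow> ('r, 'r) superop \<Rightarrow>
     ('m \<times> 'r, ('m option \<times> 'r) \<times> ('k + 'l)) superop" where
  "ideal_channel S f R S_acc S_rej \<rho> =
     (let \<tau> = (\<lambda>i j. (\<Sum>k\<in>Keys S. ketbra (basis_ket (Inl k)) i j) / of_nat (card (Keys S)));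
          \<tau>' = (\<lambda>i j. (\<Sum>k\<in>Keys S. ketbra (basis_ket (Inr (f k))) i j) / of_nat (card (Keys S)))
      in (\<lambda>i j. tensor (embed_msg (ampl S_acc \<rho>)) \<tau> i j
             + tensor (bot_msg (S_rej (ptrace1 (Msg S) \<rho>))) \<tau>' i j))"

definition qca_r :: "('k, 'm, 't, 'i) scheme \<Rightarrow> ('k \<Rightarrow> 'l) \<Rightarrow> real \<Rightarrow> bool" where
  "qca_r S f \<delta> \<longleftrightarrow>
     encryption_scheme S \<and>
     (\<forall>d::nat. 0 < d \<longrightarrow> (let R = {..<d}; MTR = (Msg S \<times> Tag S) \<times> R in
        \<forall>\<A>. cptp_map MTR MTR \<A> \<longrightarrow>
          (\<exists>S_rej. cp_map R R S_rej \<and>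
             trace_preserving R R (\<lambda>\<rho> i j. sim_acc S R \<A> \<rho> i j + S_rej \<rho> i j) \<and>
             diamond_dist (Msg S \<times> R) (out_reg S f R)
               (real_channel S f R \<A>) (ideal_channel S f R (sim_acc S R \<A>) S_rej) \<le> \<delta>)))"


subsection \<open>The canonical construction\<close>

text \<open>Regards an operator on \<open>m + t\<close> qubits as one on the pair of an \<open>m\<close>- and a \<open>t\<close>-qubit register.\<close>

definition split_reg ::
    "nat \<Rightarrow> nat \<Rightarrow> (bool list, bool list) opr
     \<Rightarrow> (bool list \<times> bool list, bool list \<times> bool list) opr" where
  "split_reg m t X = (\<lambda>(a, b) (a', b').
     if (a, b) \<in> bits m \<times> bits t \<and> (a', b') \<in> bits m \<times> bits t then X (a @ b) (a' @ b') else 0)"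

definition canonical_scheme ::
    "nat \<Rightarrow> nat \<Rightarrow> 'k set \<Rightarrow> ('k \<Rightarrow> (bool list, bool list) opr) \<Rightarrow>
     ('k \<times> bool list, bool list, bool list, unit) scheme" where
  "canonical_scheme m t K V =
     \<lparr> Keys = K \<times> bits (2 * (m + t)),
       Msg = bits m,
       Tag = bits t,
       Enc = (\<lambda>(k1, k2). split_reg m t (mul (bits (m + t)) (pauli (m + t) k2) (V k1))),
       Idx = (\<lambda>_. {()}),
       Prob = (\<lambda>_ _. 1),
       TagKet = (\<lambda>_ _. basis_ket (replicate t False)) \<rparr>"

end

theory Submission
  imports Defs
begin

text \<open>
  Expand the Kraus operators of the attack as \<open>\<Sum>\<^sub>l P\<^sub>l \<otimes> E\<^sub>l\<close> in the Pauli basis, where \<open>P\<^sub>0\<close> is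
  the identity. After decryption with the key \<open>(k\<^sub>1, k\<^sub>2)\<close> the error \<open>P\<^sub>l\<close> appears as
  \<open>\<plusminus> V\<^sup>\<dagger> P\<^sub>l V\<close>, with a sign that is a character of \<open>k\<^sub>2\<close>, and its accepted part \<open>W\<^sub>l\<close> is either \<open>0\<close> or
  unitary. Hence averaging over \<open>k\<^sub>2\<close> decouples distinct errors; for \<open>l \<noteq> 0\<close> an error is accepted
  with probability at most \<open>\<epsilon>\<close> over \<open>k\<^sub>1\<close>, and the same bound holds for its weight \<open>s\<^sub>l\<close> in the
  ideal accepting map. The ideal rejecting map gives \<open>P\<^sub>l\<close> the weight \<open>1 - s\<^sub>l\<close>.

  On acceptance \<open>k\<^sub>2\<close> is kept, so that the cross terms between the error-free part \<open>E\<^sub>0\<close> and the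
  accepted errors \<open>H\<close> survive. As completely positive maps they are dominated by
  \<open>c E\<^sub>0 \<rho> E\<^sub>0\<^sup>\<dagger> + H \<rho> H\<^sup>\<dagger> / c\<close>, and \<open>c = \<surd>\<epsilon>\<close> balances the two. A map dominated in this
  order has diamond norm at most the largest trace of the dominating map, so that no purification is
  needed; the total is \<open>\<surd>\<epsilon> / 2 + 2 \<epsilon>\<close>, which suffices for \<open>\<epsilon> \<le> 1\<close>. For larger \<open>\<epsilon>\<close> the code is
  strong purity testing with error \<open>1\<close>, and \<open>\<epsilon> = 0\<close> is obtained as a limit.
\<close>

subsection \<open>The spectral theorem\<close>

text \<open>The sum over \<open>k2\<close> decouples errors at two levels. On rejection only
  \<open>k1\<close> survives, so it acts on the output operator itself. On acceptance every key
  labels its own block and the superposition of errors persists there; but the bound needs only the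
  trace of the dominating map, in which the blocks add up, and there the characters cancel again.
  \<open>W\<close> is zero or unitary because a Pauli code turns an error into a phase times one
  Pauli: on the zero tag a bit flip is always caught, phase flips act trivially, and a Pauli on the
  message remains. The weight in the ideal accepting map is an EPR fidelity, the mean of the squared
  normalised trace of \<open>W\<close>, which Cauchy-Schwarz compares with acceptance. For an error
  other than the identity the trace bound collects \<open>1 / c\<close> times its acceptance
  probability from the cross terms, that probability once from the accepted errors and once from
  rejection, and the ideal accepting weight twice. With \<open>c = sqrt \<epsilon>\<close> this is
  at most \<open>sqrt \<epsilon> + 4 * \<epsilon>\<close>, which the diamond distance halves. The
  excess of \<open>2 * \<epsilon>\<close> over \<open>3 / 2 * \<epsilon>\<close> is covered by the
  other half of \<open>sqrt \<epsilon>\<close>, as \<epsilon> \<le> sqrt \<epsilon> for \<epsilon>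
  \<le> 1.\<close>

lemma inner_ket_add_right: "inner_ket A u (\<lambda>a. v a + w a) = inner_ket A u v + inner_ket A u w"
  by (simp add: inner_ket_def sum.distrib algebra_simps)

lemma inner_ket_add_left: "inner_ket A (\<lambda>a. v a + w a) u = inner_ket A v u + inner_ket A w u"
  by (simp add: inner_ket_def sum.distrib algebra_simps)

lemma inner_ket_scale_right: "inner_ket A u (\<lambda>a. c * v a) = c * inner_ket A u v"
  by (simp add: inner_ket_def sum_distrib_left algebra_simps)

lemma inner_ket_scale_left: "inner_ket A (\<lambda>a. c * v a) u = cnj c * inner_ket A v u"
  by (simp add: inner_ket_def sum_distrib_left algebra_simps)

lemma inner_ket_commute: "inner_ket A v u = cnj (inner_ket A u v)"
  by (simp add: inner_ket_def mult.commute)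

lemma inner_ket_self: "inner_ket A v v = complex_of_real (\<Sum>a\<in>A. (cmod (v a))\<^sup>2)"
  by (simp add: inner_ket_def complex_norm_square mult.commute del: of_real_power)

lemma Re_inner_ket_self_nonneg: "0 \<le> Re (inner_ket A v v)"
  by (simp add: inner_ket_self sum_nonneg)

lemma inner_ket_self_eq_0:
  assumes "finite A" "v \<in> kets A" "inner_ket A v v = 0"
  shows "v = (\<lambda>_. 0)"
proof
  fix a
  have "(\<Sum>a\<in>A. (cmod (v a))\<^sup>2) = 0"
    using assms(3) by (simp only: inner_ket_self of_real_eq_0_iff)
  then show "v a = 0"
    using assms(1,2) by (cases "a \<in> A") (auto simp: sum_nonneg_eq_0_iff kets_def)
qed

lemma app_ket_add: "app_ket A X (\<lambda>a. v a + w a) = (\<lambda>a. app_ket A X v a + app_ket A X w a)"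
  by (simp add: app_ket_def sum.distrib algebra_simps)

lemma app_ket_scale: "app_ket A X (\<lambda>a. c * v a) = (\<lambda>a. c * app_ket A X v a)"
  by (simp add: app_ket_def sum_distrib_left algebra_simps)

lemma inner_ket_app: "inner_ket A v (app_ket A X w) = inner_ket A (app_ket A (dagger X) v) w"
proof -
  have "inner_ket A v (app_ket A X w) = (\<Sum>i\<in>A. \<Sum>j\<in>A. cnj (v i) * X i j * w j)"
    by (simp add: inner_ket_def app_ket_def sum_distrib_left mult.assoc)
  also have "\<dots> = (\<Sum>j\<in>A. \<Sum>i\<in>A. cnj (v i) * X i j * w j)"
    by (rule sum.swap)
  also have "\<dots> = inner_ket A (app_ket A (dagger X) v) w"
    by (simp add: inner_ket_def app_ket_def dagger_def sum_distrib_right sum_distrib_left mult_ac)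
  finally show ?thesis .
qed

text \<open>Kets are functions on the whole index type, so the topology is that of pointwise
  convergence. The set is a closed part of a product of unit discs over \<open>A\<close> and of
  points elsewhere, which is compact by Tychonoff's theorem.\<close>

lemma compact_unit_kets:
  assumes "finite A"
  shows "compact {w \<in> kets A. (\<forall>i<n. inner_ket A (v i) w = 0) \<and> inner_ket A w w = 1}" (is "compact ?S")
proof -
  let ?B = "PiE UNIV (\<lambda>a. if a \<in> A then cball (0::complex) 1 else {0})"
  have "compactin euclidean ?B"
    unfolding euclidean_product_topology[symmetric] compactin_PiE by auto
  then have "compact ?B" by (simp only: compactin_euclidean_iff)
  moreover have "closed ?S"
  proof -
    have "?S = (\<Inter>a\<in>-A. {w. w a = 0}) \<inter> (\<Inter>i\<in>{..<n}. {w. inner_ket A (v i) w = 0})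
        \<inter> {w. inner_ket A w w = 1}"
      by (auto simp: kets_def)
    moreover have "closed {w::'a \<Rightarrow> complex. w a = 0}" for a
      by (intro closed_Collect_eq continuous_intros) auto
    moreover have "closed {w. inner_ket A (v i) w = 0}" for i
      unfolding inner_ket_def by (intro closed_Collect_eq continuous_intros) auto
    moreover have "closed {w. inner_ket A w w = 1}"
      unfolding inner_ket_def by (intro closed_Collect_eq continuous_intros) auto
    ultimately show ?thesis by (auto intro!: closed_INT closed_Int)
  qed
  moreover have "?S \<subseteq> ?B"
  proof
    fix w assume w: "w \<in> ?S"
    have "cmod (w a) \<le> 1" if "a \<in> A" for a
    proof -
      have "(\<Sum>a\<in>A. (cmod (w a))\<^sup>2) = 1"
        using w by (simp only: inner_ket_self of_real_eq_1_iff mem_Collect_eq)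
      moreover have "(cmod (w a))\<^sup>2 \<le> (\<Sum>a\<in>A. (cmod (w a))\<^sup>2)"
        using assms that by (intro member_le_sum) auto
      ultimately show ?thesis using abs_square_le_1[of "cmod (w a)"] by simp
    qed
    then show "w \<in> ?B" using w by (auto simp: kets_def)
  qed
  ultimately show ?thesis using compact_Int_closed[of ?B ?S] Int_absorb1[of ?S ?B] by simp
qed

text \<open>
  The new eigenvector maximises the quadratic form on the unit sphere of the orthogonal complement
  of the given ones.
\<close>

lemma eigenvector_in_complement:
  assumes fin: "finite A" and X: "X \<in> ops A A" and herm: "dagger X = X"
    and ev: "\<And>i. i < n \<Longrightarrow> app_ket A X (v i) = (\<lambda>a. complex_of_real (l i) * v i a)"
    and u: "u \<in> kets A" "u \<noteq> (\<lambda>_. 0)" "\<And>i. i < n \<Longrightarrow> inner_ket A (v i) u = 0"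
  shows "\<exists>w (\<mu>::real). w \<in> kets A \<and> inner_ket A w w = 1 \<and> (\<forall>i<n. inner_ket A (v i) w = 0) \<and>
    app_ket A X w = (\<lambda>a. complex_of_real \<mu> * w a)"
proof -
  define W where "W = {w \<in> kets A. \<forall>i<n. inner_ket A (v i) w = 0}"
  let ?S = "{w \<in> kets A. (\<forall>i<n. inner_ket A (v i) w = 0) \<and> inner_ket A w w = 1}"
  define f where "f = (\<lambda>w. Re (inner_ket A w (app_ket A X w)))"
  have normalize: "\<exists>w'\<in>?S. f w = Re (inner_ket A w w) * f w' \<and> 0 < Re (inner_ket A w w)"
    if w: "w \<in> W" "w \<noteq> (\<lambda>_. 0)" for w
  proof -
    define c where "c = Re (inner_ket A w w)"
    have cc: "inner_ket A w w = complex_of_real c" by (simp add: c_def inner_ket_self)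
    have "c \<noteq> 0" using w cc inner_ket_self_eq_0[OF fin, of w] by (auto simp: W_def)
    moreover have "c \<ge> 0" by (simp add: c_def Re_inner_ket_self_nonneg)
    ultimately have c: "c > 0" by simp
    define w' where "w' = (\<lambda>a. complex_of_real (1 / sqrt c) * w a)"
    have "inner_ket A w' w' = complex_of_real ((1 / sqrt c) * (1 / sqrt c) * c)"
      unfolding w'_def inner_ket_scale_left inner_ket_scale_right cc by (simp only: of_real_mult complex_cnj_complex_of_real mult.assoc)
    also have "(1 / sqrt c) * (1 / sqrt c) * c = 1" using c by (simp add: field_simps)
    finally have 1: "inner_ket A w' w' = 1" by simp
    have "w' \<in> ?S" using w 1 unfolding W_def w'_def by (simp add: inner_ket_scale_right kets_def del: of_real_divide)
    moreover have "f w = c * f w'"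
    proof -
      have "f w' = Re (complex_of_real ((1 / sqrt c) * (1 / sqrt c)) * inner_ket A w (app_ket A X w))"
        unfolding f_def w'_def app_ket_scale inner_ket_scale_left inner_ket_scale_right by simp
      also have "\<dots> = (1 / sqrt c) * (1 / sqrt c) * f w" by (simp only: Re_complex_of_real Re_complex_of_real f_def times_complex.sel Im_complex_of_real mult_zero_left diff_0_right)
      also have "\<dots> = f w / c" using c by (simp add: field_simps)
      finally show ?thesis using c by simp
    qed
    ultimately show ?thesis using c c_def by blast
  qed
  have uW: "u \<in> W" using u by (simp add: W_def)
  then have "?S \<noteq> {}" using normalize u(2) by blast
  moreover have "continuous_on ?S f"
    unfolding f_def inner_ket_def app_ket_def
    by (intro continuous_intros) (auto intro: continuous_on_subset[OF continuous_on_product_coordinates])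
  ultimately obtain w where w: "w \<in> ?S" and max: "\<And>y. y \<in> ?S \<Longrightarrow> f y \<le> f w"
    using continuous_attains_sup[OF compact_unit_kets[OF fin, of n v]] by blast
  define \<mu> where "\<mu> = f w"
  \<comment> \<open>By maximality the form of \<open>\<mu> - X\<close> is nonnegative on
    \<open>W\<close> and vanishes at \<open>w\<close>. A zero of a nonnegative Hermitian form lies
    in its kernel, which is the eigenvalue equation.\<close>
  define M where "M = (\<lambda>y a. complex_of_real \<mu> * y a - app_ket A X y a)"
  have Madd: "M (\<lambda>a. y a + z a) = (\<lambda>a. M y a + M z a)" for y z
    by (auto simp: M_def app_ket_add algebra_simps)
  have Mscale: "M (\<lambda>a. c * y a) = (\<lambda>a. c * M y a)" for y c
    by (auto simp: M_def app_ket_scale algebra_simps)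
  have innerM: "inner_ket A y (M z) = complex_of_real \<mu> * inner_ket A y z - inner_ket A y (app_ket A X z)" for y z
    by (simp add: M_def inner_ket_def algebra_simps sum_subtractf sum_distrib_left)
  have Msym: "inner_ket A y (M z) = inner_ket A (M y) z" for y z
  proof -
    have "inner_ket A (M y) z = cnj (inner_ket A z (M y))" by (rule inner_ket_commute)
    also have "\<dots> = complex_of_real \<mu> * inner_ket A y z - cnj (inner_ket A z (app_ket A X y))"
      by (simp add: innerM inner_ket_commute[of A y z])
    also have "cnj (inner_ket A z (app_ket A X y)) = inner_ket A y (app_ket A X z)"
      by (metis herm inner_ket_app inner_ket_commute)
    finally show ?thesis by (simp add: innerM)
  qed
  have Mpos: "0 \<le> Re (inner_ket A y (M y))" if yW: "y \<in> W" for y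
  proof (cases "y = (\<lambda>_. 0)")
    case True then show ?thesis by (simp add: inner_ket_def)
  next
    case False
    obtain y' where y': "y' \<in> ?S" "f y = Re (inner_ket A y y) * f y'" "0 < Re (inner_ket A y y)"
      using normalize[OF yW False] by blast
    have "f y \<le> \<mu> * Re (inner_ket A y y)"
      using y' max[OF y'(1)] by (simp add: \<mu>_def mult.commute)
    then show ?thesis by (simp add: innerM f_def inner_ket_self)
  qed
  have M0: "Re (inner_ket A w (M w)) = 0" using w by (simp add: innerM \<mu>_def f_def)
  define z where "z = M w"
  have wW: "w \<in> W" using w by (simp add: W_def)
  have zW: "z \<in> W"
  proof -
    have "z \<in> kets A" using w X by (auto simp: z_def M_def kets_def ops_def app_ket_def)
    moreover have "inner_ket A (v i) z = 0" if "i < n" for i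
    proof -
      have "inner_ket A (v i) (app_ket A X w) = inner_ket A (app_ket A X (v i)) w"
        by (metis herm inner_ket_app)
      also have "\<dots> = 0" using ev[OF that] w that by (simp add: inner_ket_scale_left)
      finally show ?thesis using w that by (simp add: z_def innerM)
    qed
    ultimately show ?thesis by (simp add: W_def)
  qed
  define N where "N = Re (inner_ket A z (M z))"
  define q where "q = Re (inner_ket A z z)"
  \<comment> \<open>The form is tested at \<open>w - s z\<close> with \<open>z = M w\<close>. The
    linear term is \<open>- 2 * s * q\<close> because \<open>M\<close> is symmetric, so a positive
    \<open>q\<close> would be contradicted by a small \<open>s\<close>.\<close>
  have ineq: "2 * q \<le> s * N" if s: "s > 0" for s
  proof -
    let ?c = "complex_of_real (- s)"
    let ?y = "\<lambda>a. w a + ?c * z a"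
    have "?y \<in> W" using wW zW
      by (auto simp: W_def kets_def inner_ket_add_right inner_ket_scale_right simp del: of_real_minus)
    from Mpos[OF this] have "0 \<le> Re (inner_ket A ?y (M ?y))" .
    also have "inner_ket A ?y (M ?y) = inner_ket A w (M w) + ?c * inner_ket A w (M z)
        + ?c * inner_ket A z (M w) + ?c * ?c * inner_ket A z (M z)"
      unfolding Madd Mscale inner_ket_add_left inner_ket_add_right inner_ket_scale_left inner_ket_scale_right
      by (simp add: algebra_simps)
    also have "Re \<dots> = - 2 * s * q + s * s * N"
      unfolding Msym[of w z] using M0 by (simp add: z_def[symmetric] q_def N_def)
    finally have "0 \<le> s * (s * N - 2 * q)" by (simp add: algebra_simps)
    then show ?thesis using s by (simp add: zero_le_mult_iff)
  qed
  have "q \<le> 0"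
  proof (rule ccontr)
    assume "\<not> q \<le> 0"
    then have q: "q > 0" by simp
    have N: "N \<ge> 0" unfolding N_def using Mpos[OF zW] .
    \<comment> \<open>The shift by one keeps the denominator positive when
      \<open>N = 0\<close>.\<close>
    have "2 * q \<le> q / (N + 1) * N" using N q by (intro ineq) simp
    also have "\<dots> \<le> q" using N q by (simp add: field_simps)
    finally show False using q by simp
  qed
  then have "inner_ket A z z = 0"
    using Re_inner_ket_self_nonneg[of A z] by (simp add: q_def inner_ket_self)
  then have "z = (\<lambda>_. 0)" using zW by (intro inner_ket_self_eq_0[OF fin]) (auto simp: W_def)
  then have "app_ket A X w = (\<lambda>a. complex_of_real \<mu> * w a)"
    by (auto simp: z_def M_def fun_eq_iff)
  then show ?thesis using w by blast
qed

text \<open>Bessel's inequality for each basis ket bounds the squared entries of the family at that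
  index by one; adding over \<open>A\<close> and exchanging the sums counts the vectors.\<close>

lemma orthonormal_family_le_card:
  assumes fin: "finite A" and on: "\<And>i j. i < n \<Longrightarrow> j < n \<Longrightarrow> inner_ket A (v i) (v j) = of_bool (i = j)"
  shows "n \<le> card A"
proof -
  have bessel: "(\<Sum>i<n. (cmod (v i a))\<^sup>2) \<le> 1" if a: "a \<in> A" for a
  proof -
    \<comment> \<open>The projection of the basis ket at \<open>a\<close> onto the span of the
      family.\<close>
    define p where "p = (\<lambda>b. \<Sum>i<n. v i b * cnj (v i a))"
    have e: "inner_ket A (\<lambda>b. of_bool (b = a)) y = y a" for y
    proof -
      have "inner_ket A (\<lambda>b. of_bool (b = a)) y = (\<Sum>b\<in>A. if b = a then y b else 0)"
        unfolding inner_ket_def by (intro sum.cong) auto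
      then show ?thesis using fin a by simp
    qed
    have pr: "inner_ket A y p = (\<Sum>i<n. inner_ket A y (v i) * cnj (v i a))" for y
    proof -
      have "inner_ket A y p = (\<Sum>b\<in>A. \<Sum>i<n. cnj (y b) * v i b * cnj (v i a))"
        by (simp add: inner_ket_def p_def sum_distrib_left mult.assoc)
      also have "\<dots> = (\<Sum>i<n. \<Sum>b\<in>A. cnj (y b) * v i b * cnj (v i a))" by (rule sum.swap)
      finally show ?thesis by (simp add: inner_ket_def sum_distrib_right)
    qed
    have vp: "inner_ket A p (v i) = v i a" if "i < n" for i
    proof -
      have "inner_ket A (v i) p = (\<Sum>j<n. of_bool (i = j) * cnj (v j a))"
        unfolding pr using that on by (intro sum.cong) auto
      also have "\<dots> = cnj (v i a)" using that by simp
      finally show ?thesis using inner_ket_commute[of A p "v i"] by simp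
    qed
    have pp: "inner_ket A p p = p a"
      unfolding pr by (simp add: vp) (simp add: p_def)
    let ?d = "\<lambda>b. of_bool (b = a) + (-1) * p b"
    have "inner_ket A ?d ?d = 1 - p a - cnj (p a) + inner_ket A p p"
      unfolding inner_ket_add_left inner_ket_add_right inner_ket_scale_left inner_ket_scale_right e
      by (subst inner_ket_commute[of A p]) (simp add: e)
    moreover have "p a = complex_of_real (\<Sum>i<n. (cmod (v i a))\<^sup>2)"
      unfolding p_def by (simp add: complex_norm_square del: of_real_power)
    ultimately have "Re (inner_ket A ?d ?d) = 1 - (\<Sum>i<n. (cmod (v i a))\<^sup>2)"
      using pp by simp
    then show ?thesis using Re_inner_ket_self_nonneg[of A ?d] by simp
  qed
  have "real n = (\<Sum>i<n. \<Sum>a\<in>A. (cmod (v i a))\<^sup>2)"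
  proof -
    have "(\<Sum>a\<in>A. (cmod (v i a))\<^sup>2) = 1" if "i < n" for i
      using on[OF that that] by (simp only: inner_ket_self) (metis of_bool_eq(2) of_real_eq_1_iff)
    then show ?thesis by simp
  qed
  also have "\<dots> = (\<Sum>a\<in>A. \<Sum>i<n. (cmod (v i a))\<^sup>2)" by (rule sum.swap)
  also have "\<dots> \<le> (\<Sum>a\<in>A. 1)" using bessel by (intro sum_mono)
  finally show ?thesis by simp
qed

text \<open>The family may be incomplete, so that one of maximal length can be chosen in the
  spectral theorem.\<close>

definition eigensystem :: "'a set \<Rightarrow> ('a, 'a) opr \<Rightarrow> nat \<Rightarrow> (nat \<Rightarrow> 'a \<Rightarrow> complex) \<Rightarrow> (nat \<Rightarrow> real) \<Rightarrow> bool" where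
  "eigensystem A X n v l \<longleftrightarrow>
     (\<forall>i<n. v i \<in> kets A \<and> app_ket A X (v i) = (\<lambda>a. complex_of_real (l i) * v i a)) \<and>
     (\<forall>i<n. \<forall>j<n. inner_ket A (v i) (v j) = of_bool (i = j))"

text \<open>A longest orthonormal family of eigenvectors exists since its length is at most
  \<open>card A\<close>. A nonzero vector orthogonal to it would yield a further eigenvector, so
  only zero is orthogonal to it, which gives the resolution of the identity; multiplying that by
  \<open>X\<close> gives the second formula.\<close>

theorem spectral:
  assumes fin: "finite A" and X: "X \<in> ops A A" and herm: "dagger X = X"
  obtains n v l where "eigensystem A X n v l"
    and "id_op A = (\<lambda>a b. \<Sum>i<n. v i a * cnj (v i b))"
    and "X = (\<lambda>a b. \<Sum>i<n. complex_of_real (l i) * (v i a * cnj (v i b)))"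
proof -
  define P where "P = (\<lambda>n. \<exists>v l. eigensystem A X n v l)"
  have "P 0" by (simp add: P_def eigensystem_def)
  moreover have bnd: "k \<le> card A" if kP: "P k" for k
  proof -
    from kP obtain v l where "eigensystem A X k v l" unfolding P_def by blast
    then show ?thesis by (intro orthonormal_family_le_card[OF fin, of k v]) (auto simp: eigensystem_def)
  qed
  ultimately have "P (GREATEST k. P k)" using GreatestI_nat[of P 0 "card A"] by blast
  moreover have "k \<le> (GREATEST k. P k)" if "P k" for k
    using that bnd Greatest_le_nat[of P k "card A"] by blast
  ultimately obtain n where "P n" and maxn: "\<And>k. P k \<Longrightarrow> k \<le> n" by blast
  then obtain v l where es: "eigensystem A X n v l" by (auto simp: P_def)
  have complete: "u = (\<lambda>_. 0)" if u: "u \<in> kets A" "\<And>i. i < n \<Longrightarrow> inner_ket A (v i) u = 0" for u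
  proof (rule ccontr)
    assume "u \<noteq> (\<lambda>_. 0)"
    with eigenvector_in_complement[OF fin X herm, of n v l u] u es
    obtain w \<mu> where w: "w \<in> kets A" "inner_ket A w w = 1" "\<forall>i<n. inner_ket A (v i) w = 0"
      "app_ket A X w = (\<lambda>a. complex_of_real \<mu> * w a)" by (auto simp: eigensystem_def)
    have "\<forall>i<n. inner_ket A w (v i) = 0" using w(3) by (metis complex_cnj_zero inner_ket_commute)
    then have "eigensystem A X (Suc n) (v(n := w)) (l(n := \<mu>))"
      using es w by (auto simp: eigensystem_def less_Suc_eq)
    then have "P (Suc n)" by (auto simp: P_def)
    with maxn[of "Suc n"] show False by simp
  qed
  have ketv: "v i a = 0" if "i < n" "a \<notin> A" for i a
    using es that by (auto simp: eigensystem_def kets_def)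
  have on: "inner_ket A (v i) (v j) = of_bool (i = j)" if "i < n" "j < n" for i j
    using es that by (auto simp: eigensystem_def)
  have idA: "id_op A = (\<lambda>a b. \<Sum>i<n. v i a * cnj (v i b))"
  proof (intro ext)
    fix a b
    show "id_op A a b = (\<Sum>i<n. v i a * cnj (v i b))"
    proof (cases "b \<in> A")
      case False
      then show ?thesis using ketv by (auto simp: id_op_def)
    next
      case b: True
      \<comment> \<open>Column \<open>b\<close> of the identity minus its projection onto the
        family. It is orthogonal to every member, hence zero.\<close>
      define u where "u = (\<lambda>a. id_op A a b - (\<Sum>i<n. v i a * cnj (v i b)))"
      have "u \<in> kets A" using ketv b by (auto simp: u_def kets_def id_op_def)
      moreover have "inner_ket A (v j) u = 0" if j: "j < n" for j
      proof -
        have "inner_ket A (v j) u = (\<Sum>a\<in>A. cnj (v j a) * id_op A a b)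
            - (\<Sum>a\<in>A. \<Sum>i<n. cnj (v j a) * (v i a * cnj (v i b)))"
          by (simp add: inner_ket_def u_def right_diff_distrib sum_subtractf sum_distrib_left)
        also have "(\<Sum>a\<in>A. cnj (v j a) * id_op A a b) = cnj (v j b)"
          using b fin by (simp add: id_op_def of_bool_def if_distrib cong: if_cong)
        also have "(\<Sum>a\<in>A. \<Sum>i<n. cnj (v j a) * (v i a * cnj (v i b)))
            = (\<Sum>i<n. \<Sum>a\<in>A. cnj (v j a) * (v i a * cnj (v i b)))" by (rule sum.swap)
        also have "\<dots> = (\<Sum>i<n. inner_ket A (v j) (v i) * cnj (v i b))"
          by (simp add: inner_ket_def sum_distrib_right mult.assoc)
        also have "\<dots> = (\<Sum>i<n. of_bool (j = i) * cnj (v i b))"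
          using j on by (intro sum.cong) auto
        also have "\<dots> = cnj (v j b)" using j by simp
        finally show ?thesis by simp
      qed
      ultimately have "u = (\<lambda>_. 0)" by (rule complete)
      then have "u a = 0" by simp
      then show ?thesis by (simp add: u_def)
    qed
  qed
  have "X = (\<lambda>a b. \<Sum>i<n. complex_of_real (l i) * (v i a * cnj (v i b)))"
  proof (intro ext)
    fix a b
    show "X a b = (\<Sum>i<n. complex_of_real (l i) * (v i a * cnj (v i b)))"
    proof (cases "b \<in> A")
      case False
      then show ?thesis using ketv X by (auto simp: ops_def)
    next
      case b: True
      have "X a b = (\<Sum>c\<in>A. X a c * id_op A c b)"
        using b fin by (simp add: id_op_def of_bool_def if_distrib cong: if_cong)
      also have "\<dots> = (\<Sum>c\<in>A. \<Sum>i<n. X a c * (v i c * cnj (v i b)))"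
        by (simp add: idA sum_distrib_left)
      also have "\<dots> = (\<Sum>i<n. \<Sum>c\<in>A. X a c * (v i c * cnj (v i b)))" by (rule sum.swap)
      also have "\<dots> = (\<Sum>i<n. app_ket A X (v i) a * cnj (v i b))"
        by (simp add: app_ket_def sum_distrib_right mult.assoc)
      also have "\<dots> = (\<Sum>i<n. complex_of_real (l i) * (v i a * cnj (v i b)))"
        using es by (intro sum.cong) (auto simp: eigensystem_def mult.assoc)
      finally show ?thesis .
    qed
  qed
  with es idA that show ?thesis by blast
qed

subsection \<open>Positive semidefinite operators and the trace norm\<close>

lemma psd_iff_inner_ket:
  "psd A X \<longleftrightarrow> X \<in> ops A A \<and> (\<forall>v. inner_ket A v (app_ket A X v) \<in> \<real>\<^sub>\<ge>\<^sub>0)"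
  by (simp add: psd_def inner_ket_def app_ket_def sum_distrib_left mult.assoc)

lemma psd_opsD: "psd A X \<Longrightarrow> X \<in> ops A A"
  by (simp add: psd_def)

lemma psd_inner_nonneg:
  assumes "psd A X"
  shows "0 \<le> Re (inner_ket A v (app_ket A X v))" "Im (inner_ket A v (app_ket A X v)) = 0"
  using assms by (simp_all add: psd_iff_inner_ket complex_nonneg_Reals_iff)

lemma inner_ket_basis:
  assumes "finite A" "a \<in> A"
  shows "inner_ket A (basis_ket a) v = v a" "app_ket A X (basis_ket a) = (\<lambda>i. X i a)"
proof -
  have "inner_ket A (basis_ket a) v = (\<Sum>i\<in>A. if i = a then v i else 0)"
    unfolding inner_ket_def basis_ket_def by (intro sum.cong) auto
  then show "inner_ket A (basis_ket a) v = v a" using assms by simp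
  show "app_ket A X (basis_ket a) = (\<lambda>i. X i a)"
  proof
    fix i
    have "app_ket A X (basis_ket a) i = (\<Sum>j\<in>A. if j = a then X i j else 0)"
      unfolding app_ket_def basis_ket_def by (intro sum.cong) auto
    then show "app_ket A X (basis_ket a) i = X i a" using assms by simp
  qed
qed

text \<open>Symmetry is not part of \<open>psd\<close>. It follows by polarisation: the form is real
  at \<open>e_a + c e_b\<close>, and \<open>c = 1\<close> and \<open>c = \<i>\<close> control the
  imaginary and the real parts of the two off-diagonal entries.\<close>

lemma psd_hermitian:
  assumes fin: "finite A" and X: "psd A X"
  shows "dagger X = X"
proof (intro ext)
  fix a b
  show "dagger X a b = X a b"
  proof (cases "a \<in> A \<and> b \<in> A")
    case False
    then show ?thesis using psd_opsD[OF X] by (auto simp: dagger_def ops_def)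
  next
    case True
    have q: "Im (X a a + c * X a b + cnj c * X b a + cnj c * c * X b b) = 0" for c
    proof -
      let ?v = "\<lambda>i. basis_ket a i + c * basis_ket b i"
      have "inner_ket A ?v (app_ket A X ?v) = X a a + c * X a b + cnj c * X b a + cnj c * c * X b b"
        using True fin
        by (simp add: inner_ket_add_left inner_ket_scale_left app_ket_add app_ket_scale inner_ket_basis algebra_simps)
      then show ?thesis using psd_inner_nonneg(2)[OF X, of ?v] by simp
    qed
    have "Im (X a a) = 0" "Im (X b b) = 0"
      using psd_inner_nonneg(2)[OF X, of "basis_ket a"] psd_inner_nonneg(2)[OF X, of "basis_ket b"] True fin
      by (simp_all add: inner_ket_basis)
    with q[of 1] q[of \<i>] show ?thesis by (simp add: dagger_def complex_eq_iff)
  qed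
qed

lemma psd_add: "psd A X \<Longrightarrow> psd A Y \<Longrightarrow> psd A (\<lambda>i j. X i j + Y i j)"
  unfolding psd_def by (auto simp: ops_def algebra_simps sum.distrib)

lemma psd_scale: "0 \<le> c \<Longrightarrow> psd A X \<Longrightarrow> psd A (\<lambda>i j. complex_of_real c * X i j)"
proof -
  assume c: "0 \<le> c" and X: "psd A X"
  have "(\<Sum>i\<in>A. \<Sum>j\<in>A. cnj (v i) * (complex_of_real c * X i j) * v j)
      = complex_of_real c * (\<Sum>i\<in>A. \<Sum>j\<in>A. cnj (v i) * X i j * v j)" for v
    by (simp add: sum_distrib_left mult_ac)
  then show ?thesis
    using c X by (auto simp: psd_def ops_def complex_nonneg_Reals_iff)
qed

lemma psd_sum: "(\<And>s. s \<in> S \<Longrightarrow> psd A (X s)) \<Longrightarrow> psd A (\<lambda>i j. \<Sum>s\<in>S. X s i j)"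
proof (induction S rule: infinite_finite_induct)
  case (insert x F)
  then have "psd A (\<lambda>i j. X x i j + (\<Sum>s\<in>F. X s i j))" by (intro psd_add) auto
  then show ?case using insert by simp
qed (auto simp: psd_def ops_def)

lemma psd_ketbra:
  assumes "v \<in> kets A"
  shows "psd A (ketbra v)"
proof -
  have "(\<Sum>i\<in>A. \<Sum>j\<in>A. cnj (w i) * ketbra v i j * w j) = inner_ket A w v * cnj (inner_ket A w v)" for w
    by (simp add: ketbra_def inner_ket_def sum_product mult_ac)
  then show ?thesis using assms
    by (auto simp: psd_def ops_def kets_def ketbra_def complex_nonneg_Reals_iff)
qed

lemma cnj_of_bool [simp]: "cnj (of_bool P) = of_bool P"
  by (cases P) auto

text \<open>The eigenvalues are nonnegative, and their square roots are absorbed into the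
  eigenvectors, which are therefore not normalised.\<close>

lemma psd_decompose:
  assumes fin: "finite A" and X: "psd A X"
  obtains n :: nat and w where "\<And>s. w s \<in> kets A" "X = (\<lambda>a b. \<Sum>s<n. ketbra (w s) a b)"
proof -
  obtain n v l where es: "eigensystem A X n v l"
    and "id_op A = (\<lambda>a b. \<Sum>i<n. v i a * cnj (v i b))"
    and Xs: "X = (\<lambda>a b. \<Sum>i<n. complex_of_real (l i) * (v i a * cnj (v i b)))"
    by (rule spectral[OF fin psd_opsD[OF X] psd_hermitian[OF fin X]])
  have l: "0 \<le> l i" if "i < n" for i
  proof -
    have "inner_ket A (v i) (app_ket A X (v i)) = complex_of_real (l i)"
      using es that by (simp add: eigensystem_def inner_ket_scale_right)
    then show ?thesis using psd_inner_nonneg(1)[OF X, of "v i"] by simp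
  qed
  define w where "w = (\<lambda>i a. if i < n then complex_of_real (sqrt (l i)) * v i a else 0)"
  have "w s \<in> kets A" for s using es by (auto simp: w_def eigensystem_def kets_def)
  moreover have "X = (\<lambda>a b. \<Sum>s<n. ketbra (w s) a b)"
  proof -
    have "complex_of_real (l i) * (v i a * cnj (v i b)) = ketbra (w i) a b" if "i \<in> {..<n}" for i a b
    proof -
      have "ketbra (w i) a b = complex_of_real (sqrt (l i) * sqrt (l i)) * (v i a * cnj (v i b))"
        using that by (simp add: w_def ketbra_def del: real_sqrt_mult_self)
      also have "sqrt (l i) * sqrt (l i) = l i" using l that by simp
      finally show ?thesis by simp
    qed
    then show ?thesis unfolding Xs by (intro ext sum.cong refl)
  qed
  ultimately show ?thesis by (rule that[of w n])
qed

lemma app_ket_mul: "app_ket A (mul A S T) v = app_ket A S (app_ket A T v)"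
proof
  fix i
  have "app_ket A (mul A S T) v i = (\<Sum>j\<in>A. \<Sum>k\<in>A. S i k * T k j * v j)"
    by (simp add: app_ket_def mul_def sum_distrib_right)
  also have "\<dots> = (\<Sum>k\<in>A. \<Sum>j\<in>A. S i k * T k j * v j)" by (rule sum.swap)
  finally show "app_ket A (mul A S T) v i = app_ket A S (app_ket A T v) i"
    by (simp add: app_ket_def sum_distrib_left mult.assoc)
qed

text \<open>\<open>trace_norm\<close> picks the root by a definite description, so uniqueness is
  needed to evaluate it. Let \<open>v\<close> be a unit eigenvector of \<open>S - T\<close> with
  eigenvalue \<open>l\<close>, and \<open>t = <v, T v>\<close>. Equal squares give equal norms of
  \<open>S v\<close> and \<open>T v\<close>, hence \<open>l * (2 * t + l) = 0\<close>. Both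
  \<open>t\<close> and \<open>t + l\<close> are nonnegative, so the second factor vanishes only if
  \<open>l = 0\<close>.\<close>

lemma psd_sqrt_unique:
  assumes fin: "finite A" and S: "psd A S" and T: "psd A T" and eq: "mul A S S = mul A T T"
  shows "S = T"
proof -
  define D where "D = (\<lambda>i j. S i j - T i j)"
  have hS: "dagger S = S" and hT: "dagger T = T" using psd_hermitian[OF fin] S T by auto
  have "D \<in> ops A A" using psd_opsD[OF S] psd_opsD[OF T] by (auto simp: D_def ops_def)
  moreover have "dagger D = D"
    using hS hT by (auto simp: D_def dagger_def fun_eq_iff)
  ultimately obtain n v l where es: "eigensystem A D n v l"
    and "id_op A = (\<lambda>a b. \<Sum>i<n. v i a * cnj (v i b))"
    and Ds: "D = (\<lambda>a b. \<Sum>i<n. complex_of_real (l i) * (v i a * cnj (v i b)))"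
    by (rule spectral[OF fin])
  have "l i = 0" if i: "i < n" for i
  proof -
    let ?v = "v i" and ?c = "complex_of_real (l i)"
    have vv: "inner_ket A ?v ?v = 1" using es i by (auto simp: eigensystem_def)
    have "app_ket A D ?v = (\<lambda>a. app_ket A S ?v a - app_ket A T ?v a)"
      by (auto simp: app_ket_def D_def algebra_simps sum_subtractf)
    moreover have "app_ket A D ?v = (\<lambda>a. ?c * ?v a)" using es i by (simp add: eigensystem_def)
    ultimately have Sv: "app_ket A S ?v = (\<lambda>a. app_ket A T ?v a + ?c * ?v a)"
      by (auto simp: fun_eq_iff algebra_simps)
    have "inner_ket A (app_ket A S ?v) (app_ket A S ?v) = inner_ket A ?v (app_ket A (mul A S S) ?v)"
      unfolding app_ket_mul by (subst (2) inner_ket_app) (simp add: hS)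
    moreover have "inner_ket A (app_ket A T ?v) (app_ket A T ?v) = inner_ket A ?v (app_ket A (mul A T T) ?v)"
      unfolding app_ket_mul by (subst (2) inner_ket_app) (simp add: hT)
    ultimately have *: "inner_ket A (app_ket A S ?v) (app_ket A S ?v) = inner_ket A (app_ket A T ?v) (app_ket A T ?v)"
      by (simp add: eq)
    define t where "t = inner_ket A ?v (app_ket A T ?v)"
    have t': "inner_ket A (app_ket A T ?v) ?v = cnj t"
      unfolding t_def by (rule inner_ket_commute)
    have t: "0 \<le> Re t" unfolding t_def using psd_inner_nonneg[OF T] by blast
    have s: "inner_ket A ?v (app_ket A S ?v) = t + ?c"
      unfolding Sv inner_ket_add_right inner_ket_scale_right t_def vv by simp
    then have s': "0 \<le> Re t + l i" using psd_inner_nonneg(1)[OF S, of ?v] by simp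
    have "?c * t + ?c * cnj t + ?c * ?c = 0"
      using * unfolding Sv inner_ket_add_left inner_ket_add_right inner_ket_scale_left inner_ket_scale_right vv t'
      by (simp add: t_def[symmetric] algebra_simps)
    then have "Re (?c * t + ?c * cnj t + ?c * ?c) = 0" by simp
    then have "l i * (2 * Re t + l i) = 0" by (simp add: algebra_simps)
    then have "l i = 0 \<or> 2 * Re t + l i = 0" by simp
    then show ?thesis using t s' by linarith
  qed
  then have "D = (\<lambda>_ _. 0)" unfolding Ds by simp
  then show ?thesis by (auto simp: D_def fun_eq_iff)
qed

lemma mul_spectral:
  fixes n :: nat
  assumes on: "\<And>i j. i < n \<Longrightarrow> j < n \<Longrightarrow> inner_ket A (v i) (v j) = of_bool (i = j)"
  shows "mul A (\<lambda>a b. \<Sum>i<n. l i * (v i a * cnj (v i b))) (\<lambda>a b. \<Sum>i<n. k i * (v i a * cnj (v i b)))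
    = (\<lambda>a b. \<Sum>i<n. l i * k i * (v i a * cnj (v i b)))"
proof (intro ext)
  fix a b
  have "mul A (\<lambda>a b. \<Sum>i<n. l i * (v i a * cnj (v i b))) (\<lambda>a b. \<Sum>i<n. k i * (v i a * cnj (v i b))) a b
    = (\<Sum>c\<in>A. \<Sum>i<n. \<Sum>j<n. l i * k j * v i a * cnj (v j b) * (cnj (v i c) * v j c))"
    unfolding mul_def sum_product by (simp add: mult_ac)
  also have "\<dots> = (\<Sum>i<n. \<Sum>c\<in>A. \<Sum>j<n. l i * k j * v i a * cnj (v j b) * (cnj (v i c) * v j c))"
    by (rule sum.swap)
  also have "\<dots> = (\<Sum>i<n. \<Sum>j<n. \<Sum>c\<in>A. l i * k j * v i a * cnj (v j b) * (cnj (v i c) * v j c))"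
    by (rule sum.cong[OF refl], rule sum.swap)
  also have "\<dots> = (\<Sum>i<n. \<Sum>j<n. l i * k j * v i a * cnj (v j b) * of_bool (i = j))"
    using on by (intro sum.cong refl) (simp add: inner_ket_def flip: sum_distrib_left)
  also have "\<dots> = (\<Sum>i<n. l i * k i * (v i a * cnj (v i b)))"
  proof (intro sum.cong refl)
    fix i assume "i \<in> {..<n}"
    have "(\<Sum>j<n. l i * k j * v i a * cnj (v j b) * of_bool (i = j))
        = (\<Sum>j<n. if j = i then l i * k i * (v i a * cnj (v i b)) else 0)" by (intro sum.cong) auto
    also have "\<dots> = l i * k i * (v i a * cnj (v i b))"
      using \<open>i \<in> {..<n}\<close> by (subst sum.delta) auto
    finally show "(\<Sum>j<n. l i * k j * v i a * cnj (v j b) * of_bool (i = j)) = l i * k i * (v i a * cnj (v i b))" .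
  qed
  finally show "mul A (\<lambda>a b. \<Sum>i<n. l i * (v i a * cnj (v i b))) (\<lambda>a b. \<Sum>i<n. k i * (v i a * cnj (v i b))) a b
    = (\<Sum>i<n. l i * k i * (v i a * cnj (v i b)))" .
qed

text \<open>In an eigenbasis of \<open>X\<close> the two hypotheses bound each absolute eigenvalue
  by the diagonal entry of \<open>N\<close>, and these entries add up to the trace of
  \<open>N\<close>. The root in the trace norm is \<open>X\<close> with its eigenvalues replaced by
  their absolute values.\<close>

theorem trace_norm_le:
  assumes fin: "finite A" and plus: "psd A (\<lambda>i j. N i j + X i j)" and minus: "psd A (\<lambda>i j. N i j - X i j)"
  shows "trace_norm A X \<le> Re (trace_op A N)"
proof -
  \<comment> \<open>Both sums are Hermitian, and so is their difference, twice
    \<open>X\<close>.\<close>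
  have hp: "cnj (N b a) + cnj (X b a) = N a b + X a b" for a b
    using psd_hermitian[OF fin plus] by (simp add: dagger_def fun_eq_iff)
  have hm: "cnj (N b a) - cnj (X b a) = N a b - X a b" for a b
    using psd_hermitian[OF fin minus] by (simp add: dagger_def fun_eq_iff)
  have "2 * cnj (X b a) = 2 * X a b" for a b
    using arg_cong2[OF hp[of b a] hm[of b a], of minus] by simp
  then have herm: "dagger X = X" by (auto simp: dagger_def fun_eq_iff)
  have X: "X \<in> ops A A"
  proof -
    have "N i j + X i j = 0 \<and> N i j - X i j = 0" if "i \<notin> A \<or> j \<notin> A" for i j
      using that psd_opsD[OF plus] psd_opsD[OF minus] by (auto simp: ops_def)
    then have "X i j = 0" if "i \<notin> A \<or> j \<notin> A" for i j using that
      by (metis add_cancel_right_left diff_add_cancel eq_iff_diff_eq_0 mult_2 mult_eq_0_iff zero_neq_numeral)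
    then show ?thesis by (simp add: ops_def)
  qed
  obtain n v l where es: "eigensystem A X n v l"
    and idA: "id_op A = (\<lambda>a b. \<Sum>i<n. v i a * cnj (v i b))"
    and Xs: "X = (\<lambda>a b. \<Sum>i<n. complex_of_real (l i) * (v i a * cnj (v i b)))"
    by (rule spectral[OF fin X herm])
  have on: "inner_ket A (v i) (v j) = of_bool (i = j)" if "i < n" "j < n" for i j
    using es that by (auto simp: eigensystem_def)
  define S where "S = (\<lambda>a b. \<Sum>i<n. complex_of_real \<bar>l i\<bar> * (v i a * cnj (v i b)))"
  have S: "psd A S"
    unfolding S_def
  proof (intro psd_sum psd_scale)
    fix i assume "i \<in> {..<n}"
    then show "psd A (\<lambda>a b. v i a * cnj (v i b))"
      using psd_ketbra[of "v i" A] es by (simp add: eigensystem_def ketbra_def)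
  qed auto
  have "mul A S S = mul A X X"
    unfolding S_def Xs by (subst (1 2) mul_spectral[OF on]) (auto simp flip: of_real_mult)
  then have SX: "mul A S S = mul A (dagger X) X" by (simp add: herm)
  have "(THE S. psd A S \<and> mul A S S = mul A (dagger X) X) = S"
    using S SX psd_sqrt_unique[OF fin] by (intro the_equality) auto
  then have "trace_norm A X = Re (\<Sum>a\<in>A. \<Sum>i<n. complex_of_real \<bar>l i\<bar> * (v i a * cnj (v i a)))"
    by (simp add: trace_norm_def trace_op_def S_def)
  also have "(\<Sum>a\<in>A. \<Sum>i<n. complex_of_real \<bar>l i\<bar> * (v i a * cnj (v i a)))
      = (\<Sum>i<n. \<Sum>a\<in>A. complex_of_real \<bar>l i\<bar> * (v i a * cnj (v i a)))" by (rule sum.swap)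
  also have "\<dots> = (\<Sum>i<n. complex_of_real \<bar>l i\<bar> * inner_ket A (v i) (v i))"
    by (simp add: inner_ket_def sum_distrib_left mult_ac)
  also have "\<dots> = (\<Sum>i<n. complex_of_real \<bar>l i\<bar>)"
    using on by (intro sum.cong) auto
  also have "Re \<dots> = (\<Sum>i<n. \<bar>l i\<bar>)" by simp
  also have "\<dots> \<le> (\<Sum>i<n. Re (inner_ket A (v i) (app_ket A N (v i))))"
  proof (intro sum_mono)
    fix i assume i: "i \<in> {..<n}"
    have x: "inner_ket A (v i) (app_ket A X (v i)) = complex_of_real (l i)"
      using es i on[of i i] by (simp add: eigensystem_def inner_ket_scale_right)
    have "app_ket A (\<lambda>i j. N i j + X i j) (v i) = (\<lambda>a. app_ket A N (v i) a + app_ket A X (v i) a)"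
      "app_ket A (\<lambda>i j. N i j - X i j) (v i) = (\<lambda>a. app_ket A N (v i) a + (-1) * app_ket A X (v i) a)"
      by (auto simp: app_ket_def algebra_simps sum.distrib sum_subtractf)
    with psd_inner_nonneg(1)[OF plus, of "v i"] psd_inner_nonneg(1)[OF minus, of "v i"]
    have "0 \<le> Re (inner_ket A (v i) (app_ket A N (v i))) + l i"
      "0 \<le> Re (inner_ket A (v i) (app_ket A N (v i))) - l i"
      by (simp_all only: inner_ket_add_right inner_ket_scale_right x) simp_all
    then show "\<bar>l i\<bar> \<le> Re (inner_ket A (v i) (app_ket A N (v i)))" by linarith
  qed
  also have "\<dots> = Re (\<Sum>i<n. inner_ket A (v i) (app_ket A N (v i)))" by simp
  also have "(\<Sum>i<n. inner_ket A (v i) (app_ket A N (v i)))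
      = (\<Sum>i<n. \<Sum>a\<in>A. \<Sum>b\<in>A. N a b * (v i b * cnj (v i a)))"
    by (simp add: inner_ket_def app_ket_def sum_distrib_left mult_ac)
  also have "\<dots> = (\<Sum>a\<in>A. \<Sum>i<n. \<Sum>b\<in>A. N a b * (v i b * cnj (v i a)))" by (rule sum.swap)
  also have "\<dots> = (\<Sum>a\<in>A. \<Sum>b\<in>A. \<Sum>i<n. N a b * (v i b * cnj (v i a)))"
    by (rule sum.cong[OF refl], rule sum.swap)
  also have "\<dots> = (\<Sum>a\<in>A. \<Sum>b\<in>A. N a b * id_op A b a)"
    by (simp add: idA sum_distrib_left)
  also have "\<dots> = (\<Sum>a\<in>A. \<Sum>b\<in>A. if b = a then N a b else 0)"
    by (intro sum.cong refl) (auto simp: id_op_def)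
  also have "\<dots> = trace_op A N" using fin by (simp add: trace_op_def)
  finally show ?thesis .
qed

subsection \<open>Completely positive maps\<close>

text \<open>Distinct operators on the two sides are needed for the interference terms between two
  parts of one Kraus operator.\<close>

definition sandwich2 :: "'a set \<Rightarrow> ('b, 'a) opr \<Rightarrow> ('b, 'a) opr \<Rightarrow> ('a, 'b) superop" where
  "sandwich2 A K L X = (\<lambda>i j. \<Sum>a\<in>A. \<Sum>b\<in>A. K i a * X a b * cnj (L j b))"

abbreviation sandwich :: "'a set \<Rightarrow> ('b, 'a) opr \<Rightarrow> ('a, 'b) superop" where
  "sandwich A K \<equiv> sandwich2 A K K"

lemma sum_swap_pairs:
  "(\<Sum>i\<in>I. \<Sum>j\<in>J. \<Sum>a\<in>A. \<Sum>b\<in>B. f i j a b) = (\<Sum>a\<in>A. \<Sum>b\<in>B. \<Sum>i\<in>I. \<Sum>j\<in>J. f i j a b)"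
proof -
  have "(\<Sum>i\<in>I. \<Sum>j\<in>J. \<Sum>a\<in>A. \<Sum>b\<in>B. f i j a b) = (\<Sum>i\<in>I. \<Sum>a\<in>A. \<Sum>j\<in>J. \<Sum>b\<in>B. f i j a b)"
    by (rule sum.cong[OF refl], rule sum.swap)
  also have "\<dots> = (\<Sum>a\<in>A. \<Sum>i\<in>I. \<Sum>j\<in>J. \<Sum>b\<in>B. f i j a b)" by (rule sum.swap)
  also have "\<dots> = (\<Sum>a\<in>A. \<Sum>i\<in>I. \<Sum>b\<in>B. \<Sum>j\<in>J. f i j a b)"
    by (rule sum.cong[OF refl], rule sum.cong[OF refl], rule sum.swap)
  also have "\<dots> = (\<Sum>a\<in>A. \<Sum>b\<in>B. \<Sum>i\<in>I. \<Sum>j\<in>J. f i j a b)"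
    by (rule sum.cong[OF refl], rule sum.swap)
  finally show ?thesis .
qed

lemma psd_sandwich:
  assumes X: "psd A X" and K: "\<And>i a. i \<notin> B \<Longrightarrow> K i a = 0"
  shows "psd B (sandwich A K X)"
proof -
  have "(\<Sum>i\<in>B. \<Sum>j\<in>B. cnj (v i) * sandwich A K X i j * v j)
      = (\<Sum>a\<in>A. \<Sum>b\<in>A. cnj (\<Sum>i\<in>B. cnj (K i a) * v i) * X a b * (\<Sum>i\<in>B. cnj (K i b) * v i))" for v
  proof -
    have "(\<Sum>i\<in>B. \<Sum>j\<in>B. cnj (v i) * sandwich A K X i j * v j)
      = (\<Sum>i\<in>B. \<Sum>j\<in>B. \<Sum>a\<in>A. \<Sum>b\<in>A. (K i a * cnj (v i)) * X a b * (cnj (K j b) * v j))"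
      by (simp add: sandwich2_def sum_distrib_left sum_distrib_right mult_ac)
    also have "\<dots> = (\<Sum>a\<in>A. \<Sum>b\<in>A. \<Sum>i\<in>B. \<Sum>j\<in>B. (K i a * cnj (v i)) * X a b * (cnj (K j b) * v j))"
      by (rule sum_swap_pairs)
    finally show ?thesis by (simp add: sum_distrib_left sum_distrib_right mult_ac)
  qed
  then have "(\<Sum>i\<in>B. \<Sum>j\<in>B. cnj (v i) * sandwich A K X i j * v j) \<in> \<real>\<^sub>\<ge>\<^sub>0" for v
    using X by (simp only: psd_def)
  moreover have "sandwich A K X \<in> ops B B" using K by (auto simp: ops_def sandwich2_def)
  ultimately show ?thesis by (simp add: psd_def)
qed

text \<open>Only the positivity clause of \<open>cp_map\<close>: linearity plays no part in
  comparing maps and would otherwise have to be carried through every combination.\<close>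

definition cpos :: "'a set \<Rightarrow> 'b set \<Rightarrow> ('a, 'b) superop \<Rightarrow> bool" where
  "cpos A B \<Psi> \<longleftrightarrow> (\<forall>d::nat. \<forall>X. psd ({..<d} \<times> A) X \<longrightarrow> psd ({..<d} \<times> B) (ampl \<Psi> X))"

lemma ops_block: "X \<in> ops (E \<times> A) (E \<times> A) \<Longrightarrow> (\<lambda>k l. X (e, k) (f, l)) \<in> ops A A"
  by (auto simp: ops_def)

lemma psd_diagonal_block:
  assumes X: "psd (E \<times> A) X" and E: "finite E" "finite A"
  shows "psd A (\<lambda>k l. X (e, k) (e, l))"
proof (cases "e \<in> E")
  case True
  have red: "(\<Sum>p\<in>E \<times> A. of_bool (e = fst p \<and> a = snd p) * f p) = f (e, a)" if "a \<in> A" for a and f :: "'a \<times> 'b \<Rightarrow> complex"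
  proof -
    have "(\<Sum>p\<in>E \<times> A. of_bool (e = fst p \<and> a = snd p) * f p) = (\<Sum>p\<in>E \<times> A. if p = (e, a) then f p else 0)"
      by (intro sum.cong) auto
    then show ?thesis using that True E by simp
  qed
  let ?K = "\<lambda>a p. of_bool (e = fst p \<and> a = snd p \<and> a \<in> A)"
  have "sandwich (E \<times> A) ?K X = (\<lambda>k l. X (e, k) (e, l))"
  proof (intro ext)
    fix k l
    show "sandwich (E \<times> A) ?K X k l = X (e, k) (e, l)"
    proof (cases "k \<in> A \<and> l \<in> A")
      case True
      have "sandwich (E \<times> A) ?K X k l = (\<Sum>p\<in>E \<times> A. of_bool (e = fst p \<and> k = snd p) *
          (\<Sum>q\<in>E \<times> A. of_bool (e = fst q \<and> l = snd q) * X p q))"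
        using True by (simp add: sandwich2_def sum_distrib_left mult_ac)
      then show ?thesis using True by (simp add: red)
    next
      case False
      then show ?thesis using psd_opsD[OF X] by (auto simp: sandwich2_def ops_def)
    qed
  qed
  then show ?thesis using psd_sandwich[OF X, of A ?K] by simp
next
  case False
  then have "(\<lambda>k l. X (e, k) (e, l)) = (\<lambda>_ _. 0)" using psd_opsD[OF X] by (auto simp: ops_def fun_eq_iff)
  then show ?thesis by (simp add: psd_def ops_def)
qed

text \<open>\<open>ampl\<close> acts on all blocks of the index type while \<open>id_op E\<close>
  cuts down to \<open>E\<close>, so the two sides are compared for operators that vanish outside the
  register.\<close>

lemma ampl_sandwich:
  fixes X :: "('e \<times> 'a, 'e \<times> 'a) opr" and K :: "('b, 'a) opr"
  assumes E: "finite E" and X: "X \<in> ops (E \<times> A) (E \<times> A)"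
  shows "ampl (sandwich A K) X = sandwich (E \<times> A) (tensor (id_op E) K) X"
proof (intro ext)
  fix p q :: "'e \<times> 'b"
  obtain e i f j where pq: "p = (e, i)" "q = (f, j)" by (cases p, cases q)
  show "ampl (sandwich A K) X p q = sandwich (E \<times> A) (tensor (id_op E) K) X p q"
  proof (cases "e \<in> E \<and> f \<in> E")
    case True
    have red: "(\<Sum>e'\<in>E. of_bool (e = e') * g e') = g e" if "e \<in> E" for e and g :: "'e \<Rightarrow> complex"
    proof -
      have "(\<Sum>e'\<in>E. of_bool (e = e') * g e') = (\<Sum>e'\<in>E. if e' = e then g e' else 0)"
        using that by (intro sum.cong) auto
      then show ?thesis using E that by simp
    qed
    have "sandwich (E \<times> A) (tensor (id_op E) K) X p q
      = (\<Sum>e'\<in>E. of_bool (e = e') * (\<Sum>a\<in>A. \<Sum>f'\<in>E. of_bool (f = f') *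
          (\<Sum>b\<in>A. K i a * X (e', a) (f', b) * cnj (K j b))))"
      unfolding sandwich2_def pq sum.cartesian_product'
      using True by (simp add: tensor_def id_op_def sum_distrib_left mult_ac)
    also have "\<dots> = ampl (sandwich A K) X p q"
      using True by (simp only: red) (simp add: ampl_def pq sandwich2_def)
    finally show ?thesis by simp
  next
    case False
    have "ampl (sandwich A K) X p q = 0"
      using False X by (auto simp: pq ampl_def sandwich2_def ops_def)
    moreover have "sandwich (E \<times> A) (tensor (id_op E) K) X p q = 0"
      using False by (auto simp: pq sandwich2_def tensor_def id_op_def split: prod.splits intro!: sum.neutral)
    ultimately show ?thesis by simp
  qed
qed

lemma cpos_sandwich:
  assumes "\<And>i a. i \<notin> B \<Longrightarrow> K i a = 0"
  shows "cpos A B (sandwich A K)"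
  unfolding cpos_def
proof (intro allI impI)
  fix d :: nat and X
  assume X: "psd ({..<d} \<times> A) X"
  show "psd ({..<d} \<times> B) (ampl (sandwich A K) X)"
    unfolding ampl_sandwich[OF finite_lessThan psd_opsD[OF X]]
    by (intro psd_sandwich[OF X]) (clarsimp simp: tensor_def id_op_def, metis assms)
qed

lemma cpos_add:
  fixes A :: "'a set"
  assumes "cpos A B \<Psi>" "cpos A B \<Phi>"
  shows "cpos A B (\<lambda>X i j. \<Psi> X i j + \<Phi> X i j)"
proof -
  have "ampl (\<lambda>X i j. \<Psi> X i j + \<Phi> X i j) X = (\<lambda>p q. ampl \<Psi> X p q + ampl \<Phi> X p q)" for X :: "(nat \<times> 'a, nat \<times> 'a) opr"
    by (auto simp: ampl_def)
  then show ?thesis using assms by (simp add: cpos_def psd_add)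
qed

lemma cpos_scale:
  fixes A :: "'a set"
  assumes "0 \<le> c" "cpos A B \<Psi>"
  shows "cpos A B (\<lambda>X i j. complex_of_real c * \<Psi> X i j)"
proof -
  have "ampl (\<lambda>X i j. complex_of_real c * \<Psi> X i j) X = (\<lambda>p q. complex_of_real c * ampl \<Psi> X p q)" for X :: "(nat \<times> 'a, nat \<times> 'a) opr"
    by (auto simp: ampl_def)
  then show ?thesis using assms by (simp add: cpos_def psd_scale)
qed

lemma cpos_zero: "cpos A B (\<lambda>X i j. 0)"
  by (auto simp: cpos_def ampl_def psd_def ops_def)

lemma cpos_sum: "(\<And>s. s \<in> S \<Longrightarrow> cpos A B (\<Psi> s)) \<Longrightarrow> cpos A B (\<lambda>X i j. \<Sum>s\<in>S. \<Psi> s X i j)"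
proof (induction S rule: infinite_finite_induct)
  case (insert x F)
  then have "cpos A B (\<lambda>X i j. \<Psi> x X i j + (\<Sum>s\<in>F. \<Psi> s X i j))" by (intro cpos_add) auto
  then show ?case using insert by simp
qed (simp_all add: cpos_zero)

text \<open>Superoperators are total functions, and the identities between them hold only for
  operators on the intended register.\<close>

lemma cpos_congI:
  assumes "cpos A B \<Phi>" "\<And>X. X \<in> ops A A \<Longrightarrow> \<Psi> X = \<Phi> X"
  shows "cpos A B \<Psi>"
proof -
  have "ampl \<Psi> X = ampl \<Phi> X" if "psd ({..<d} \<times> A) X" for X and d :: nat
    using assms(2) ops_block[OF psd_opsD[OF that]] by (auto simp: ampl_def)
  then show ?thesis using assms(1) by (auto simp: cpos_def)
qed

lemma cpos_comp:
  fixes A :: "'a set"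
  assumes "cpos A B \<Psi>" "cpos B C \<Phi>"
  shows "cpos A C (\<lambda>X. \<Phi> (\<Psi> X))"
proof -
  have "ampl (\<lambda>X. \<Phi> (\<Psi> X)) X = ampl \<Phi> (ampl \<Psi> X)" for X :: "(nat \<times> 'a, nat \<times> 'a) opr"
    by (auto simp: ampl_def)
  then show ?thesis using assms by (auto simp: cpos_def)
qed

text \<open>This is \<open>- \<nu> \<le> \<Delta> \<le> \<nu>\<close> in the order of completely
  positive maps. Unlike the diamond norm it is handled by adding, scaling and composing.\<close>

definition dominated :: "'a set \<Rightarrow> 'b set \<Rightarrow> ('a, 'b) superop \<Rightarrow> ('a, 'b) superop \<Rightarrow> bool" where
  "dominated A B \<Delta> \<nu> \<longleftrightarrow>
     cpos A B (\<lambda>X i j. \<nu> X i j + \<Delta> X i j) \<and> cpos A B (\<lambda>X i j. \<nu> X i j - \<Delta> X i j)"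

lemma dominated_add:
  assumes "dominated A B \<Delta> \<nu>" "dominated A B \<Delta>' \<nu>'"
  shows "dominated A B (\<lambda>X i j. \<Delta> X i j + \<Delta>' X i j) (\<lambda>X i j. \<nu> X i j + \<nu>' X i j)"
  using cpos_add[of A B "\<lambda>X i j. \<nu> X i j + \<Delta> X i j" "\<lambda>X i j. \<nu>' X i j + \<Delta>' X i j"]
    cpos_add[of A B "\<lambda>X i j. \<nu> X i j - \<Delta> X i j" "\<lambda>X i j. \<nu>' X i j - \<Delta>' X i j"] assms
  by (simp add: dominated_def algebra_simps)

lemma dominated_scale:
  assumes "dominated A B \<Delta> \<nu>" "0 \<le> c"
  shows "dominated A B (\<lambda>X i j. complex_of_real c * \<Delta> X i j) (\<lambda>X i j. complex_of_real c * \<nu> X i j)"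
  using cpos_scale[of c A B "\<lambda>X i j. \<nu> X i j + \<Delta> X i j"]
    cpos_scale[of c A B "\<lambda>X i j. \<nu> X i j - \<Delta> X i j"] assms
  by (simp add: dominated_def algebra_simps)

lemma dominated_sum:
  assumes "\<And>s. s \<in> S \<Longrightarrow> dominated A B (\<Delta> s) (\<nu> s)"
  shows "dominated A B (\<lambda>X i j. \<Sum>s\<in>S. \<Delta> s X i j) (\<lambda>X i j. \<Sum>s\<in>S. \<nu> s X i j)"
  using cpos_sum[of S A B "\<lambda>s X i j. \<nu> s X i j + \<Delta> s X i j"]
    cpos_sum[of S A B "\<lambda>s X i j. \<nu> s X i j - \<Delta> s X i j"] assms
  by (simp add: dominated_def sum.distrib sum_subtractf)

lemma dominated_real_multiple:
  assumes "cpos A B \<Psi>" "\<bar>c\<bar> \<le> d"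
  shows "dominated A B (\<lambda>X i j. complex_of_real c * \<Psi> X i j) (\<lambda>X i j. complex_of_real d * \<Psi> X i j)"
  using cpos_scale[of "d + c" A B \<Psi>] cpos_scale[of "d - c" A B \<Psi>] assms
  by (simp add: dominated_def algebra_simps)

text \<open>Expand \<open>c\<close> times the sandwich by \<open>K + s L\<close>. With
  \<open>s = 1 / c\<close> and \<open>s = - 1 / c\<close> the square of \<open>L\<close> receives
  \<open>c * s * s = 1 / c\<close> and the cross terms receive plus and minus one.\<close>

lemma dominated_cross:
  assumes c: "0 < c" and K: "\<And>i a. i \<notin> B \<Longrightarrow> K i a = 0" and L: "\<And>i a. i \<notin> B \<Longrightarrow> L i a = 0"
  shows "dominated A B (\<lambda>X i j. sandwich2 A K L X i j + sandwich2 A L K X i j)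
    (\<lambda>X i j. complex_of_real c * sandwich A K X i j + complex_of_real (1 / c) * sandwich A L X i j)"
proof -
  have eq: "complex_of_real c * sandwich A (\<lambda>i a. K i a + complex_of_real s * L i a) X i j
      = complex_of_real c * sandwich A K X i j + complex_of_real (c * s * s) * sandwich A L X i j
       + complex_of_real (c * s) * (sandwich2 A K L X i j + sandwich2 A L K X i j)" for s X i j
    by (simp add: sandwich2_def algebra_simps sum.distrib sum_distrib_left)
  have cp: "cpos A B (\<lambda>X i j. complex_of_real c * sandwich A (\<lambda>i a. K i a + complex_of_real s * L i a) X i j)" for s
    using c K L by (intro cpos_scale cpos_sandwich) auto
  from cp[of "1 / c"] cp[of "- 1 / c"] show ?thesis
    using c unfolding dominated_def eq by (simp add: algebra_simps)
qed

text \<open>The order survives the ancilla, so the trace norm is at most the trace of the amplified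
  \<open>\<nu>\<close>. That trace is a sum over the diagonal ancilla blocks, which are positive, so
  the hypothesis without ancilla applies to each of them.\<close>

theorem diamond_norm_le:
  assumes fin: "finite A" "finite B" and A: "A \<noteq> {}" and dom: "dominated A B \<Delta> \<nu>"
    and tr: "\<And>\<rho>. psd A \<rho> \<Longrightarrow> Re (trace_op B (\<nu> \<rho>)) \<le> c * Re (trace_op A \<rho>)"
  shows "diamond_norm A B \<Delta> \<le> c"
  unfolding diamond_norm_def
proof (rule cSup_least)
  \<comment> \<open>A supremum of reals is bounded through its elements only if there are any; a
    basis state with a one-dimensional ancilla supplies one.\<close>
  obtain a where a: "a \<in> A" using A by blast
  let ?v = "basis_ket (0::nat, a)"
  have "density ({..<1} \<times> A) (ketbra ?v)"
  proof -
    have "trace_op ({..<1} \<times> A) (ketbra ?v) = (\<Sum>p\<in>{..<1::nat} \<times> A. if p = (0, a) then 1 else 0)"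
      unfolding trace_op_def ketbra_def basis_ket_def by (intro sum.cong) auto
    also have "\<dots> = 1" using a fin by simp
    finally show ?thesis
      using a unfolding density_def by (auto intro!: psd_ketbra simp: kets_def basis_ket_def)
  qed
  then show "{trace_norm ({..<d} \<times> B) (ampl \<Delta> \<rho>) |(d::nat) \<rho>. density ({..<d} \<times> A) \<rho>} \<noteq> {}" by blast
next
  fix x assume "x \<in> {trace_norm ({..<d} \<times> B) (ampl \<Delta> \<rho>) |(d::nat) \<rho>. density ({..<d} \<times> A) \<rho>}"
  then obtain d :: nat and \<rho> where x: "x = trace_norm ({..<d} \<times> B) (ampl \<Delta> \<rho>)"
    and \<rho>: "psd ({..<d} \<times> A) \<rho>" "trace_op ({..<d} \<times> A) \<rho> = 1" by (auto simp: density_def)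
  have "ampl (\<lambda>X i j. \<nu> X i j + \<Delta> X i j) \<rho> = (\<lambda>p q. ampl \<nu> \<rho> p q + ampl \<Delta> \<rho> p q)"
    "ampl (\<lambda>X i j. \<nu> X i j - \<Delta> X i j) \<rho> = (\<lambda>p q. ampl \<nu> \<rho> p q - ampl \<Delta> \<rho> p q)"
    by (auto simp: ampl_def)
  then have "x \<le> Re (trace_op ({..<d} \<times> B) (ampl \<nu> \<rho>))"
    unfolding x using dom \<rho>(1) fin
    by (intro trace_norm_le) (fastforce simp: dominated_def cpos_def)+
  also have "\<dots> = (\<Sum>e<d. Re (trace_op B (\<nu> (\<lambda>k l. \<rho> (e, k) (e, l)))))"
    by (simp add: trace_op_def ampl_def sum.cartesian_product')
  also have "\<dots> \<le> (\<Sum>e<d. c * Re (trace_op A (\<lambda>k l. \<rho> (e, k) (e, l))))"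
    using \<rho>(1) fin by (intro sum_mono tr psd_diagonal_block) auto
  also have "\<dots> = c * Re (trace_op ({..<d} \<times> A) \<rho>)"
    by (simp add: trace_op_def sum.cartesian_product' sum_distrib_left)
  finally show "x \<le> c" using \<rho>(2) by simp
qed

lemma linear_superop_sum:
  assumes "linear_superop A B \<Psi>" "finite F" "\<And>p. p \<in> F \<Longrightarrow> E p \<in> ops A A"
  shows "\<Psi> (\<lambda>i j. \<Sum>p\<in>F. c p * E p i j) = (\<lambda>i j. \<Sum>p\<in>F. c p * \<Psi> (E p) i j)"
  using assms(2,3)
proof (induction F rule: finite_induct)
  case empty
  have "\<Psi> (scale 0 (\<lambda>_ _. 0)) = scale 0 (\<Psi> (\<lambda>_ _. 0))"
    using assms(1) unfolding linear_superop_def by (auto simp: ops_def)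
  then show ?case by (simp add: scale_def)
next
  case (insert p F)
  have "scale (c p) (E p) \<in> ops A A" "(\<lambda>i j. \<Sum>p\<in>F. c p * E p i j) \<in> ops A A"
    using insert by (auto simp: ops_def scale_def)
  then have "\<Psi> (\<lambda>i j. scale (c p) (E p) i j + (\<Sum>p\<in>F. c p * E p i j))
      = (\<lambda>i j. scale (c p) (\<Psi> (E p)) i j + \<Psi> (\<lambda>i j. \<Sum>p\<in>F. c p * E p i j) i j)"
    using assms(1) insert by (auto simp: linear_superop_def)
  then show ?case using insert by (simp add: scale_def)
qed

lemma linear_superop_sandwich:
  assumes "\<And>i a. i \<notin> B \<Longrightarrow> K i a = 0"
  shows "linear_superop A B (sandwich A K)"
  using assms by (auto simp: linear_superop_def ops_def sandwich2_def scale_def fun_eq_iff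
      algebra_simps sum.distrib sum_distrib_left)

lemma linear_superop_scale_sum:
  assumes "\<And>s. s \<in> S \<Longrightarrow> linear_superop A B (\<Psi> s)"
  shows "linear_superop A B (\<lambda>X i j. \<Sum>s\<in>S. c s * \<Psi> s X i j)"
  using assms
  by (auto simp: linear_superop_def ops_def scale_def algebra_simps sum.distrib sum_distrib_left intro!: sum.neutral ext sum.cong)

text \<open>The Kraus operators are read off a decomposition of the Choi matrix into rank-one operators.\<close>

theorem kraus_representation:
  fixes A :: "'a set"
  assumes fin: "finite A" "finite B" and cp: "cp_map A B \<Psi>"
  obtains n :: nat and K where "\<And>s. K s \<in> ops B A"
    and "\<And>X. X \<in> ops A A \<Longrightarrow> \<Psi> X = (\<lambda>i j. \<Sum>s<n. sandwich A (K s) X i j)"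
proof -
  define d where "d = card A"
  \<comment> \<open>\<open>cp_map\<close> speaks of ancillas of the form \<open>{..<d}\<close> only,
    so \<open>A\<close> is copied to such a set.\<close>
  obtain h where h: "bij_betw h {..<d} A"
    using ex_bij_betw_nat_finite[OF fin(1)] by (auto simp: d_def atLeast0LessThan)
  define g where "g = inv_into {..<d} h"
  have g: "g a < d" "h (g a) = a" if "a \<in> A" for a
    using h that by (auto simp: g_def bij_betw_def intro: inv_into_into[of a h "{..<d}", simplified] f_inv_into_f)
  define unit where "unit = (\<lambda>(a::'a) (b::'a). (\<lambda>i j. of_bool (i = a \<and> j = b) :: complex))"
  \<comment> \<open>The unnormalised maximally entangled vector;
    \<open>ampl \<Psi> (ketbra \<omega>)\<close> is the Choi matrix.\<close>
  define \<omega> where "\<omega> = (\<lambda>(e, a). of_bool (e < d \<and> a = h e) :: complex)"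
  have "\<omega> \<in> kets ({..<d} \<times> A)"
    using h by (auto simp: \<omega>_def kets_def bij_betw_def)
  then have "psd ({..<d} \<times> B) (ampl \<Psi> (ketbra \<omega>))"
    using cp by (auto simp: cp_map_def intro: psd_ketbra)
  then obtain n w where w: "\<And>s. w s \<in> kets ({..<d} \<times> B)"
    "ampl \<Psi> (ketbra \<omega>) = (\<lambda>a b. \<Sum>s<(n::nat). ketbra (w s) a b)"
    by (rule psd_decompose[rotated]) (use fin in auto)
  define K where "K = (\<lambda>s i a. if a \<in> A then w s (g a, i) else 0)"
  have lin: "linear_superop A B \<Psi>" using cp by (simp add: cp_map_def)
  have unit: "\<Psi> (unit a b) i j = (\<Sum>s<n. K s i a * cnj (K s j b))" if "a \<in> A" "b \<in> A" for a b i j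
  proof -
    \<comment> \<open>Each block of the projector is a matrix unit, so the blocks of the Choi matrix
      are the values of \<open>\<Psi>\<close> on matrix units.\<close>
    have "(\<lambda>k l. ketbra \<omega> (g a, k) (g b, l)) = unit a b"
      using g that by (auto simp: ketbra_def \<omega>_def unit_def fun_eq_iff)
    then have "\<Psi> (unit a b) i j = ampl \<Psi> (ketbra \<omega>) (g a, i) (g b, j)" by (simp add: ampl_def)
    then show ?thesis unfolding w(2) using that by (simp add: ketbra_def K_def)
  qed
  show ?thesis
  proof
    show "K s \<in> ops B A" for s using w(1)[of s] by (auto simp: K_def kets_def ops_def)
    show "\<Psi> X = (\<lambda>i j. \<Sum>s<n. sandwich A (K s) X i j)" if X: "X \<in> ops A A" for X
    proof -
      have "X = (\<lambda>i j. \<Sum>p\<in>A \<times> A. X (fst p) (snd p) * unit (fst p) (snd p) i j)"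
      proof (intro ext)
        fix i j
        have "(\<Sum>p\<in>A \<times> A. X (fst p) (snd p) * unit (fst p) (snd p) i j)
            = (\<Sum>p\<in>A \<times> A. if p = (i, j) then X (fst p) (snd p) else 0)"
          by (intro sum.cong) (auto simp: unit_def)
        also have "\<dots> = X i j" using X fin by (auto simp: ops_def)
        finally show "X i j = (\<Sum>p\<in>A \<times> A. X (fst p) (snd p) * unit (fst p) (snd p) i j)" by simp
      qed
      then have "\<Psi> X = \<Psi> (\<lambda>i j. \<Sum>p\<in>A \<times> A. X (fst p) (snd p) * unit (fst p) (snd p) i j)" by simp
      also have "\<dots> = (\<lambda>i j. \<Sum>p\<in>A \<times> A. X (fst p) (snd p) * \<Psi> (unit (fst p) (snd p)) i j)"
        using fin by (intro linear_superop_sum[OF lin]) (auto simp: unit_def ops_def)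
      also have "\<dots> = (\<lambda>i j. \<Sum>s<n. sandwich A (K s) X i j)"
      proof (intro ext)
        fix i j
        have "(\<Sum>p\<in>A \<times> A. X (fst p) (snd p) * \<Psi> (unit (fst p) (snd p)) i j)
            = (\<Sum>p\<in>A \<times> A. \<Sum>s<n. K s i (fst p) * X (fst p) (snd p) * cnj (K s j (snd p)))"
          by (intro sum.cong refl) (auto simp: unit sum_distrib_left mult_ac)
        also have "\<dots> = (\<Sum>s<n. \<Sum>p\<in>A \<times> A. K s i (fst p) * X (fst p) (snd p) * cnj (K s j (snd p)))"
          by (rule sum.swap)
        finally show "(\<Sum>p\<in>A \<times> A. X (fst p) (snd p) * \<Psi> (unit (fst p) (snd p)) i j)
            = (\<Sum>s<n. sandwich A (K s) X i j)"
          by (simp add: sandwich2_def sum.cartesian_product case_prod_unfold)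
      qed
      finally show ?thesis .
    qed
  qed
qed

subsection \<open>Operators on strings of qubits\<close>

lemma mul_assoc: "mul B (mul A X Y) Z = mul A X (mul B Y Z)"
proof (intro ext)
  fix i l
  have "mul B (mul A X Y) Z i l = (\<Sum>k\<in>B. \<Sum>j\<in>A. X i j * Y j k * Z k l)"
    by (simp add: mul_def sum_distrib_right)
  also have "\<dots> = (\<Sum>j\<in>A. \<Sum>k\<in>B. X i j * Y j k * Z k l)" by (rule sum.swap)
  finally show "mul B (mul A X Y) Z i l = mul A X (mul B Y Z) i l"
    by (simp add: mul_def sum_distrib_left mult.assoc)
qed

lemma mul_id_left:
  assumes "finite A" "X \<in> ops A B"
  shows "mul A (id_op A) X = X"
proof (intro ext)
  fix i k
  have "mul A (id_op A) X i k = (\<Sum>j\<in>A. if j = i then X j k else 0)"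
    unfolding mul_def id_op_def by (intro sum.cong) auto
  then show "mul A (id_op A) X i k = X i k" using assms by (auto simp: ops_def)
qed

lemma mul_id_right:
  assumes "finite A" "X \<in> ops B A"
  shows "mul A X (id_op A) = X"
proof (intro ext)
  fix i k
  have "mul A X (id_op A) i k = (\<Sum>j\<in>A. if j = k then X i j else 0)"
    unfolding mul_def id_op_def by (intro sum.cong) auto
  then show "mul A X (id_op A) i k = X i k" using assms by (auto simp: ops_def)
qed

lemma dagger_mul: "dagger (mul A X Y) = mul A (dagger Y) (dagger X)"
  by (simp add: dagger_def mul_def mult.commute)

lemma dagger_dagger [simp]: "dagger (dagger X) = X"
  by (simp add: dagger_def)

lemma dagger_id_op [simp]: "dagger (id_op A) = id_op A"
  by (auto simp: dagger_def id_op_def fun_eq_iff)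

lemma dagger_ops: "X \<in> ops A B \<Longrightarrow> dagger X \<in> ops B A"
  by (auto simp: dagger_def ops_def)

lemma mul_ops: "X \<in> ops A B \<Longrightarrow> Y \<in> ops B C \<Longrightarrow> mul D X Y \<in> ops A C"
  by (auto simp: mul_def ops_def)

lemma mul_scale_left: "mul A (scale c X) Y = scale c (mul A X Y)"
  by (simp add: mul_def scale_def sum_distrib_left mult.assoc)

lemma mul_scale_right: "mul A X (scale c Y) = scale c (mul A X Y)"
  by (simp add: mul_def scale_def sum_distrib_left mult_ac)

lemma unitary_mul:
  assumes "finite A" "unitary_op A U" "unitary_op A V"
  shows "unitary_op A (mul A U V)"
proof -
  have U: "U \<in> ops A A" "mul A U (dagger U) = id_op A" "mul A (dagger U) U = id_op A"
    and V: "V \<in> ops A A" "mul A V (dagger V) = id_op A" "mul A (dagger V) V = id_op A"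
    using assms by (auto simp: unitary_op_def)
  have "mul A (mul A U V) (dagger (mul A U V)) = mul A U (mul A (mul A V (dagger V)) (dagger U))"
    by (simp add: dagger_mul mul_assoc)
  moreover have "mul A (dagger (mul A U V)) (mul A U V) = mul A (dagger V) (mul A (mul A (dagger U) U) V)"
    by (simp add: dagger_mul mul_assoc)
  ultimately show ?thesis
    using U V assms(1)
    by (simp add: unitary_op_def mul_id_left[OF assms(1) dagger_ops[OF U(1)]] mul_id_left[OF assms(1) V(1)]
        mul_ops[OF U(1) V(1)])
qed

lemma unitary_dagger: "unitary_op A U \<Longrightarrow> unitary_op A (dagger U)"
  by (simp add: unitary_op_def dagger_ops)

lemma unitary_columns:
  assumes "unitary_op A U" "b \<in> A"
  shows "(\<Sum>a\<in>A. cnj (U a b) * U a b') = of_bool (b = b')"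
proof -
  have "mul A (dagger U) U b b' = id_op A b b'" using assms by (simp add: unitary_op_def)
  then show ?thesis using assms(2) by (simp add: mul_def dagger_def id_op_def)
qed

lemma finite_bits [simp]: "finite (bits n)"
  and card_bits: "card (bits n) = 2 ^ n"
proof -
  have b: "bits n = {xs. set xs \<subseteq> (UNIV :: bool set) \<and> length xs = n}" by (simp add: bits_def)
  show "finite (bits n)" unfolding b by (rule finite_lists_length_eq) simp
  show "card (bits n) = 2 ^ n" unfolding b by (subst card_lists_length_eq) (simp_all add: card_UNIV_bool)
qed

lemma replicate_in_bits [simp]: "replicate n x \<in> bits n"
  by (simp add: bits_def)

lemma append_in_bits [simp]: "a \<in> bits m \<Longrightarrow> b \<in> bits t \<Longrightarrow> a @ b \<in> bits (m + t)"
  by (simp add: bits_def)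

lemma sum_bits_append: "(\<Sum>c\<in>bits (m + t). h c) = (\<Sum>a\<in>bits m. \<Sum>b\<in>bits t. h (a @ b))"
proof -
  have "(\<Sum>a\<in>bits m. \<Sum>b\<in>bits t. h (a @ b)) = (\<Sum>p\<in>bits m \<times> bits t. h (fst p @ snd p))"
    by (simp add: sum.cartesian_product case_prod_unfold)
  also have "\<dots> = (\<Sum>c\<in>bits (m + t). h c)"
    by (rule sum.reindex_bij_witness[where j = "\<lambda>p. fst p @ snd p" and i = "\<lambda>c. (take m c, drop m c)"])
      (auto simp: bits_def)
  finally show ?thesis by simp
qed

text \<open>Distributivity, qubit by qubit: it reduces every identity about Pauli strings to a
  finite check on one qubit.\<close>

lemma sum_bits_prod:
  fixes g :: "nat \<Rightarrow> bool \<Rightarrow> complex"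
  shows "(\<Sum>a\<in>bits n. \<Prod>q<n. g q (a ! q)) = (\<Prod>q<n. \<Sum>x\<in>UNIV. g q x)"
proof (induction n)
  case 0
  have "bits 0 = {[]}" by (auto simp: bits_def)
  then show ?case by simp
next
  case (Suc n)
  have "(\<Sum>a\<in>bits (n + 1). \<Prod>q<Suc n. g q (a ! q))
      = (\<Sum>a\<in>bits n. \<Sum>b\<in>bits 1. (\<Prod>q<n. g q (a ! q)) * g n (b ! 0))"
    unfolding sum_bits_append by (intro sum.cong refl) (auto simp: bits_def nth_append intro!: prod.cong)
  also have "\<dots> = (\<Sum>a\<in>bits n. \<Prod>q<n. g q (a ! q)) * (\<Sum>b\<in>bits 1. g n (b ! 0))"
    by (rule sum_product[symmetric])
  also have "(\<Sum>b\<in>bits 1. g n (b ! 0)) = (\<Sum>x\<in>UNIV. g n x)"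
    by (rule sum.reindex_bij_witness[where i = "\<lambda>x. [x]" and j = "\<lambda>b. b ! 0"])
      (auto simp: bits_def length_Suc_conv)
  finally show ?case using Suc by simp
qed

text \<open>A Pauli index keeps the two bits of a qubit \<open>n\<close> places apart; here they are
  regrouped.\<close>

lemma sum_bits_double:
  fixes F :: "nat \<Rightarrow> bool \<Rightarrow> bool \<Rightarrow> complex"
  shows "(\<Sum>l\<in>bits (2 * n). \<Prod>q<n. F q (l ! q) (l ! (n + q))) = (\<Prod>q<n. \<Sum>x\<in>UNIV. \<Sum>z\<in>UNIV. F q x z)"
proof -
  have "(\<Sum>l\<in>bits (2 * n). \<Prod>q<n. F q (l ! q) (l ! (n + q)))
      = (\<Sum>a\<in>bits n. \<Sum>b\<in>bits n. \<Prod>q<n. F q (a ! q) (b ! q))"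
    unfolding mult_2 sum_bits_append
    by (intro sum.cong refl) (auto simp: bits_def nth_append intro!: prod.cong)
  also have "\<dots> = (\<Sum>a\<in>bits n. \<Prod>q<n. \<Sum>z\<in>UNIV. F q (a ! q) z)"
    by (intro sum.cong refl sum_bits_prod)
  also have "\<dots> = (\<Prod>q<n. \<Sum>x\<in>UNIV. \<Sum>z\<in>UNIV. F q x z)" by (rule sum_bits_prod)
  finally show ?thesis .
qed

lemma prod_of_bool: "finite A \<Longrightarrow> (\<Prod>q\<in>A. of_bool (P q) :: complex) = of_bool (\<forall>q\<in>A. P q)"
  by (induction A rule: finite_induct) auto

text \<open>Tensor products of one-qubit operators, more general than Paulis so that products and
  adjoints stay in the class.\<close>

definition qprod :: "nat \<Rightarrow> (nat \<Rightarrow> (bool, bool) opr) \<Rightarrow> (bool list, bool list) opr" where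
  "qprod n f = (\<lambda>a b. if a \<in> bits n \<and> b \<in> bits n then \<Prod>q<n. f q (a ! q) (b ! q) else 0)"

lemma pauli_eq_qprod: "pauli n l = qprod n (\<lambda>q. pauli1 (l ! q) (l ! (n + q)))"
  by (simp add: pauli_def qprod_def)

lemma qprod_ops: "qprod n f \<in> ops (bits n) (bits n)"
  by (auto simp: qprod_def ops_def)

lemma qprod_mul: "mul (bits n) (qprod n f) (qprod n g) = qprod n (\<lambda>q. mul UNIV (f q) (g q))"
proof (intro ext)
  fix a c
  show "mul (bits n) (qprod n f) (qprod n g) a c = qprod n (\<lambda>q. mul UNIV (f q) (g q)) a c"
  proof (cases "a \<in> bits n \<and> c \<in> bits n")
    case True
    then have "mul (bits n) (qprod n f) (qprod n g) a c
        = (\<Sum>b\<in>bits n. \<Prod>q<n. f q (a ! q) (b ! q) * g q (b ! q) (c ! q))"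
      unfolding mul_def by (intro sum.cong) (auto simp: qprod_def prod.distrib)
    also have "\<dots> = (\<Prod>q<n. \<Sum>x\<in>UNIV. f q (a ! q) x * g q x (c ! q))" by (rule sum_bits_prod)
    finally show ?thesis using True by (simp add: qprod_def mul_def)
  qed (auto simp: mul_def qprod_def)
qed

lemma dagger_qprod: "dagger (qprod n f) = qprod n (\<lambda>q. dagger (f q))"
  by (auto simp: dagger_def qprod_def fun_eq_iff)

lemma qprod_id: "qprod n (\<lambda>q. id_op UNIV) = id_op (bits n)"
  by (auto simp: qprod_def id_op_def fun_eq_iff prod_of_bool bits_def list_eq_iff_nth_eq)

lemma qprod_scale: "qprod n (\<lambda>q. scale (c q) (f q)) = scale (\<Prod>q<n. c q) (qprod n f)"
  by (auto simp: qprod_def scale_def fun_eq_iff prod.distrib)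

lemma pauli1_unitary:
  "mul UNIV (dagger (pauli1 x z)) (pauli1 x z) = id_op UNIV"
  "mul UNIV (pauli1 x z) (dagger (pauli1 x z)) = id_op UNIV"
proof -
  have "mul UNIV (dagger (pauli1 x z)) (pauli1 x z) a b = id_op UNIV a b
      \<and> mul UNIV (pauli1 x z) (dagger (pauli1 x z)) a b = id_op UNIV a b" for a b
    by (cases x; cases z; cases a; cases b) (simp_all add: mul_def dagger_def pauli1_def id_op_def UNIV_bool)
  then show "mul UNIV (dagger (pauli1 x z)) (pauli1 x z) = id_op UNIV"
    "mul UNIV (pauli1 x z) (dagger (pauli1 x z)) = id_op UNIV" by (auto simp: fun_eq_iff)
qed

lemma qprod_pauli1_unitary: "unitary_op (bits n) (qprod n (\<lambda>q. pauli1 (x q) (z q)))"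
  by (simp add: unitary_op_def qprod_ops dagger_qprod qprod_mul pauli1_unitary qprod_id)

lemma pauli_unitary: "unitary_op (bits n) (pauli n l)"
  unfolding pauli_eq_qprod by (rule qprod_pauli1_unitary)

text \<open>A bit flip anticommutes with a phase flip on the same qubit, and each factor accounts
  for one of the two possible pairings; together they form the symplectic character.\<close>

definition sign1 :: "bool \<Rightarrow> bool \<Rightarrow> bool \<Rightarrow> bool \<Rightarrow> complex" where
  "sign1 x z x' z' = (if x \<and> z' then -1 else 1) * (if z \<and> x' then -1 else 1)"

text \<open>The sign by which the Paulis with indices \<open>l\<close> and \<open>k\<close> commute.\<close>

definition csign :: "nat \<Rightarrow> bool list \<Rightarrow> bool list \<Rightarrow> complex" where
  "csign n l k = (\<Prod>q<n. sign1 (l ! q) (l ! (n + q)) (k ! q) (k ! (n + q)))"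

lemma cnj_csign [simp]: "cnj (csign n l k) = csign n l k"
proof -
  have "cnj (sign1 x z x' z') = sign1 x z x' z'" for x z x' z' by (simp add: sign1_def)
  then show ?thesis by (simp add: csign_def)
qed

lemma pauli1_conj:
  "mul UNIV (dagger (pauli1 x' z')) (mul UNIV (pauli1 x z) (pauli1 x' z')) = scale (sign1 x z x' z') (pauli1 x z)"
proof (intro ext)
  fix a b
  show "mul UNIV (dagger (pauli1 x' z')) (mul UNIV (pauli1 x z) (pauli1 x' z')) a b = scale (sign1 x z x' z') (pauli1 x z) a b"
    by (cases x; cases z; cases x'; cases z'; cases a; cases b)
      (simp_all add: mul_def dagger_def pauli1_def scale_def sign1_def UNIV_bool)
qed

lemma pauli_conj:
  "mul (bits n) (dagger (pauli n k)) (mul (bits n) (pauli n l) (pauli n k)) = scale (csign n l k) (pauli n l)"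
  by (simp add: pauli_eq_qprod dagger_qprod qprod_mul pauli1_conj qprod_scale csign_def)

lemma sign1_orthogonal:
  "(\<Sum>x'\<in>UNIV. \<Sum>z'\<in>UNIV. sign1 x z x' z' * sign1 y w x' z') = 4 * of_bool (x = y \<and> z = w)"
  by (cases x; cases z; cases y; cases w) (simp_all add: sign1_def UNIV_bool)

text \<open>For fixed \<open>l\<close> the sign is a character in \<open>k\<close>, and distinct
  indices give distinct characters because the symplectic form is nondegenerate. The proof checks
  this on one qubit, where there are four Paulis.\<close>

lemma csign_orthogonal:
  assumes "l \<in> bits (2 * n)" "l' \<in> bits (2 * n)"
  shows "(\<Sum>k\<in>bits (2 * n). csign n l k * csign n l' k) = 4 ^ n * of_bool (l = l')"
proof -
  have eq: "(\<forall>q<n. l ! q = l' ! q \<and> l ! (n + q) = l' ! (n + q)) \<longleftrightarrow> l = l'"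
  proof
    assume *: "\<forall>q<n. l ! q = l' ! q \<and> l ! (n + q) = l' ! (n + q)"
    show "l = l'"
    proof (rule nth_equalityI)
      fix i assume i: "i < length l"
      show "l ! i = l' ! i"
      proof (cases "i < n")
        case False
        then have "i - n < n" "i = n + (i - n)" using i assms by (auto simp: bits_def)
        then show ?thesis using * by metis
      qed (use * in simp)
    qed (use assms in \<open>simp add: bits_def\<close>)
  qed simp
  have "(\<Sum>k\<in>bits (2 * n). csign n l k * csign n l' k)
      = (\<Prod>q<n. 4 * of_bool (l ! q = l' ! q \<and> l ! (n + q) = l' ! (n + q)))"
    unfolding csign_def prod.distrib[symmetric] sign1_orthogonal[symmetric] by (rule sum_bits_double)
  also have "\<dots> = 4 ^ n * of_bool (l = l')"
    by (simp only: prod.distrib prod_constant card_lessThan prod_of_bool finite_lessThan)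
      (simp add: Ball_def eq)
  finally show ?thesis .
qed

lemma pauli1_complete:
  "(\<Sum>x\<in>UNIV. \<Sum>z\<in>UNIV. pauli1 x z a b * cnj (pauli1 x z c d)) = 2 * of_bool (a = c \<and> b = d)"
  by (cases a; cases b; cases c; cases d) (simp_all add: pauli1_def UNIV_bool)

text \<open>The sum runs over the Paulis and not over matrix entries: it is this completeness
  relation, not trace orthogonality, that inverts the Pauli expansion of Kraus operators and gives
  Parseval's identity.\<close>

lemma pauli_complete:
  assumes "a \<in> bits n" "b \<in> bits n" "c \<in> bits n" "d \<in> bits n"
  shows "(\<Sum>l\<in>bits (2 * n). pauli n l a b * cnj (pauli n l c d)) = 2 ^ n * of_bool (a = c \<and> b = d)"
proof -
  have "(\<Sum>l\<in>bits (2 * n). pauli n l a b * cnj (pauli n l c d))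
      = (\<Sum>l\<in>bits (2 * n). \<Prod>q<n. pauli1 (l ! q) (l ! (n + q)) (a ! q) (b ! q)
          * cnj (pauli1 (l ! q) (l ! (n + q)) (c ! q) (d ! q)))"
    using assms by (simp add: pauli_def prod.distrib)
  also have "\<dots> = (\<Prod>q<n. 2 * of_bool (a ! q = c ! q \<and> b ! q = d ! q))"
    unfolding sum_bits_double[where F = "\<lambda>q x z. pauli1 x z (a ! q) (b ! q) * cnj (pauli1 x z (c ! q) (d ! q))"]
      pauli1_complete ..
  also have "\<dots> = 2 ^ n * of_bool (\<forall>q<n. a ! q = c ! q \<and> b ! q = d ! q)"
    by (simp only: prod.distrib prod_constant card_lessThan prod_of_bool finite_lessThan) (simp add: Ball_def)
  also have "(\<forall>q<n. a ! q = c ! q \<and> b ! q = d ! q) \<longleftrightarrow> a = c \<and> b = d"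
    using assms by (auto simp: bits_def list_eq_iff_nth_eq)
  finally show ?thesis .
qed

lemma pauli_zero: "pauli n (replicate (2 * n) False) = id_op (bits n)"
proof -
  have "pauli1 False False = id_op UNIV"
    by (intro ext) (auto simp: pauli1_def id_op_def)
  then have "qprod n (\<lambda>q. pauli1 (replicate (2 * n) False ! q) (replicate (2 * n) False ! (n + q)))
      = qprod n (\<lambda>q. id_op UNIV)"
    by (auto simp: qprod_def fun_eq_iff intro!: prod.cong)
  then show ?thesis by (simp add: pauli_eq_qprod qprod_id)
qed

text \<open>A bit flip on a tag qubit leaves the zero tag, so the entry vanishes; a phase flip acts
  trivially on it. The phase bits of the message start at \<open>m + t\<close>, behind the flip bits
  of all qubits.\<close>

lemma pauli_restrict_to_zero_tag:
  assumes l: "l \<in> bits (2 * (m + t))" and a: "a \<in> bits m" "a' \<in> bits m"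
  shows "pauli (m + t) l (a @ replicate t False) (a' @ replicate t False)
    = of_bool (l \<in> undetected m t) * qprod m (\<lambda>q. pauli1 (l ! q) (l ! (m + t + q))) a a'"
proof -
  let ?f = "\<lambda>q. pauli1 (l ! q) (l ! (m + t + q)) ((a @ replicate t False) ! q) ((a' @ replicate t False) ! q)"
  have "pauli (m + t) l (a @ replicate t False) (a' @ replicate t False) = (\<Prod>q<m + t. ?f q)"
    using a by (simp add: pauli_def)
  also have "\<dots> = (\<Prod>q<m. ?f q) * (\<Prod>q\<in>{m..<m + t}. ?f q)"
    by (subst prod.union_disjoint[symmetric]) (auto intro!: prod.cong)
  also have "(\<Prod>q\<in>{m..<m + t}. ?f q) = (\<Prod>q\<in>{m..<m + t}. of_bool (\<not> l ! q))"
    using a by (intro prod.cong refl) (auto simp: bits_def nth_append pauli1_def)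
  also have "\<dots> = of_bool (l \<in> undetected m t)"
    using l by (simp add: prod_of_bool undetected_def)
  also have "(\<Prod>q<m. ?f q) = qprod m (\<lambda>q. pauli1 (l ! q) (l ! (m + t + q))) a a'"
    using a by (auto simp: qprod_def bits_def nth_append intro!: prod.cong)
  finally show ?thesis by (simp add: mult.commute)
qed

subsection \<open>Conjugation of Paulis by the code\<close>

definition code_conj :: "nat \<Rightarrow> (bool list, bool list) opr \<Rightarrow> bool list \<Rightarrow> (bool list, bool list) opr" where
  "code_conj n V l = mul (bits n) (dagger V) (mul (bits n) (pauli n l) V)"

text \<open>The event whose probability strong purity testing bounds, for a single code.\<close>

definition passes :: "nat \<Rightarrow> nat \<Rightarrow> (bool list, bool list) opr \<Rightarrow> bool list \<Rightarrow> bool" where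
  "passes m t V l \<longleftrightarrow> (\<exists>l'\<in>undetected m t. \<exists>\<theta>::real. code_conj (m + t) V l = scale (cis \<theta>) (pauli (m + t) l'))"

lemma code_conj_unitary: "unitary_op (bits n) V \<Longrightarrow> unitary_op (bits n) (code_conj n V l)"
  unfolding code_conj_def by (intro unitary_mul unitary_dagger pauli_unitary finite_bits)

lemma code_conj_zero:
  assumes "unitary_op (bits n) V"
  shows "code_conj n V (replicate (2 * n) False) = id_op (bits n)"
  using assms by (simp add: code_conj_def pauli_zero mul_id_left[OF finite_bits, of V n "bits n"] unitary_op_def)

text \<open>The Pauli of the key acts after the code, so in the conjugated error it meets
  \<open>P_l\<close> directly and contributes only a commutation sign.\<close>

lemma encryption_conj:
  fixes V :: "(bool list, bool list) opr" and n :: nat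
  defines "U \<equiv> \<lambda>k. mul (bits n) (pauli n k) V"
  shows "mul (bits n) (dagger (U k)) (mul (bits n) (pauli n l) (U k)) = scale (csign n l k) (code_conj n V l)"
proof -
  have "mul (bits n) (dagger (U k)) (mul (bits n) (pauli n l) (U k))
     = mul (bits n) (dagger V) (mul (bits n) (mul (bits n) (dagger (pauli n k)) (mul (bits n) (pauli n l) (pauli n k))) V)"
    by (simp add: U_def dagger_mul mul_assoc)
  then show ?thesis unfolding pauli_conj by (simp add: mul_scale_left mul_scale_right code_conj_def)
qed

text \<open>The conjugated error is a phase times one Pauli. Its block on the zero tag is then zero,
  or a phase times a Pauli on the message and so unitary; the phase cancels.\<close>

lemma code_conj_restrict:
  assumes V: "pauli_code m t V" and l: "l \<in> bits (2 * (m + t))" and b: "b \<in> bits m" "b' \<in> bits m"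
  defines "W \<equiv> \<lambda>a b. code_conj (m + t) V l (a @ replicate t False) (b @ replicate t False)"
  shows "(\<Sum>a\<in>bits m. cnj (W a b) * W a b') = of_bool (passes m t V l) * of_bool (b = b')"
proof -
  let ?n = "m + t"
  \<comment> \<open>Shown for any Pauli form of the conjugated error, since the index in
    \<open>passes\<close> and the index supplied by \<open>pauli_code\<close> come from separate
    existential statements.\<close>
  have *: "(\<Sum>a\<in>bits m. cnj (W a b) * W a b') = of_bool (l' \<in> undetected m t) * of_bool (b = b')"
    if G: "code_conj ?n V l = scale (cis \<theta>) (pauli ?n l')" and l': "l' \<in> bits (2 * ?n)" for l' \<theta>
  proof -
    let ?Q = "qprod m (\<lambda>q. pauli1 (l' ! q) (l' ! (m + t + q)))"
    have "(\<Sum>a\<in>bits m. cnj (W a b) * W a b')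
        = (\<Sum>a\<in>bits m. (cnj (cis \<theta>) * cis \<theta>) * of_bool (l' \<in> undetected m t) * (cnj (?Q a b) * ?Q a b'))"
      unfolding W_def G
      by (intro sum.cong refl) (auto simp: scale_def pauli_restrict_to_zero_tag[OF l'] b)
    also have "cnj (cis \<theta>) * cis \<theta> = 1" by (simp add: cis_cnj cis_mult)
    finally show ?thesis
      using unitary_columns[OF qprod_pauli1_unitary b(1), of "\<lambda>q. l' ! q" "\<lambda>q. l' ! (m + t + q)" b']
      by (simp flip: sum_distrib_left)
  qed
  obtain l' \<theta> where l': "l' \<in> bits (2 * ?n)"
    and eq: "mul (bits ?n) (pauli ?n l) V = scale (cis \<theta>) (mul (bits ?n) V (pauli ?n l'))"
    using V l unfolding pauli_code_def by blast
  have V': "unitary_op (bits ?n) V" using V by (simp add: pauli_code_def)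
  have "code_conj ?n V l = scale (cis \<theta>) (mul (bits ?n) (mul (bits ?n) (dagger V) V) (pauli ?n l'))"
    unfolding code_conj_def eq by (simp add: mul_scale_right mul_assoc)
  also have "\<dots> = scale (cis \<theta>) (pauli ?n l')"
    using V' pauli_unitary[of ?n l'] by (simp add: unitary_op_def mul_id_left[OF finite_bits, of "pauli ?n l'" ?n "bits ?n"])
  finally have G: "code_conj ?n V l = scale (cis \<theta>) (pauli ?n l')" .
  show ?thesis
  proof (cases "passes m t V l")
    case True
    then obtain l'' \<theta>' where "l'' \<in> undetected m t" "code_conj ?n V l = scale (cis \<theta>') (pauli ?n l'')"
      by (auto simp: passes_def)
    then show ?thesis using *[of \<theta>' l''] True by (simp add: undetected_def)
  next
    case False
    then have "l' \<notin> undetected m t" using G by (auto simp: passes_def)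
    then show ?thesis using *[OF G l'] False by simp
  qed
qed

subsection \<open>Splitting a register in two\<close>

lemma split_reg_ops: "split_reg m t X \<in> ops (bits m \<times> bits t) (bits m \<times> bits t)"
  by (auto simp: split_reg_def ops_def)

lemma dagger_split_reg: "dagger (split_reg m t X) = split_reg m t (dagger X)"
  by (auto simp: split_reg_def dagger_def fun_eq_iff)

lemma mul_split_reg:
  "mul (bits m \<times> bits t) (split_reg m t X) (split_reg m t Y) = split_reg m t (mul (bits (m + t)) X Y)"
proof (intro ext)
  fix p q :: "bool list \<times> bool list"
  show "mul (bits m \<times> bits t) (split_reg m t X) (split_reg m t Y) p q = split_reg m t (mul (bits (m + t)) X Y) p q"
  proof (cases "p \<in> bits m \<times> bits t \<and> q \<in> bits m \<times> bits t")
    case True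
    have "mul (bits m \<times> bits t) (split_reg m t X) (split_reg m t Y) p q
        = (\<Sum>a\<in>bits m. \<Sum>b\<in>bits t. X (fst p @ snd p) (a @ b) * Y (a @ b) (fst q @ snd q))"
      unfolding mul_def sum.cartesian_product' using True
      by (intro sum.cong refl) (auto simp: split_reg_def case_prod_unfold)
    then show ?thesis using True
      by (simp add: split_reg_def mul_def sum_bits_append case_prod_unfold mem_Times_iff)
  qed (auto simp: split_reg_def mul_def case_prod_unfold mem_Times_iff intro!: sum.neutral)
qed

lemma split_reg_id: "split_reg m t (id_op (bits (m + t))) = id_op (bits m \<times> bits t)"
  by (auto simp: split_reg_def id_op_def fun_eq_iff bits_def)

lemma split_reg_scale: "split_reg m t (scale c X) = scale c (split_reg m t X)"
  by (auto simp: split_reg_def scale_def fun_eq_iff)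

lemma unitary_split_reg: "unitary_op (bits (m + t)) U \<Longrightarrow> unitary_op (bits m \<times> bits t) (split_reg m t U)"
  by (simp add: unitary_op_def split_reg_ops dagger_split_reg mul_split_reg split_reg_id)

subsection \<open>Calculus of sandwiched operators\<close>

text \<open>Partial traces, tag measurements and flag registers all select or relabel basis vectors,
  so one evaluation rule serves them.\<close>

lemma sandwich_select:
  assumes "finite A" "\<And>i. i \<in> I \<Longrightarrow> g i \<in> A"
  shows "sandwich A (\<lambda>i a. of_bool (i \<in> I \<and> a = g i)) X i j = of_bool (i \<in> I \<and> j \<in> I) * X (g i) (g j)"
proof (cases "i \<in> I \<and> j \<in> I")
  case True
  have "sandwich A (\<lambda>i a. of_bool (i \<in> I \<and> a = g i)) X i j
      = (\<Sum>a\<in>A. if a = g i then (\<Sum>b\<in>A. if b = g j then X a b else 0) else 0)"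
    unfolding sandwich2_def by (intro sum.cong refl) (use True in \<open>auto intro!: sum.cong\<close>)
  also have "\<dots> = X (g i) (g j)" using True assms by simp
  finally show ?thesis using True by simp
qed (auto simp: sandwich2_def)

lemma sandwich_sum:
  "sandwich2 A (\<lambda>i a. \<Sum>l\<in>L. c l * F l i a) (\<lambda>i a. \<Sum>l\<in>L. c' l * F l i a) X i j
    = (\<Sum>l\<in>L. \<Sum>l'\<in>L. c l * cnj (c' l') * sandwich2 A (F l) (F l') X i j)"
proof -
  have "sandwich2 A (\<lambda>i a. \<Sum>l\<in>L. c l * F l i a) (\<lambda>i a. \<Sum>l\<in>L. c' l * F l i a) X i j
      = (\<Sum>a\<in>A. \<Sum>b\<in>A. \<Sum>l\<in>L. \<Sum>l'\<in>L. c l * cnj (c' l') * (F l i a * X a b * cnj (F l' j b)))"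
    by (simp add: sandwich2_def sum_distrib_left sum_distrib_right mult_ac)
  also have "\<dots> = (\<Sum>l\<in>L. \<Sum>l'\<in>L. \<Sum>a\<in>A. \<Sum>b\<in>A. c l * cnj (c' l') * (F l i a * X a b * cnj (F l' j b)))"
    by (rule sum_swap_pairs)
  finally show ?thesis by (simp add: sandwich2_def sum_distrib_left)
qed

text \<open>Expanding the sandwich produces pairs of errors with a product of two characters of the
  key; orthogonality leaves the diagonal pairs. A subset \<open>L\<close> is allowed so that the
  identity error can be left out.\<close>

lemma pauli_twirl:
  assumes L: "L \<subseteq> bits (2 * n)"
  shows "(\<Sum>k\<in>bits (2 * n). sandwich A (\<lambda>i a. \<Sum>l\<in>L. csign n l k * F l i a) X i j)
    = 4 ^ n * (\<Sum>l\<in>L. sandwich A (F l) X i j)"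
proof -
  have fin: "finite L" using L finite_subset finite_bits by blast
  have "(\<Sum>k\<in>bits (2 * n). sandwich A (\<lambda>i a. \<Sum>l\<in>L. csign n l k * F l i a) X i j)
      = (\<Sum>k\<in>bits (2 * n). \<Sum>l\<in>L. \<Sum>l'\<in>L. csign n l k * csign n l' k * sandwich2 A (F l) (F l') X i j)"
    unfolding sandwich_sum by simp
  also have "\<dots> = (\<Sum>l\<in>L. \<Sum>k\<in>bits (2 * n). \<Sum>l'\<in>L. csign n l k * csign n l' k * sandwich2 A (F l) (F l') X i j)"
    by (rule sum.swap)
  also have "\<dots> = (\<Sum>l\<in>L. \<Sum>l'\<in>L. \<Sum>k\<in>bits (2 * n). csign n l k * csign n l' k * sandwich2 A (F l) (F l') X i j)"
    by (rule sum.cong[OF refl], rule sum.swap)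
  also have "\<dots> = (\<Sum>l\<in>L. \<Sum>l'\<in>L. if l' = l then 4 ^ n * sandwich A (F l) X i j else 0)"
  proof (intro sum.cong refl)
    fix l l' assume "l \<in> L" "l' \<in> L"
    then show "(\<Sum>k\<in>bits (2 * n). csign n l k * csign n l' k * sandwich2 A (F l) (F l') X i j)
        = (if l' = l then 4 ^ n * sandwich A (F l) X i j else 0)"
      using csign_orthogonal[of l n l'] subsetD[OF L] by (simp flip: sum_distrib_right)
  qed
  also have "\<dots> = 4 ^ n * (\<Sum>l\<in>L. sandwich A (F l) X i j)"
    using fin by (simp add: sum_distrib_left)
  finally show ?thesis .
qed

lemma sandwich_scale_op:
  "sandwich A (\<lambda>i a. c * F i a) X i j = complex_of_real ((cmod c)\<^sup>2) * sandwich A F X i j"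
  by (simp add: sandwich2_def sum_distrib_left mult_ac complex_norm_square del: of_real_power)

text \<open>When the columns of \<open>C\<close> over the rows \<open>S\<close> are orthogonal with
  common squared norm \<open>c\<close>, tracing out those rows forgets \<open>C\<close> except for
  this weight. \<open>S\<close> may be a part of the output register, as for the rejected
  tags.\<close>

lemma sandwich_tensor_ptrace:
  assumes fin: "finite A"
    and C: "\<And>a a'. a \<in> A \<Longrightarrow> a' \<in> A \<Longrightarrow> (\<Sum>x\<in>S. C x a * cnj (C x a')) = c * of_bool (a = a')"
  shows "(\<Sum>x\<in>S. sandwich (A \<times> R) (tensor C E) \<rho> (x, r) (x, r')) = c * sandwich R E (ptrace1 A \<rho>) r r'"
proof -
  let ?g = "\<lambda>p q. E r (snd p) * \<rho> p q * cnj (E r' (snd q))"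
  have "(\<Sum>x\<in>S. sandwich (A \<times> R) (tensor C E) \<rho> (x, r) (x, r'))
      = (\<Sum>x\<in>S. \<Sum>p\<in>A \<times> R. \<Sum>q\<in>A \<times> R. C x (fst p) * cnj (C x (fst q)) * ?g p q)"
    by (simp add: sandwich2_def tensor_def case_prod_unfold mult_ac)
  also have "\<dots> = (\<Sum>p\<in>A \<times> R. \<Sum>x\<in>S. \<Sum>q\<in>A \<times> R. C x (fst p) * cnj (C x (fst q)) * ?g p q)"
    by (rule sum.swap)
  also have "\<dots> = (\<Sum>p\<in>A \<times> R. \<Sum>q\<in>A \<times> R. \<Sum>x\<in>S. C x (fst p) * cnj (C x (fst q)) * ?g p q)"
    by (rule sum.cong[OF refl], rule sum.swap)
  also have "\<dots> = (\<Sum>p\<in>A \<times> R. \<Sum>q\<in>A \<times> R. c * of_bool (fst p = fst q) * ?g p q)"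
    by (intro sum.cong refl) (auto simp: C simp flip: sum_distrib_right)
  also have "\<dots> = (\<Sum>a\<in>A. \<Sum>s\<in>R. \<Sum>a'\<in>A. if a' = a then \<Sum>s'\<in>R. c * ?g (a, s) (a, s') else 0)"
    unfolding sum.cartesian_product' by (intro sum.cong refl) auto
  also have "\<dots> = (\<Sum>a\<in>A. \<Sum>s\<in>R. \<Sum>s'\<in>R. c * ?g (a, s) (a, s'))"
    using fin by (intro sum.cong refl) simp
  also have "\<dots> = (\<Sum>s\<in>R. \<Sum>a\<in>A. \<Sum>s'\<in>R. c * ?g (a, s) (a, s'))"
    by (rule sum.swap)
  also have "\<dots> = (\<Sum>s\<in>R. \<Sum>s'\<in>R. \<Sum>a\<in>A. c * ?g (a, s) (a, s'))"
    by (rule sum.cong[OF refl], rule sum.swap)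
  also have "\<dots> = c * sandwich R E (ptrace1 A \<rho>) r r'"
    by (simp add: sandwich2_def ptrace1_def sum_distrib_left sum_distrib_right mult_ac)
  finally show ?thesis .
qed

lemma trace_sandwich_tensor:
  assumes fin: "finite A"
    and C: "\<And>a a'. a \<in> A \<Longrightarrow> a' \<in> A \<Longrightarrow> (\<Sum>x\<in>A. C x a * cnj (C x a')) = c * of_bool (a = a')"
  shows "trace_op (A \<times> R) (sandwich (A \<times> R) (tensor C E) \<rho>) = c * trace_op R (sandwich R E (ptrace1 A \<rho>))"
proof -
  have "trace_op (A \<times> R) (sandwich (A \<times> R) (tensor C E) \<rho>)
      = (\<Sum>a\<in>A. \<Sum>r\<in>R. sandwich (A \<times> R) (tensor C E) \<rho> (a, r) (a, r))"
    by (simp add: trace_op_def sum.cartesian_product')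
  also have "\<dots> = (\<Sum>r\<in>R. \<Sum>a\<in>A. sandwich (A \<times> R) (tensor C E) \<rho> (a, r) (a, r))"
    by (rule sum.swap)
  also have "\<dots> = (\<Sum>r\<in>R. c * sandwich R E (ptrace1 A \<rho>) r r)"
    by (intro sum.cong refl sandwich_tensor_ptrace[OF fin] C)
  finally show ?thesis by (simp add: trace_op_def sum_distrib_left)
qed

lemma id_op_columns:
  assumes "finite A" "a \<in> A" "a' \<in> A"
  shows "(\<Sum>x\<in>A. id_op A x a * cnj (id_op A x a')) = 1 * of_bool (a = a')"
proof -
  have "(\<Sum>x\<in>A. id_op A x a * cnj (id_op A x a')) = (\<Sum>x\<in>A. if x = a then of_bool (a = a') else 0)"
    using assms by (intro sum.cong) (auto simp: id_op_def)
  then show ?thesis using assms by simp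
qed

lemma trace_ptrace1: "trace_op R (ptrace1 A \<rho>) = trace_op (A \<times> R) \<rho>"
proof -
  have "trace_op (A \<times> R) \<rho> = (\<Sum>a\<in>A. \<Sum>r\<in>R. \<rho> (a, r) (a, r))"
    by (simp add: trace_op_def sum.cartesian_product')
  also have "\<dots> = (\<Sum>r\<in>R. \<Sum>a\<in>A. \<rho> (a, r) (a, r))" by (rule sum.swap)
  finally show ?thesis by (simp add: trace_op_def ptrace1_def)
qed

lemma psd_trace_nonneg:
  assumes "finite A" "psd A X"
  shows "0 \<le> Re (trace_op A X)"
proof -
  have "0 \<le> Re (X a a)" if "a \<in> A" for a
    using psd_inner_nonneg(1)[OF assms(2), of "basis_ket a"] that assms(1) by (simp add: inner_ket_basis)
  then show ?thesis by (simp add: trace_op_def sum_nonneg)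
qed

lemma ptrace1_as_sandwich:
  assumes "finite A" "finite R" "X \<in> ops (A \<times> R) (A \<times> R)"
  shows "ptrace1 A X = (\<lambda>i j. \<Sum>a\<in>A. sandwich (A \<times> R) (\<lambda>r p. of_bool (r \<in> R \<and> p = (a, r))) X i j)"
proof (intro ext)
  fix i j
  have "(\<Sum>a\<in>A. sandwich (A \<times> R) (\<lambda>r p. of_bool (r \<in> R \<and> p = (a, r))) X i j)
      = (\<Sum>a\<in>A. of_bool (i \<in> R \<and> j \<in> R) * X (a, i) (a, j))"
    using assms by (intro sum.cong refl, subst sandwich_select) auto
  then show "ptrace1 A X i j = (\<Sum>a\<in>A. sandwich (A \<times> R) (\<lambda>r p. of_bool (r \<in> R \<and> p = (a, r))) X i j)"
    using assms(3) by (auto simp: ptrace1_def ops_def intro!: sum.cong)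
qed

lemma psd_ptrace1:
  assumes "finite A" "finite R" "psd (A \<times> R) X"
  shows "psd R (ptrace1 A X)"
  unfolding ptrace1_as_sandwich[OF assms(1,2) psd_opsD[OF assms(3)]]
  by (intro psd_sum psd_sandwich[OF assms(3)]) auto

lemma cpos_ptrace1:
  assumes "finite A" "finite R"
  shows "cpos (A \<times> R) R (ptrace1 A)"
proof (rule cpos_congI)
  show "cpos (A \<times> R) R (\<lambda>X i j. \<Sum>a\<in>A. sandwich (A \<times> R) (\<lambda>r p. of_bool (r \<in> R \<and> p = (a, r))) X i j)"
    by (intro cpos_sum cpos_sandwich) auto
qed (rule ptrace1_as_sandwich[OF assms])

lemma dominated_comp_left:
  assumes "dominated A B \<Delta> \<nu>" "cpos B C \<Phi>"
    and "\<And>X Y. \<Phi> (\<lambda>i j. X i j + Y i j) = (\<lambda>i j. \<Phi> X i j + \<Phi> Y i j)"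
    and "\<And>X Y. \<Phi> (\<lambda>i j. X i j - Y i j) = (\<lambda>i j. \<Phi> X i j - \<Phi> Y i j)"
  shows "dominated A C (\<lambda>X. \<Phi> (\<Delta> X)) (\<lambda>X. \<Phi> (\<nu> X))"
  using cpos_comp[of A B "\<lambda>X i j. \<nu> X i j + \<Delta> X i j" C \<Phi>]
    cpos_comp[of A B "\<lambda>X i j. \<nu> X i j - \<Delta> X i j" C \<Phi>] assms
  by (simp add: dominated_def)

lemma dominated_comp_right:
  assumes "dominated B C \<Delta> \<nu>" "cpos A B \<Phi>"
  shows "dominated A C (\<lambda>X. \<Delta> (\<Phi> X)) (\<lambda>X. \<nu> (\<Phi> X))"
  using cpos_comp[of A B \<Phi> C "\<lambda>X i j. \<nu> X i j + \<Delta> X i j"]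
    cpos_comp[of A B \<Phi> C "\<lambda>X i j. \<nu> X i j - \<Delta> X i j"] assms
  by (simp add: dominated_def)

subsection \<open>The flagged output registers\<close>

definition acc_flag :: "'x \<Rightarrow> ('m \<times> 'r, ('m option \<times> 'r) \<times> ('x + 'l)) superop" where
  "acc_flag k Y = tensor (embed_msg Y) (ketbra (basis_ket (Inl k)))"

definition rej_flag :: "'l \<Rightarrow> ('r, ('m option \<times> 'r) \<times> ('x + 'l)) superop" where
  "rej_flag l Y = tensor (bot_msg Y) (ketbra (basis_ket (Inr l)))"

lemma acc_flag_add: "acc_flag k (\<lambda>i j. X i j + Y i j) = (\<lambda>i j. acc_flag k X i j + acc_flag k Y i j)"
  by (auto simp: acc_flag_def tensor_def embed_msg_def fun_eq_iff algebra_simps split: option.splits)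

lemma acc_flag_diff: "acc_flag k (\<lambda>i j. X i j - Y i j) = (\<lambda>i j. acc_flag k X i j - acc_flag k Y i j)"
  by (auto simp: acc_flag_def tensor_def embed_msg_def fun_eq_iff algebra_simps split: option.splits)

lemma rej_flag_add: "rej_flag k (\<lambda>i j. X i j + Y i j) = (\<lambda>i j. rej_flag k X i j + rej_flag k Y i j)"
  by (auto simp: rej_flag_def tensor_def bot_msg_def fun_eq_iff algebra_simps)

lemma rej_flag_diff: "rej_flag k (\<lambda>i j. X i j - Y i j) = (\<lambda>i j. rej_flag k X i j - rej_flag k Y i j)"
  by (auto simp: rej_flag_def tensor_def bot_msg_def fun_eq_iff algebra_simps)

lemma rej_flag_sum: "rej_flag k (\<lambda>i j. \<Sum>s\<in>S. X s i j) i j = (\<Sum>s\<in>S. rej_flag k (X s) i j)"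
  by (auto simp: rej_flag_def tensor_def bot_msg_def sum_distrib_left sum_distrib_right split: prod.splits)

lemma rej_flag_mult: "rej_flag k (\<lambda>i j. c * X i j) i j = c * rej_flag k X i j"
  by (auto simp: rej_flag_def tensor_def bot_msg_def split: prod.splits)

lemma cpos_acc_flag:
  assumes "finite M" "finite R" "k \<in> Ks"
  shows "cpos (M \<times> R) ((insert None (Some ` M) \<times> R) \<times> (Ks <+> L)) (acc_flag k)"
proof -
  let ?I = "{((Some a, r), Inl k) | a r. a \<in> M \<and> r \<in> R}"
  let ?K = "\<lambda>i p. of_bool (i \<in> ?I \<and> p = (the (fst (fst i)), snd (fst i)))"
  have eq: "acc_flag k X = sandwich (M \<times> R) ?K X" if "X \<in> ops (M \<times> R) (M \<times> R)" for X
  proof (intro ext)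
    fix i j
    have "sandwich (M \<times> R) ?K X i j
        = of_bool (i \<in> ?I \<and> j \<in> ?I) * X (the (fst (fst i)), snd (fst i)) (the (fst (fst j)), snd (fst j))"
      using assms by (intro sandwich_select) auto
    also have "\<dots> = acc_flag k X i j"
      using that by (cases i; cases j)
        (auto simp: acc_flag_def tensor_def embed_msg_def ketbra_def basis_ket_def ops_def split: option.splits)
    finally show "acc_flag k X i j = sandwich (M \<times> R) ?K X i j" by simp
  qed
  show ?thesis
    by (rule cpos_congI[where \<Phi> = "sandwich (M \<times> R) ?K", OF cpos_sandwich eq]) (use assms in auto)
qed

lemma cpos_rej_flag:
  assumes "finite R" "l \<in> L"
  shows "cpos R ((insert None (Some ` M) \<times> R) \<times> (Ks <+> L)) (rej_flag l)"
proof -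
  let ?I = "{((None, r), Inr l) | r. r \<in> R}"
  let ?K = "\<lambda>i p. of_bool (i \<in> ?I \<and> p = snd (fst i))"
  have eq: "rej_flag l X = sandwich R ?K X" if "X \<in> ops R R" for X
  proof (intro ext)
    fix i j
    have "sandwich R ?K X i j = of_bool (i \<in> ?I \<and> j \<in> ?I) * X (snd (fst i)) (snd (fst j))"
      using assms by (intro sandwich_select) auto
    also have "\<dots> = rej_flag l X i j"
      using that by (cases i; cases j)
        (auto simp: rej_flag_def tensor_def bot_msg_def ketbra_def basis_ket_def ops_def)
    finally show "rej_flag l X i j = sandwich R ?K X i j" by simp
  qed
  show ?thesis
    by (rule cpos_congI[where \<Phi> = "sandwich R ?K", OF cpos_sandwich eq]) (use assms in auto)
qed

lemma trace_tensor: "trace_op (A \<times> B) (tensor X Y) = trace_op A X * trace_op B Y"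
  by (simp add: trace_op_def tensor_def sum.cartesian_product' sum_product)

lemma trace_ketbra_basis:
  assumes "finite A" "a \<in> A"
  shows "trace_op A (ketbra (basis_ket a)) = 1"
proof -
  have "trace_op A (ketbra (basis_ket a)) = (\<Sum>i\<in>A. if i = a then 1 else 0)"
    unfolding trace_op_def ketbra_def basis_ket_def by (intro sum.cong) auto
  then show ?thesis using assms by simp
qed

lemma trace_acc_flag:
  assumes "finite M" "finite Ks" "finite L" "k \<in> Ks"
  shows "trace_op ((insert None (Some ` M) \<times> R) \<times> (Ks <+> L)) (acc_flag k Y) = trace_op (M \<times> R) Y"
proof -
  have "trace_op (insert None (Some ` M) \<times> R) (embed_msg Y) = trace_op (M \<times> R) Y"
    using assms by (simp add: trace_op_def embed_msg_def sum.cartesian_product' sum.reindex)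
  then show ?thesis using assms unfolding acc_flag_def trace_tensor
    by (subst trace_ketbra_basis) auto
qed

lemma trace_rej_flag:
  assumes "finite M" "finite Ks" "finite L" "l \<in> L"
  shows "trace_op ((insert None (Some ` M) \<times> R) \<times> (Ks <+> L)) (rej_flag l Y) = trace_op R Y"
proof -
  have "trace_op (insert None (Some ` M)) (ketbra (basis_ket None)) = 1"
    using assms by (intro trace_ketbra_basis) auto
  moreover have "trace_op (Ks <+> L) (ketbra (basis_ket (Inr l))) = 1"
    using assms by (intro trace_ketbra_basis) auto
  ultimately show ?thesis unfolding rej_flag_def bot_msg_def trace_tensor by simp
qed

subsection \<open>The error bound\<close>

lemma trace_op_sum: "trace_op A (\<lambda>i j. \<Sum>s\<in>S. X s i j) = (\<Sum>s\<in>S. trace_op A (X s))"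
  unfolding trace_op_def by (rule sum.swap)

lemma trace_op_mult: "trace_op A (\<lambda>i j. c * X i j) = c * trace_op A X"
  by (simp add: trace_op_def sum_distrib_left)

lemma trace_op_add: "trace_op A (\<lambda>i j. X i j + Y i j) = trace_op A X + trace_op A Y"
  by (simp add: trace_op_def sum.distrib)

lemma sandwich_add:
  "sandwich A (\<lambda>i a. F i a + G i a) X i j
    = sandwich A F X i j + (sandwich2 A F G X i j + sandwich2 A G F X i j) + sandwich A G X i j"
  by (simp add: sandwich2_def algebra_simps sum.distrib)

lemma csign_zero: "csign n (replicate (2 * n) False) k = 1"
  by (simp add: csign_def sign1_def)

text \<open>
  The operators \<open>E e l\<close> are the coefficients of the \<open>e\<close>-th Kraus operator of the attack at the Pauli
  with index \<open>l\<close>.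
\<close>

locale purity_setup =
  fixes m t d ne :: nat and K :: "'k set" and V :: "'k \<Rightarrow> (bool list, bool list) opr"
    and E :: "nat \<Rightarrow> bool list \<Rightarrow> (nat, nat) opr"
  assumes finK: "finite K" and K_ne: "K \<noteq> {}" and code: "\<And>k. k \<in> K \<Longrightarrow> pauli_code m t (V k)"
    and E_ops: "\<And>e l. E e l \<in> ops {..<d} {..<d}"
    and E_columns: "\<And>s s'. s < d \<Longrightarrow> s' < d \<Longrightarrow>
      (\<Sum>e<ne. \<Sum>l\<in>bits (2 * (m + t)). \<Sum>r<d. E e l r s * cnj (E e l r s')) = of_bool (s = s')"
begin

abbreviation "R \<equiv> {..<d}"
abbreviation "M \<equiv> bits m"
definition "\<Lambda> = bits (2 * (m + t))"
definition "l0 = replicate (2 * (m + t)) False"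
abbreviation "out \<equiv> (insert None (Some ` M) \<times> R) \<times> (K \<times> \<Lambda> <+> K)"

text \<open>The block that starts and ends with the zero tag, that is, the action of the error on a
  message that is accepted.\<close>

definition W :: "'k \<Rightarrow> bool list \<Rightarrow> (bool list, bool list) opr" where
  "W k l = (\<lambda>a b. if a \<in> M \<and> b \<in> M
     then code_conj (m + t) (V k) l (a @ replicate t False) (b @ replicate t False) else 0)"

definition pass :: "'k \<Rightarrow> bool list \<Rightarrow> real" where
  "pass k l = of_bool (passes m t (V k) l)"

definition pass_prob :: "bool list \<Rightarrow> real" where
  "pass_prob l = (\<Sum>k\<in>K. pass k l) / card K"

text \<open>The EPR expectation value of \<open>W\<close> acting on one half, which is its
  normalised trace.\<close>

definition overlap :: "'k \<Rightarrow> bool list \<Rightarrow> complex" where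
  "overlap k l = (\<Sum>a\<in>M. W k l a a) / 2 ^ m"

text \<open>
  After the Pauli twirl, the ideal accepting map applies each \<open>E e l\<close> with the following weight.
\<close>

definition sim_prob :: "bool list \<Rightarrow> real" where
  "sim_prob l = (\<Sum>k\<in>K. (cmod (overlap k l))\<^sup>2) / card K"

section \<open>Acceptance of Pauli errors by the codes\<close>

lemma finite_\<Lambda> [simp]: "finite \<Lambda>"
  by (simp add: \<Lambda>_def)

lemma card_\<Lambda>: "card \<Lambda> = 4 ^ (m + t)"
  unfolding \<Lambda>_def card_bits power_mult by simp

lemma l0_in: "l0 \<in> \<Lambda>"
  unfolding \<Lambda>_def l0_def by (rule replicate_in_bits)

lemma csign_l0: "csign (m + t) l0 k = 1"
  unfolding l0_def by (rule csign_zero)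

lemma twirl:
  "L \<subseteq> \<Lambda> \<Longrightarrow> (\<Sum>k\<in>\<Lambda>. sandwich A (\<lambda>i a. \<Sum>l\<in>L. csign (m + t) l k * F l i a) X i j)
    = 4 ^ (m + t) * (\<Sum>l\<in>L. sandwich A (F l) X i j)"
  unfolding \<Lambda>_def by (rule pauli_twirl)

lemma card_K_pos: "0 < real (card K)"
  using finK K_ne by (simp add: card_gt_0_iff)

lemma V_unitary: "k \<in> K \<Longrightarrow> unitary_op (bits (m + t)) (V k)"
  using code by (auto simp: pauli_code_def)

lemma W_ops: "W k l \<in> ops M M"
  by (auto simp: W_def ops_def)

lemma W_columns:
  assumes "k \<in> K" "l \<in> \<Lambda>" "a \<in> M" "a' \<in> M"
  shows "(\<Sum>x\<in>M. W k l x a * cnj (W k l x a')) = complex_of_real (pass k l) * of_bool (a = a')"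
proof -
  have "(\<Sum>x\<in>M. W k l x a * cnj (W k l x a'))
    = (\<Sum>x\<in>M. cnj (code_conj (m + t) (V k) l (x @ replicate t False) (a' @ replicate t False))
        * code_conj (m + t) (V k) l (x @ replicate t False) (a @ replicate t False))"
    using assms by (simp add: W_def mult.commute)
  also have "\<dots> = of_bool (passes m t (V k) l) * of_bool (a' = a)"
    by (rule code_conj_restrict[OF code[OF assms(1)] assms(2)[unfolded \<Lambda>_def] assms(4,3)])
  finally show ?thesis by (simp add: pass_def eq_commute[of a a'])
qed

lemma code_conj_l0: "k \<in> K \<Longrightarrow> code_conj (m + t) (V k) l0 = id_op (bits (m + t))"
  unfolding l0_def by (rule code_conj_zero[OF V_unitary])

lemma W_zero: "k \<in> K \<Longrightarrow> W k l0 = id_op M"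
  by (auto simp: W_def code_conj_l0 id_op_def fun_eq_iff)

lemma pass_zero: "k \<in> K \<Longrightarrow> pass k l0 = 1"
proof -
  assume k: "k \<in> K"
  have "\<not> l0 ! q" if "q < m + t" for q
    using that by (simp add: l0_def)
  then have "l0 \<in> undetected m t" using l0_in by (auto simp: undetected_def \<Lambda>_def)
  moreover have "code_conj (m + t) (V k) l0 = scale (cis 0) (pauli (m + t) l0)"
    using code_conj_l0[OF k] pauli_zero[of "m + t", folded l0_def] by (simp add: scale_def)
  ultimately have "passes m t (V k) l0" unfolding passes_def by blast
  then show ?thesis by (simp add: pass_def)
qed

lemma overlap_zero: "k \<in> K \<Longrightarrow> overlap k l0 = 1"
  by (simp add: overlap_def W_zero id_op_def card_bits)

text \<open>By Cauchy-Schwarz the squared trace is at most the dimension times the sum of the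
  squared diagonal entries, each of which is at most the squared norm of its column, the acceptance
  indicator.\<close>

lemma overlap_le_pass:
  assumes "k \<in> K" "l \<in> \<Lambda>"
  shows "(cmod (overlap k l))\<^sup>2 \<le> pass k l"
proof -
  have col: "(\<Sum>x\<in>M. (cmod (W k l x a))\<^sup>2) = pass k l" if "a \<in> M" for a
  proof -
    have "complex_of_real (\<Sum>x\<in>M. (cmod (W k l x a))\<^sup>2) = complex_of_real (pass k l)"
      using W_columns[OF assms that that] by (simp add: complex_norm_square del: of_real_power)
    then show ?thesis by (simp only: of_real_eq_iff)
  qed
  have "cmod (\<Sum>a\<in>M. W k l a a) \<le> (\<Sum>a\<in>M. cmod (W k l a a))" by (rule norm_sum)
  then have "(cmod (\<Sum>a\<in>M. W k l a a))\<^sup>2 \<le> (\<Sum>a\<in>M. cmod (W k l a a))\<^sup>2" by (intro power_mono) auto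
  also have "\<dots> \<le> real (card M) * (\<Sum>a\<in>M. (cmod (W k l a a))\<^sup>2)"
    using sum_squared_le_sum_of_squares[of "\<lambda>a. cmod (W k l a a)" M] by (simp add: mult.commute)
  also have "\<dots> \<le> real (card M) * (\<Sum>a\<in>M. pass k l)"
  proof (intro mult_left_mono sum_mono)
    fix a assume a: "a \<in> M"
    have "(cmod (W k l a a))\<^sup>2 \<le> (\<Sum>x\<in>M. (cmod (W k l x a))\<^sup>2)"
      using a by (intro member_le_sum) auto
    then show "(cmod (W k l a a))\<^sup>2 \<le> pass k l" using col[OF a] by simp
  qed simp
  also have "\<dots> = (2 ^ m)\<^sup>2 * pass k l" by (simp add: card_bits power2_eq_square)
  finally show ?thesis
    by (simp add: overlap_def norm_divide norm_power power_divide divide_le_eq mult.commute)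
qed

lemma sim_prob_nonneg: "0 \<le> sim_prob l"
  by (simp add: sim_prob_def sum_nonneg)

lemma sim_prob_le: "l \<in> \<Lambda> \<Longrightarrow> sim_prob l \<le> pass_prob l"
  unfolding sim_prob_def pass_prob_def by (intro divide_right_mono sum_mono overlap_le_pass) auto

lemma pass_prob_le_1: "pass_prob l \<le> 1"
proof -
  have "(\<Sum>k\<in>K. pass k l) \<le> (\<Sum>k\<in>K. 1)" by (intro sum_mono) (simp add: pass_def)
  then show ?thesis using card_K_pos by (simp add: pass_prob_def divide_le_eq)
qed

lemma sim_prob_zero: "sim_prob l0 = 1"
  using card_K_pos by (simp add: sim_prob_def overlap_zero)

text \<open>The sum over errors stands inside the sandwich: both keys are kept on acceptance, so the
  errors remain in superposition.\<close>

definition acc_real :: "'k \<Rightarrow> bool list \<Rightarrow> (bool list \<times> nat, bool list \<times> nat) superop" where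
  "acc_real k l' X = (\<lambda>i j. \<Sum>e<ne.
     sandwich (M \<times> R) (\<lambda>p q. \<Sum>l\<in>\<Lambda>. csign (m + t) l l' * tensor (W k l) (E e l) p q) X i j)"

definition acc_ideal :: "(bool list \<times> nat, bool list \<times> nat) superop" where
  "acc_ideal X = (\<lambda>i j. \<Sum>e<ne. \<Sum>l\<in>\<Lambda>.
     complex_of_real (sim_prob l) * sandwich (M \<times> R) (tensor (id_op M) (E e l)) X i j)"

text \<open>The second key is already averaged out, which turns the errors into a mixture.\<close>

definition rej_real :: "'k \<Rightarrow> (nat, nat) superop" where
  "rej_real k X = (\<lambda>i j. \<Sum>e<ne. \<Sum>l\<in>\<Lambda>. complex_of_real (1 - pass k l) * sandwich R (E e l) X i j)"

text \<open>The witness for the rejecting simulator. The weights complement those of the accepting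
  one, so that together they preserve the trace.\<close>

definition rej_ideal :: "(nat, nat) superop" where
  "rej_ideal X = (\<lambda>i j. \<Sum>e<ne. \<Sum>l\<in>\<Lambda>. complex_of_real (1 - sim_prob l) * sandwich R (E e l) X i j)"

text \<open>The rejecting block has no factor \<open>1 / 4 ^ (m + t)\<close>, because
  \<open>rej_real\<close> already contains the average over the second key.\<close>

definition diff_channel :: "(bool list \<times> nat, (bool list option \<times> nat) \<times> ('k \<times> bool list + 'k)) superop" where
  "diff_channel X = (\<lambda>i j. \<Sum>k\<in>K. complex_of_real (1 / card K) *
     ((\<Sum>l\<in>\<Lambda>. complex_of_real (1 / 4 ^ (m + t)) *
         acc_flag (k, l) (\<lambda>i j. acc_real k l X i j - acc_ideal X i j) i j)
      + rej_flag k (\<lambda>i j. rej_real k (ptrace1 M X) i j - rej_ideal (ptrace1 M X) i j) i j))"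

definition err_op :: "'k \<Rightarrow> bool list \<Rightarrow> nat \<Rightarrow> (bool list \<times> nat, bool list \<times> nat) opr" where
  "err_op k l' e = (\<lambda>p q. \<Sum>l\<in>\<Lambda> - {l0}. csign (m + t) l l' * tensor (W k l) (E e l) p q)"

text \<open>The first two terms dominate the interference, the third is the accepted error itself,
  and the last dominates the errors that the ideal map accepts. The factor
  \<open>complex_of_real 1\<close> gives the third term the shape of
  \<open>dominated_real_multiple\<close>.\<close>

definition acc_bound :: "real \<Rightarrow> 'k \<Rightarrow> bool list \<Rightarrow> (bool list \<times> nat, bool list \<times> nat) superop" where
  "acc_bound c k l' X = (\<lambda>i j. \<Sum>e<ne.
      complex_of_real c * sandwich (M \<times> R) (tensor (id_op M) (E e l0)) X i j
    + complex_of_real (1 / c) * sandwich (M \<times> R) (err_op k l' e) X i j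
    + complex_of_real 1 * sandwich (M \<times> R) (err_op k l' e) X i j
    + (\<Sum>l\<in>\<Lambda> - {l0}. complex_of_real (sim_prob l) * sandwich (M \<times> R) (tensor (id_op M) (E e l)) X i j))"

definition rej_bound :: "'k \<Rightarrow> (nat, nat) superop" where
  "rej_bound k X = (\<lambda>i j. \<Sum>e<ne. \<Sum>l\<in>\<Lambda>.
     complex_of_real \<bar>sim_prob l - pass k l\<bar> * sandwich R (E e l) X i j)"

definition bound_channel ::
  "real \<Rightarrow> (bool list \<times> nat, (bool list option \<times> nat) \<times> ('k \<times> bool list + 'k)) superop" where
  "bound_channel c X = (\<lambda>i j. \<Sum>k\<in>K. complex_of_real (1 / card K) *
     ((\<Sum>l\<in>\<Lambda>. complex_of_real (1 / 4 ^ (m + t)) * acc_flag (k, l) (acc_bound c k l X) i j)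
      + rej_flag k (rej_bound k (ptrace1 M X)) i j))"

section \<open>Domination of the difference of the channels\<close>

lemma tensor_E_zero: "i \<notin> M \<times> R \<Longrightarrow> X \<in> ops M M \<Longrightarrow> tensor X (E e l) i a = 0"
  using E_ops[of e l] by (cases i; cases a) (auto simp: tensor_def ops_def)

lemma id_op_in_ops: "id_op M \<in> ops M M"
  by (auto simp: id_op_def ops_def)

lemma err_op_zero: "i \<notin> M \<times> R \<Longrightarrow> err_op k l' e i a = 0"
  by (simp add: err_op_def tensor_E_zero[OF _ W_ops])

text \<open>
  The error-free part of a Kraus operator interferes with the undetected errors; the cross terms
  are bounded by completing the square, with a parameter \<open>c\<close> to be optimised.
\<close>

lemma acc_dominated:
  assumes c: "0 < c" and k: "k \<in> K"
  shows "dominated (M \<times> R) (M \<times> R) (\<lambda>X i j. acc_real k l' X i j - acc_ideal X i j) (acc_bound c k l')"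
proof -
  let ?B = "\<lambda>e. tensor (id_op M) (E e l0)" and ?H = "\<lambda>e. err_op k l' e"
  let ?I = "\<lambda>e l. tensor (id_op M) (E e l)"
  have split: "(\<lambda>p q. \<Sum>l\<in>\<Lambda>. csign (m + t) l l' * tensor (W k l) (E e l) p q) = (\<lambda>p q. ?B e p q + ?H e p q)" for e
    by (simp add: sum.remove[OF finite_\<Lambda> l0_in] csign_l0 W_zero[OF k] err_op_def)
  \<comment> \<open>The identity error acts as the identity for every key and has weight one in the
    ideal map, so its square cancels in the difference.\<close>
  have eq: "acc_real k l' X i j - acc_ideal X i j = (\<Sum>e<ne.
      (sandwich2 (M \<times> R) (?B e) (?H e) X i j + sandwich2 (M \<times> R) (?H e) (?B e) X i j)
      + complex_of_real 1 * sandwich (M \<times> R) (?H e) X i j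
      + (\<Sum>l\<in>\<Lambda> - {l0}. complex_of_real (- sim_prob l) * sandwich (M \<times> R) (?I e l) X i j))" for X i j
    unfolding acc_real_def acc_ideal_def split sandwich_add
    by (simp add: sum.remove[OF finite_\<Lambda> l0_in] sim_prob_zero sum_negf sum_subtractf sum.distrib algebra_simps)
  have "dominated (M \<times> R) (M \<times> R) (\<lambda>X i j. \<Sum>e<ne.
      (sandwich2 (M \<times> R) (?B e) (?H e) X i j + sandwich2 (M \<times> R) (?H e) (?B e) X i j)
      + complex_of_real 1 * sandwich (M \<times> R) (?H e) X i j
      + (\<Sum>l\<in>\<Lambda> - {l0}. complex_of_real (- sim_prob l) * sandwich (M \<times> R) (?I e l) X i j))
    (\<lambda>X i j. \<Sum>e<ne.
      complex_of_real c * sandwich (M \<times> R) (?B e) X i j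
      + complex_of_real (1 / c) * sandwich (M \<times> R) (?H e) X i j
      + complex_of_real 1 * sandwich (M \<times> R) (?H e) X i j
      + (\<Sum>l\<in>\<Lambda> - {l0}. complex_of_real (sim_prob l) * sandwich (M \<times> R) (?I e l) X i j))"
    by (intro dominated_sum dominated_add dominated_cross[OF c] dominated_real_multiple cpos_sandwich
        err_op_zero tensor_E_zero id_op_in_ops) (auto simp: sim_prob_nonneg)
  then show ?thesis unfolding eq acc_bound_def .
qed

lemma rej_dominated:
  "dominated R R (\<lambda>X i j. rej_real k X i j - rej_ideal X i j) (rej_bound k)"
proof -
  have eq: "rej_real k X i j - rej_ideal X i j
      = (\<Sum>e<ne. \<Sum>l\<in>\<Lambda>. complex_of_real (sim_prob l - pass k l) * sandwich R (E e l) X i j)" for X i j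
    by (simp add: rej_real_def rej_ideal_def algebra_simps flip: sum_subtractf)
  have E0: "i \<notin> R \<Longrightarrow> E e l i a = 0" for e l i a
    using E_ops[of e l] by (auto simp: ops_def)
  have "dominated R R
      (\<lambda>X i j. \<Sum>e<ne. \<Sum>l\<in>\<Lambda>. complex_of_real (sim_prob l - pass k l) * sandwich R (E e l) X i j)
      (\<lambda>X i j. \<Sum>e<ne. \<Sum>l\<in>\<Lambda>. complex_of_real \<bar>sim_prob l - pass k l\<bar> * sandwich R (E e l) X i j)"
    by (intro dominated_sum dominated_real_multiple cpos_sandwich E0) auto
  then show ?thesis unfolding eq rej_bound_def .
qed

lemma diff_dominated:
  assumes c: "0 < c"
  shows "dominated (M \<times> R) out diff_channel (bound_channel c)"
proof -
  have acc: "dominated (M \<times> R) out (\<lambda>X. acc_flag (k, l) (\<lambda>i j. acc_real k l X i j - acc_ideal X i j))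
      (\<lambda>X. acc_flag (k, l) (acc_bound c k l X))" if "k \<in> K" "l \<in> \<Lambda>" for k l
    using that by (intro dominated_comp_left[OF acc_dominated[OF c]] cpos_acc_flag acc_flag_add acc_flag_diff) auto
  have rej: "dominated (M \<times> R) out
      (\<lambda>X. rej_flag k (\<lambda>i j. rej_real k (ptrace1 M X) i j - rej_ideal (ptrace1 M X) i j))
      (\<lambda>X. rej_flag k (rej_bound k (ptrace1 M X)))" if "k \<in> K" for k
    by (rule dominated_comp_left[OF dominated_comp_right[OF rej_dominated cpos_ptrace1]])
      (use that in \<open>auto intro!: cpos_rej_flag rej_flag_add rej_flag_diff\<close>)
  show ?thesis
    unfolding diff_channel_def bound_channel_def
    by (intro dominated_sum dominated_scale dominated_add acc rej) auto
qed

section \<open>Traces of the dominating maps\<close>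

definition weight :: "(bool list \<times> nat, bool list \<times> nat) opr \<Rightarrow> bool list \<Rightarrow> real" where
  "weight \<rho> l = (\<Sum>e<ne. Re (trace_op R (sandwich R (E e l) (ptrace1 M \<rho>))))"

lemma weight_nonneg:
  assumes "psd (M \<times> R) \<rho>"
  shows "0 \<le> weight \<rho> l"
proof -
  have "psd R (sandwich R (E e l) (ptrace1 M \<rho>))" for e
    using psd_ptrace1[OF _ _ assms] E_ops[of e l] by (intro psd_sandwich) (auto simp: ops_def)
  then show ?thesis unfolding weight_def by (intro sum_nonneg psd_trace_nonneg) auto
qed

lemma trace_sandwich_R: "trace_op R (sandwich R F \<sigma>) = (\<Sum>s<d. \<Sum>s'<d. \<sigma> s s' * (\<Sum>r<d. F r s * cnj (F r s')))"
proof -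
  have "trace_op R (sandwich R F \<sigma>) = (\<Sum>s<d. \<Sum>r<d. \<Sum>s'<d. \<sigma> s s' * (F r s * cnj (F r s')))"
    unfolding trace_op_def sandwich2_def by (subst sum.swap) (simp add: mult_ac)
  also have "\<dots> = (\<Sum>s<d. \<Sum>s'<d. \<Sum>r<d. \<sigma> s s' * (F r s * cnj (F r s')))"
    by (rule sum.cong[OF refl], rule sum.swap)
  finally show ?thesis by (simp add: sum_distrib_left)
qed

lemma trace_preserved: "(\<Sum>e<ne. \<Sum>l\<in>\<Lambda>. trace_op R (sandwich R (E e l) \<sigma>)) = trace_op R \<sigma>"
proof -
  have "(\<Sum>e<ne. \<Sum>l\<in>\<Lambda>. trace_op R (sandwich R (E e l) \<sigma>))
      = (\<Sum>s<d. \<Sum>s'<d. \<Sum>e<ne. \<Sum>l\<in>\<Lambda>. \<sigma> s s' * (\<Sum>r<d. E e l r s * cnj (E e l r s')))"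
    unfolding trace_sandwich_R by (rule sum_swap_pairs)
  also have "\<dots> = (\<Sum>s<d. \<Sum>s'<d. if s' = s then \<sigma> s s' else 0)"
    by (intro sum.cong refl) (auto simp: E_columns[folded \<Lambda>_def] simp flip: sum_distrib_left)
  also have "\<dots> = trace_op R \<sigma>" by (simp add: trace_op_def)
  finally show ?thesis .
qed

text \<open>Trace preservation of the attack makes the weights of a density operator a probability
  distribution over Pauli errors, so the final bound need only control the coefficient of each
  error.\<close>

lemma sum_weight: "(\<Sum>l\<in>\<Lambda>. weight \<rho> l) = Re (trace_op (M \<times> R) \<rho>)"
proof -
  have "(\<Sum>l\<in>\<Lambda>. weight \<rho> l) = (\<Sum>e<ne. \<Sum>l\<in>\<Lambda>. Re (trace_op R (sandwich R (E e l) (ptrace1 M \<rho>))))"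
    unfolding weight_def by (rule sum.swap)
  also have "\<dots> = Re (trace_op R (ptrace1 M \<rho>))"
    using trace_preserved[of "ptrace1 M \<rho>"] by (metis (no_types, lifting) Re_sum sum.cong)
  finally show ?thesis by (simp add: trace_ptrace1)
qed

lemma trace_id_sandwich:
  "trace_op (M \<times> R) (sandwich (M \<times> R) (tensor (id_op M) (E e l)) \<rho>) = trace_op R (sandwich R (E e l) (ptrace1 M \<rho>))"
  using trace_sandwich_tensor[of M "id_op M" 1 R "E e l" \<rho>, OF finite_bits id_op_columns[OF finite_bits]] by simp

text \<open>Within one key block the errors interfere, but traces add over the blocks, so summing
  over the second key twirls them after all. What remains of each \<open>W\<close> is its acceptance
  indicator.\<close>

lemma trace_err_sandwich:
  assumes "k \<in> K"
  shows "(\<Sum>l'\<in>\<Lambda>. trace_op (M \<times> R) (sandwich (M \<times> R) (err_op k l' e) \<rho>))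
    = 4 ^ (m + t) * (\<Sum>l\<in>\<Lambda> - {l0}. complex_of_real (pass k l) * trace_op R (sandwich R (E e l) (ptrace1 M \<rho>)))"
proof -
  have "(\<Sum>l'\<in>\<Lambda>. trace_op (M \<times> R) (sandwich (M \<times> R) (err_op k l' e) \<rho>))
      = trace_op (M \<times> R) (\<lambda>i j. \<Sum>l'\<in>\<Lambda>. sandwich (M \<times> R) (err_op k l' e) \<rho> i j)"
    by (simp only: trace_op_sum)
  also have "\<dots> = trace_op (M \<times> R) (\<lambda>i j. 4 ^ (m + t) * (\<Sum>l\<in>\<Lambda> - {l0}. sandwich (M \<times> R) (tensor (W k l) (E e l)) \<rho> i j))"
    unfolding err_op_def by (subst twirl) auto
  also have "\<dots> = 4 ^ (m + t) * (\<Sum>l\<in>\<Lambda> - {l0}. trace_op (M \<times> R) (sandwich (M \<times> R) (tensor (W k l) (E e l)) \<rho>))"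
    by (simp only: trace_op_mult trace_op_sum)
  also have "\<dots> = 4 ^ (m + t) * (\<Sum>l\<in>\<Lambda> - {l0}. complex_of_real (pass k l) * trace_op R (sandwich R (E e l) (ptrace1 M \<rho>)))"
    using assms by (intro arg_cong2[where f = times] refl sum.cong trace_sandwich_tensor W_columns) auto
  finally show ?thesis .
qed

text \<open>The coefficient \<open>1 / c + 1\<close> joins the two occurrences of
  \<open>err_op\<close>; the factor \<open>4 ^ (m + t)\<close> cancels against the average over the
  second key.\<close>

lemma trace_acc_bound:
  assumes k: "k \<in> K"
  shows "(\<Sum>l\<in>\<Lambda>. Re (trace_op (M \<times> R) (acc_bound c k l \<rho>)))
    = 4 ^ (m + t) * (c * weight \<rho> l0 + (\<Sum>l\<in>\<Lambda> - {l0}. ((1 / c + 1) * pass k l + sim_prob l) * weight \<rho> l))"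
proof -
  let ?T = "\<lambda>e l. trace_op R (sandwich R (E e l) (ptrace1 M \<rho>))"
  let ?h = "\<lambda>l' e. trace_op (M \<times> R) (sandwich (M \<times> R) (err_op k l' e) \<rho>)"
  let ?N = "4 ^ (m + t) :: real"
  have tr: "trace_op (M \<times> R) (acc_bound c k l' \<rho>) = (\<Sum>e<ne. complex_of_real c * ?T e l0
      + complex_of_real (1 / c + 1) * ?h l' e
      + (\<Sum>l\<in>\<Lambda> - {l0}. complex_of_real (sim_prob l) * ?T e l))" for l'
    unfolding acc_bound_def
    by (simp only: trace_op_sum trace_op_add trace_op_mult trace_id_sandwich) (simp add: algebra_simps)
  have card: "complex_of_nat (card \<Lambda>) = complex_of_real ?N"
    by (simp add: card_\<Lambda>)
  have "(\<Sum>l'\<in>\<Lambda>. trace_op (M \<times> R) (acc_bound c k l' \<rho>))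
      = (\<Sum>e<ne. \<Sum>l'\<in>\<Lambda>. complex_of_real c * ?T e l0 + complex_of_real (1 / c + 1) * ?h l' e
      + (\<Sum>l\<in>\<Lambda> - {l0}. complex_of_real (sim_prob l) * ?T e l))"
    unfolding tr by (rule sum.swap)
  also have "\<dots> = (\<Sum>e<ne. complex_of_real ?N * (complex_of_real c * ?T e l0)
      + complex_of_real (1 / c + 1) * (\<Sum>l'\<in>\<Lambda>. ?h l' e)
      + complex_of_real ?N * (\<Sum>l\<in>\<Lambda> - {l0}. complex_of_real (sim_prob l) * ?T e l))"
    by (simp only: sum.distrib sum_constant card sum_distrib_left[symmetric])
  also have "\<dots> = complex_of_real ?N * (\<Sum>e<ne. complex_of_real c * ?T e l0
      + (\<Sum>l\<in>\<Lambda> - {l0}. complex_of_real ((1 / c + 1) * pass k l + sim_prob l) * ?T e l))"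
    unfolding trace_err_sandwich[OF k]
    by (simp add: sum_distrib_left sum.distrib algebra_simps)
  finally have "Re (\<Sum>l'\<in>\<Lambda>. trace_op (M \<times> R) (acc_bound c k l' \<rho>))
      = ?N * (\<Sum>e<ne. c * Re (?T e l0) + (\<Sum>l\<in>\<Lambda> - {l0}. ((1 / c + 1) * pass k l + sim_prob l) * Re (?T e l)))"
    by simp
  also have "\<dots> = ?N * (c * weight \<rho> l0 + (\<Sum>e<ne. \<Sum>l\<in>\<Lambda> - {l0}. ((1 / c + 1) * pass k l + sim_prob l) * Re (?T e l)))"
    by (simp add: sum.distrib weight_def sum_distrib_left)
  also have "(\<Sum>e<ne. \<Sum>l\<in>\<Lambda> - {l0}. ((1 / c + 1) * pass k l + sim_prob l) * Re (?T e l))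
      = (\<Sum>l\<in>\<Lambda> - {l0}. \<Sum>e<ne. ((1 / c + 1) * pass k l + sim_prob l) * Re (?T e l))" by (rule sum.swap)
  finally show ?thesis by (simp add: weight_def sum_distrib_left)
qed

text \<open>The identity error drops out because both weights are one. The difference of the other
  weights is bounded by their sum, whose average over the codes is at most twice the purity
  error.\<close>

lemma trace_rej_bound:
  assumes k: "k \<in> K" and \<rho>: "psd (M \<times> R) \<rho>"
  shows "Re (trace_op R (rej_bound k (ptrace1 M \<rho>))) \<le> (\<Sum>l\<in>\<Lambda> - {l0}. (sim_prob l + pass k l) * weight \<rho> l)"
proof -
  let ?T = "\<lambda>e l. trace_op R (sandwich R (E e l) (ptrace1 M \<rho>))"
  have "Re (trace_op R (rej_bound k (ptrace1 M \<rho>))) = (\<Sum>e<ne. \<Sum>l\<in>\<Lambda>. \<bar>sim_prob l - pass k l\<bar> * Re (?T e l))"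
    unfolding rej_bound_def by (simp only: trace_op_sum trace_op_mult) simp
  also have "\<dots> = (\<Sum>l\<in>\<Lambda>. \<Sum>e<ne. \<bar>sim_prob l - pass k l\<bar> * Re (?T e l))" by (rule sum.swap)
  also have "\<dots> = (\<Sum>l\<in>\<Lambda>. \<bar>sim_prob l - pass k l\<bar> * weight \<rho> l)" by (simp add: weight_def sum_distrib_left)
  also have "\<dots> = (\<Sum>l\<in>\<Lambda> - {l0}. \<bar>sim_prob l - pass k l\<bar> * weight \<rho> l)"
    by (simp add: sum.remove[OF finite_\<Lambda> l0_in] sim_prob_zero pass_zero[OF k])
  also have "\<dots> \<le> (\<Sum>l\<in>\<Lambda> - {l0}. (sim_prob l + pass k l) * weight \<rho> l)"
  proof (intro sum_mono mult_right_mono weight_nonneg[OF \<rho>])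
    fix l
    show "\<bar>sim_prob l - pass k l\<bar> \<le> sim_prob l + pass k l"
      using sim_prob_nonneg[of l] by (cases "passes m t (V k) l") (simp_all add: pass_def)
  qed
  finally show ?thesis .
qed

text \<open>The purity error enters as \<open>c * c\<close>, so that \<open>1 / c\<close> times it
  is again \<open>c\<close> without any square root.\<close>

lemma trace_bound_channel:
  assumes c: "0 < c" and pass: "\<And>l. l \<in> \<Lambda> \<Longrightarrow> l \<noteq> l0 \<Longrightarrow> pass_prob l \<le> c * c" and \<rho>: "psd (M \<times> R) \<rho>"
  shows "Re (trace_op out (bound_channel c \<rho>)) \<le> (c + 4 * (c * c)) * Re (trace_op (M \<times> R) \<rho>)"
proof -
  let ?w = "weight \<rho>"
  let ?N = "4 ^ (m + t) :: real" and ?L = "\<Lambda> - {l0}"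
  have "trace_op out (bound_channel c \<rho>) = (\<Sum>k\<in>K. complex_of_real (1 / card K) *
      ((\<Sum>l\<in>\<Lambda>. complex_of_real (1 / ?N) * trace_op out (acc_flag (k, l) (acc_bound c k l \<rho>)))
      + trace_op out (rej_flag k (rej_bound k (ptrace1 M \<rho>)))))"
    unfolding bound_channel_def by (simp only: trace_op_sum trace_op_mult trace_op_add)
  also have "\<dots> = (\<Sum>k\<in>K. complex_of_real (1 / card K) *
      ((\<Sum>l\<in>\<Lambda>. complex_of_real (1 / ?N) * trace_op (M \<times> R) (acc_bound c k l \<rho>))
      + trace_op R (rej_bound k (ptrace1 M \<rho>))))"
    using finK by (intro sum.cong refl arg_cong2[where f = times] arg_cong2[where f = plus]
        trace_acc_flag trace_rej_flag) auto
  finally have "Re (trace_op out (bound_channel c \<rho>)) = (\<Sum>k\<in>K. 1 / card K *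
      ((\<Sum>l\<in>\<Lambda>. 1 / ?N * Re (trace_op (M \<times> R) (acc_bound c k l \<rho>)))
      + Re (trace_op R (rej_bound k (ptrace1 M \<rho>)))))"
    by (simp only: Re_sum Re_complex_of_real times_complex.sel Im_complex_of_real mult_zero_left diff_0_right plus_complex.sel)
  also have "\<dots> = (\<Sum>k\<in>K. 1 / card K *
      (1 / ?N * (\<Sum>l\<in>\<Lambda>. Re (trace_op (M \<times> R) (acc_bound c k l \<rho>)))
      + Re (trace_op R (rej_bound k (ptrace1 M \<rho>)))))"
    by (simp only: sum_distrib_left)
  also have "\<dots> \<le> (\<Sum>k\<in>K. 1 / card K * (c * ?w l0 + (\<Sum>l\<in>?L. ((1 / c + 1) * pass k l + sim_prob l) * ?w l)
      + (\<Sum>l\<in>?L. (sim_prob l + pass k l) * ?w l)))"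
  proof (intro sum_mono mult_left_mono)
    fix k assume k: "k \<in> K"
    show "1 / ?N * (\<Sum>l\<in>\<Lambda>. Re (trace_op (M \<times> R) (acc_bound c k l \<rho>))) + Re (trace_op R (rej_bound k (ptrace1 M \<rho>)))
      \<le> c * ?w l0 + (\<Sum>l\<in>?L. ((1 / c + 1) * pass k l + sim_prob l) * ?w l) + (\<Sum>l\<in>?L. (sim_prob l + pass k l) * ?w l)"
      unfolding trace_acc_bound[OF k] using trace_rej_bound[OF k \<rho>] by simp
  qed simp
  also have "\<dots> = (\<Sum>k\<in>K. 1 / card K * (c * ?w l0)
      + (\<Sum>l\<in>?L. 1 / card K * (((1 / c + 2) * pass k l + 2 * sim_prob l) * ?w l)))"
    by (simp add: sum_distrib_left sum.distrib[symmetric] algebra_simps)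
  also have "\<dots> = (\<Sum>k\<in>K. 1 / card K * (c * ?w l0))
      + (\<Sum>l\<in>?L. \<Sum>k\<in>K. 1 / card K * (((1 / c + 2) * pass k l + 2 * sim_prob l) * ?w l))"
    unfolding sum.distrib by (subst sum.swap) simp
  also have "(\<Sum>k\<in>K. 1 / card K * (c * ?w l0)) = c * ?w l0"
    using card_K_pos by simp
  also have "(\<Sum>l\<in>?L. \<Sum>k\<in>K. 1 / card K * (((1 / c + 2) * pass k l + 2 * sim_prob l) * ?w l))
      = (\<Sum>l\<in>?L. ((1 / c + 2) * pass_prob l + 2 * sim_prob l) * ?w l)"
  proof (intro sum.cong refl)
    fix l
    have "(\<Sum>k\<in>K. 1 / card K * (((1 / c + 2) * pass k l + 2 * sim_prob l) * ?w l))
        = 1 / card K * ((1 / c + 2) * (\<Sum>k\<in>K. pass k l) + card K * (2 * sim_prob l)) * ?w l"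
      by (simp add: sum_distrib_left sum_distrib_right sum.distrib algebra_simps)
    also have "\<dots> = ((1 / c + 2) * pass_prob l + 2 * sim_prob l) * ?w l"
      using card_K_pos by (simp add: pass_prob_def field_simps)
    finally show "(\<Sum>k\<in>K. 1 / card K * (((1 / c + 2) * pass k l + 2 * sim_prob l) * ?w l))
        = ((1 / c + 2) * pass_prob l + 2 * sim_prob l) * ?w l" .
  qed
  \<comment> \<open>The coefficient of the identity error is enlarged to the common one so that all
    weights can be added up.\<close>
  also have "c * ?w l0 + (\<Sum>l\<in>?L. ((1 / c + 2) * pass_prob l + 2 * sim_prob l) * ?w l)
      \<le> (c + 4 * (c * c)) * ?w l0 + (\<Sum>l\<in>?L. (c + 4 * (c * c)) * ?w l)"
  proof (rule add_mono)
    show "c * ?w l0 \<le> (c + 4 * (c * c)) * ?w l0"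
      by (intro mult_right_mono weight_nonneg[OF \<rho>]) simp
    have coeff: "(1 / c + 2) * pass_prob l + 2 * sim_prob l \<le> c + 4 * (c * c)" if l: "l \<in> ?L" for l
    proof -
    have "(1 / c + 2) * pass_prob l + 2 * sim_prob l \<le> (1 / c + 2) * (c * c) + 2 * (c * c)"
      using c l pass[of l] sim_prob_le[of l] by (intro add_mono mult_left_mono) auto
    also have "\<dots> = c + 4 * (c * c)"
      using c by (simp add: algebra_simps)
    finally show ?thesis .
    qed
    show "(\<Sum>l\<in>?L. ((1 / c + 2) * pass_prob l + 2 * sim_prob l) * ?w l) \<le> (\<Sum>l\<in>?L. (c + 4 * (c * c)) * ?w l)"
      by (rule sum_mono, rule mult_right_mono[OF coeff weight_nonneg[OF \<rho>]])
  qed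
  also have "\<dots> = (c + 4 * (c * c)) * (\<Sum>l\<in>\<Lambda>. ?w l)"
    by (simp add: sum.remove[OF finite_\<Lambda> l0_in] sum_distrib_left distrib_left)
  finally show ?thesis unfolding sum_weight .
qed

theorem diamond_diff_le:
  assumes "0 < d" "0 < \<delta>" "\<And>l. l \<in> \<Lambda> \<Longrightarrow> l \<noteq> l0 \<Longrightarrow> pass_prob l \<le> \<delta>"
  shows "diamond_norm (M \<times> R) out diff_channel \<le> sqrt \<delta> + 4 * \<delta>"
proof (rule diamond_norm_le)
  have c: "0 < sqrt \<delta>" "sqrt \<delta> * sqrt \<delta> = \<delta>" using assms(2) by auto
  show "dominated (M \<times> R) out diff_channel (bound_channel (sqrt \<delta>))"
    by (rule diff_dominated[OF c(1)])
  show "Re (trace_op out (bound_channel (sqrt \<delta>) \<rho>)) \<le> (sqrt \<delta> + 4 * \<delta>) * Re (trace_op (M \<times> R) \<rho>)"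
    if "psd (M \<times> R) \<rho>" for \<rho>
    using trace_bound_channel[OF c(1) _ that] assms(3) unfolding c(2) by blast
  have "M \<noteq> {}" using replicate_in_bits by blast
  then show "M \<times> R \<noteq> {}" using assms(1) by auto
qed (use finK in auto)

end

subsection \<open>The accepting projector\<close>

text \<open>With a common range each projector fixes the columns of the other, so
  \<open>P Q = Q\<close> and \<open>Q P = P\<close>; taking the adjoint of the second equation gives
  \<open>P = P Q\<close>.\<close>

lemma projector_unique:
  assumes fin: "finite A" and P: "P \<in> ops A A" "dagger P = P" "mul A P P = P"
    and Q: "Q \<in> ops A A" "dagger Q = Q" "mul A Q Q = Q"
    and range: "app_ket A P ` kets A = app_ket A Q ` kets A"
  shows "P = Q"
proof -
  have absorb: "mul A P Q = Q"
    if "mul A P P = P" "P \<in> ops A A" "Q \<in> ops A A" "app_ket A P ` kets A = app_ket A Q ` kets A" for P Q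
  proof (intro ext)
    fix i a
    show "mul A P Q i a = Q i a"
    proof (cases "a \<in> A")
      case False
      then show ?thesis using that by (auto simp: mul_def ops_def)
    next
      case True
      have "basis_ket a \<in> kets A" using True by (auto simp: basis_ket_def kets_def)
      then have "app_ket A Q (basis_ket a) \<in> app_ket A P ` kets A" using that(4) by blast
      then obtain u where u: "app_ket A Q (basis_ket a) = app_ket A P u" by blast
      have "app_ket A (mul A P Q) (basis_ket a) = app_ket A Q (basis_ket a)"
        unfolding app_ket_mul u by (simp add: that(1) flip: app_ket_mul)
      then show ?thesis unfolding inner_ket_basis(2)[OF fin True] by (rule fun_cong)
    qed
  qed
  have "P = dagger (mul A Q P)"
    using absorb[OF Q(3,1) P(1) range[symmetric]] P(2) by simp
  also have "\<dots> = mul A P Q" unfolding dagger_mul P(2) Q(2) ..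
  also have "\<dots> = Q" by (rule absorb[OF P(3,1) Q(1) range])
  finally show ?thesis .
qed

lemma ketbra_basis: "ketbra (basis_ket z) = (\<lambda>i j. of_bool (i = z \<and> j = z))"
  by (auto simp: ketbra_def basis_ket_def fun_eq_iff)

lemma sum_pick:
  fixes f :: "'a \<Rightarrow> complex"
  assumes "finite A" "z \<in> A"
  shows "(\<Sum>a\<in>A. of_bool (a = z) * f a) = f z"
proof -
  have "(\<Sum>a\<in>A. of_bool (a = z) * f a) = (\<Sum>a\<in>A. if a = z then f a else 0)"
    by (intro sum.cong) auto
  then show ?thesis using assms by simp
qed

text \<open>Every basis ket other than the one at \<open>z\<close> lies in the kernel, so a vector
  orthogonal to the kernel is a multiple of that one. Uniqueness of the projector then settles the
  definite description.\<close>

lemma support_proj_basis: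
  assumes fin: "finite T" and z: "z \<in> T"
  shows "support_proj T (ketbra (basis_ket z)) = ketbra (basis_ket z)"
proof -
  let ?P = "ketbra (basis_ket z)"
  have app: "app_ket T ?P v = (\<lambda>i. of_bool (i = z) * v z)" for v
  proof
    fix i
    have "app_ket T ?P v i = (\<Sum>j\<in>T. of_bool (j = z) * (of_bool (i = z) * v j))"
      unfolding app_ket_def ketbra_basis by (intro sum.cong) auto
    then show "app_ket T ?P v i = of_bool (i = z) * v z" by (simp only: sum_pick[OF fin z])
  qed
  have ops: "?P \<in> ops T T" using z by (auto simp: ketbra_basis ops_def)
  have dag: "dagger ?P = ?P" by (auto simp: ketbra_basis dagger_def fun_eq_iff)
  have idem: "mul T ?P ?P = ?P"
  proof (intro ext)
    fix i k
    have "mul T ?P ?P i k = (\<Sum>j\<in>T. of_bool (j = z) * ?P i k)"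
      unfolding mul_def ketbra_basis by (intro sum.cong) auto
    then show "mul T ?P ?P i k = ?P i k" by (simp only: sum_pick[OF fin z])
  qed
  have range: "app_ket T ?P ` kets T = support_op T ?P"
  proof
    show "app_ket T ?P ` kets T \<subseteq> support_op T ?P"
    proof
      fix u assume "u \<in> app_ket T ?P ` kets T"
      then obtain v where v: "u = (\<lambda>i. of_bool (i = z) * v z)" by (auto simp: app)
      have "inner_ket T w u = 0" if "app_ket T ?P w = (\<lambda>_. 0)" for w
      proof -
        have "w z = 0" using fun_cong[OF that, of z] by (simp add: app)
        then show ?thesis unfolding inner_ket_def v by (intro sum.neutral) auto
      qed
      then show "u \<in> support_op T ?P" using z v by (auto simp: support_op_def kets_def)
    qed
    show "support_op T ?P \<subseteq> app_ket T ?P ` kets T"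
    proof
      fix u assume u: "u \<in> support_op T ?P"
      have "u i = 0" if "i \<noteq> z" for i
      proof (cases "i \<in> T")
        case True
        have "app_ket T ?P (basis_ket i) = (\<lambda>_. 0)"
          unfolding app using that by (auto simp: basis_ket_def)
        moreover have "basis_ket i \<in> kets T"
          using True by (auto simp: kets_def basis_ket_def)
        ultimately show ?thesis using u inner_ket_basis(1)[OF fin True, of u] by (auto simp: support_op_def)
      qed (use u in \<open>auto simp: support_op_def kets_def\<close>)
      then have "u = app_ket T ?P u" by (auto simp: app fun_eq_iff)
      then show "u \<in> app_ket T ?P ` kets T" using u by (auto simp: support_op_def)
    qed
  qed
  show ?thesis
    unfolding support_proj_def
  proof (rule the_equality)
    show "?P \<in> ops T T \<and> dagger ?P = ?P \<and> mul T ?P ?P = ?P \<and> app_ket T ?P ` kets T = support_op T ?P"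
      using ops dag idem range by blast
    fix Q assume "Q \<in> ops T T \<and> dagger Q = Q \<and> mul T Q Q = Q \<and> app_ket T Q ` kets T = support_op T ?P"
    then have Q: "Q \<in> ops T T" "dagger Q = Q" "mul T Q Q = Q" "app_ket T Q ` kets T = support_op T ?P"
      by blast+
    show "Q = ?P"
      by (rule projector_unique[OF fin Q(1-3) ops dag idem]) (simp only: Q(4) range)
  qed
qed

subsection \<open>Composition of maps\<close>

lemma conj_op_eq_sandwich: "conj_op A F X = sandwich A F X"
proof (intro ext)
  fix i j
  have "conj_op A F X i j = (\<Sum>b\<in>A. \<Sum>a\<in>A. F i a * X a b * cnj (F j b))"
    by (simp add: conj_op_def mul_def dagger_def sum_distrib_right)
  then show "conj_op A F X i j = sandwich A F X i j"
    unfolding sandwich2_def by (subst sum.swap)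
qed

lemma sandwich_sandwich: "sandwich B G (sandwich A F X) = sandwich A (mul B G F) X"
proof (intro ext)
  fix i j
  have "sandwich B G (sandwich A F X) i j
      = (\<Sum>p\<in>B. \<Sum>q\<in>B. \<Sum>a\<in>A. \<Sum>b\<in>A. (G i p * F p a) * X a b * cnj (G j q * F q b))"
    by (simp add: sandwich2_def sum_distrib_left sum_distrib_right mult_ac)
  also have "\<dots> = (\<Sum>a\<in>A. \<Sum>b\<in>A. \<Sum>p\<in>B. \<Sum>q\<in>B. (G i p * F p a) * X a b * cnj (G j q * F q b))"
    by (rule sum_swap_pairs)
  also have "\<dots> = (\<Sum>a\<in>A. \<Sum>b\<in>A. X a b * (mul B G F i a * cnj (mul B G F j b)))"
    unfolding mul_def cnj_sum sum_product by (simp add: sum_distrib_left mult_ac)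
  also have "\<dots> = sandwich A (mul B G F) X i j"
    by (simp add: sandwich2_def mult_ac)
  finally show "sandwich B G (sandwich A F X) i j = sandwich A (mul B G F) X i j" .
qed

lemma sandwich_sum_arg:
  "sandwich A F (\<lambda>i j. \<Sum>s\<in>S. X s i j) = (\<lambda>i j. \<Sum>s\<in>S. sandwich A F (X s) i j)"
proof (intro ext)
  fix i j
  have "sandwich A F (\<lambda>i j. \<Sum>s\<in>S. X s i j) i j = (\<Sum>a\<in>A. \<Sum>b\<in>A. \<Sum>s\<in>S. F i a * X s a b * cnj (F j b))"
    by (simp add: sandwich2_def sum_distrib_left sum_distrib_right)
  also have "\<dots> = (\<Sum>a\<in>A. \<Sum>s\<in>S. \<Sum>b\<in>A. F i a * X s a b * cnj (F j b))"
    by (rule sum.cong[OF refl], rule sum.swap)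
  also have "\<dots> = (\<Sum>s\<in>S. \<Sum>a\<in>A. \<Sum>b\<in>A. F i a * X s a b * cnj (F j b))" by (rule sum.swap)
  finally show "sandwich A F (\<lambda>i j. \<Sum>s\<in>S. X s i j) i j = (\<Sum>s\<in>S. sandwich A F (X s) i j)"
    by (simp add: sandwich2_def)
qed

lemma sandwich_ops: "F \<in> ops B A \<Longrightarrow> sandwich A F X \<in> ops B B"
  by (auto simp: sandwich2_def ops_def)

lemma mul_tensor: "mul (A \<times> B) (tensor X Y) (tensor X' Y') = tensor (mul A X X') (mul B Y Y')"
  by (auto simp: mul_def tensor_def fun_eq_iff sum.cartesian_product' sum_product mult_ac)

lemma dagger_tensor: "dagger (tensor X Y) = tensor (dagger X) (dagger Y)"
  by (auto simp: dagger_def tensor_def fun_eq_iff)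

lemma tensor_ops: "X \<in> ops A A' \<Longrightarrow> Y \<in> ops B B' \<Longrightarrow> tensor X Y \<in> ops (A \<times> B) (A' \<times> B')"
  by (auto simp: tensor_def ops_def)

lemma tensor_scale: "tensor (scale c X) Y = (\<lambda>p q. c * tensor X Y p q)"
  by (auto simp: tensor_def scale_def fun_eq_iff)

lemma mul_sum_left: "mul A (\<lambda>i j. \<Sum>l\<in>L. F l i j) Y = (\<lambda>i j. \<Sum>l\<in>L. mul A (F l) Y i j)"
  by (auto simp: mul_def fun_eq_iff sum_distrib_right intro: sum.swap)

lemma mul_sum_right: "mul A X (\<lambda>i j. \<Sum>l\<in>L. F l i j) = (\<lambda>i j. \<Sum>l\<in>L. mul A X (F l) i j)"
  by (auto simp: mul_def fun_eq_iff sum_distrib_left intro: sum.swap)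

lemma diamond_norm_cong:
  assumes "\<And>X. X \<in> ops A A \<Longrightarrow> \<Psi> X = \<Phi> X"
  shows "diamond_norm A B \<Psi> = diamond_norm A B \<Phi>"
proof -
  have eq: "ampl \<Psi> \<rho> = ampl \<Phi> \<rho>" if "density ({..<d} \<times> A) \<rho>" for d :: nat and \<rho>
  proof -
    have "\<rho> \<in> ops ({..<d} \<times> A) ({..<d} \<times> A)" using that by (simp add: density_def psd_opsD)
    then show ?thesis using assms ops_block[of \<rho> "{..<d}" A] by (auto simp: ampl_def)
  qed
  show ?thesis
    unfolding diamond_norm_def
    by (intro arg_cong[where f = Sup] Collect_cong ex_cong1) (auto simp: eq)
qed

text \<open>Trace preservation is evaluated at the matrix unit in row \<open>p\<close> and column
  \<open>q\<close>.\<close>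

lemma kraus_trace_preserving:
  assumes fin: "finite A" and tp: "trace_preserving A B \<Psi>"
    and kraus: "\<And>X. X \<in> ops A A \<Longrightarrow> \<Psi> X = (\<lambda>i j. \<Sum>s<(n::nat). sandwich A (F s) X i j)"
    and pq: "p \<in> A" "q \<in> A"
  shows "(\<Sum>s<n. \<Sum>i\<in>B. F s i p * cnj (F s i q)) = of_bool (p = q)"
proof -
  let ?X = "\<lambda>i j. of_bool (i = p) * of_bool (j = q) :: complex"
  have X: "?X \<in> ops A A" using pq by (auto simp: ops_def)
  have s: "sandwich A (F s) ?X i j = F s i p * cnj (F s j q)" for s i j
  proof -
    have "sandwich A (F s) ?X i j = (\<Sum>a\<in>A. of_bool (a = p) * (\<Sum>b\<in>A. of_bool (b = q) * (F s i a * cnj (F s j b))))"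
      by (simp add: sandwich2_def sum_distrib_left mult_ac)
    then show ?thesis by (simp only: sum_pick[OF fin pq(1)] sum_pick[OF fin pq(2)])
  qed
  have "trace_op B (\<Psi> ?X) = (\<Sum>i\<in>B. \<Sum>s<n. F s i p * cnj (F s i q))"
    unfolding kraus[OF X] by (simp add: trace_op_def s)
  also have "\<dots> = (\<Sum>s<n. \<Sum>i\<in>B. F s i p * cnj (F s i q))" by (rule sum.swap)
  finally have "(\<Sum>s<n. \<Sum>i\<in>B. F s i p * cnj (F s i q)) = trace_op A ?X"
    using tp X by (simp add: trace_preserving_def)
  also have "\<dots> = of_bool (p = q)"
    using sum_pick[OF fin pq(1), of "\<lambda>a. of_bool (a = q)"] by (simp add: trace_op_def)
  finally show ?thesis .
qed

subsection \<open>Expansion in the Pauli basis\<close>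

text \<open>The hypothesis says that the vectors \<open>f l\<close> form a tight frame, so analysis
  followed by synthesis multiplies by the frame constant.\<close>

lemma frame_inversion:
  fixes f :: "'l \<Rightarrow> 'w \<Rightarrow> complex"
  assumes fin: "finite A" and w: "w \<in> A"
    and frame: "\<And>w w'. w \<in> A \<Longrightarrow> w' \<in> A \<Longrightarrow> (\<Sum>l\<in>L. f l w * cnj (f l w')) = N * of_bool (w = w')"
  shows "(\<Sum>l\<in>L. f l w * (\<Sum>w'\<in>A. cnj (f l w') * g w')) = N * g w"
proof -
  have "(\<Sum>l\<in>L. f l w * (\<Sum>w'\<in>A. cnj (f l w') * g w')) = (\<Sum>l\<in>L. \<Sum>w'\<in>A. (f l w * cnj (f l w')) * g w')"
    by (simp add: sum_distrib_left mult.assoc)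
  also have "\<dots> = (\<Sum>w'\<in>A. \<Sum>l\<in>L. (f l w * cnj (f l w')) * g w')" by (rule sum.swap)
  also have "\<dots> = (\<Sum>w'\<in>A. of_bool (w' = w) * (N * g w'))"
    by (intro sum.cong refl) (auto simp: frame w simp flip: sum_distrib_right)
  finally show ?thesis by (simp only: sum_pick[OF fin w])
qed

lemma frame_parseval:
  fixes f :: "'l \<Rightarrow> 'w \<Rightarrow> complex"
  assumes fin: "finite A"
    and frame: "\<And>w w'. w \<in> A \<Longrightarrow> w' \<in> A \<Longrightarrow> (\<Sum>l\<in>L. f l w * cnj (f l w')) = N * of_bool (w = w')"
  shows "(\<Sum>l\<in>L. (\<Sum>w\<in>A. cnj (f l w) * g w) * cnj (\<Sum>w\<in>A. cnj (f l w) * h w)) = N * (\<Sum>w\<in>A. g w * cnj (h w))"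
proof -
  have "(\<Sum>l\<in>L. (\<Sum>w\<in>A. cnj (f l w) * g w) * cnj (\<Sum>w\<in>A. cnj (f l w) * h w))
      = (\<Sum>l\<in>L. \<Sum>w\<in>A. cnj (h w) * (f l w * (\<Sum>w'\<in>A. cnj (f l w') * g w')))"
    by (simp add: sum_distrib_left sum_distrib_right mult_ac)
  also have "\<dots> = (\<Sum>w\<in>A. \<Sum>l\<in>L. cnj (h w) * (f l w * (\<Sum>w'\<in>A. cnj (f l w') * g w')))" by (rule sum.swap)
  also have "\<dots> = (\<Sum>w\<in>A. cnj (h w) * (N * g w))"
    by (intro sum.cong refl) (simp add: frame_inversion[OF fin _ frame] flip: sum_distrib_left)
  finally show ?thesis by (simp add: sum_distrib_left mult_ac)
qed

text \<open>Operators are viewed as vectors indexed by pairs of a row and a column; in this sense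
  the Paulis form a tight frame.\<close>

lemma split_pauli_frame:
  assumes "w \<in> (bits m \<times> bits t) \<times> (bits m \<times> bits t)" "w' \<in> (bits m \<times> bits t) \<times> (bits m \<times> bits t)"
  shows "(\<Sum>l\<in>bits (2 * (m + t)). split_reg m t (pauli (m + t) l) (fst w) (snd w)
      * cnj (split_reg m t (pauli (m + t) l) (fst w') (snd w'))) = 2 ^ (m + t) * of_bool (w = w')"
proof -
  obtain a b c e where w: "w = ((a, b), (c, e))" by (metis surj_pair)
  obtain a' b' c' e' where w': "w' = ((a', b'), (c', e'))" by (metis surj_pair)
  have in_bits: "a @ b \<in> bits (m + t)" "c @ e \<in> bits (m + t)" "a' @ b' \<in> bits (m + t)" "c' @ e' \<in> bits (m + t)"
    using assms by (auto simp: w w')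
  have "(a @ b = a' @ b' \<and> c @ e = c' @ e') \<longleftrightarrow> w = w'"
    using assms by (auto simp: w w' bits_def)
  then show ?thesis
    using pauli_complete[OF in_bits] assms by (simp add: w w' split_reg_def)
qed

lemma card_split: "card (bits m \<times> bits t) = 2 ^ (m + t)"
  by (simp add: card_cartesian_product card_bits power_add)

lemma sandwich_add_tag:
  assumes fin: "finite T" and z: "z \<in> T"
  shows "sandwich ((M \<times> T) \<times> R) G (add_tag (ketbra (basis_ket z)) \<rho>) i j
    = sandwich (M \<times> R) (\<lambda>i p. G i ((fst p, z), snd p)) \<rho> i j"
proof -
  have "sandwich ((M \<times> T) \<times> R) G (add_tag (ketbra (basis_ket z)) \<rho>) i j
      = (\<Sum>a\<in>M. \<Sum>b\<in>T. of_bool (b = z) * (\<Sum>s\<in>R. \<Sum>a'\<in>M. \<Sum>b'\<in>T. of_bool (b' = z) *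
          (\<Sum>s'\<in>R. G i ((a, b), s) * \<rho> (a, s) (a', s') * cnj (G j ((a', b'), s')))))"
    unfolding sandwich2_def sum.cartesian_product' sum_distrib_left
    by (intro sum.cong refl) (auto simp: add_tag_def ketbra_basis)
  also have "\<dots> = sandwich (M \<times> R) (\<lambda>i p. G i ((fst p, z), snd p)) \<rho> i j"
    unfolding sum_pick[OF fin z] by (simp add: sandwich2_def sum.cartesian_product')
  finally show ?thesis .
qed

text \<open>Both outcomes of the tag measurement are diagonal in the computational basis, with
  \<open>Q\<close> the zero tag or its complement.\<close>

lemma measured_tag:
  assumes fin: "finite (Msg S)" "finite (Tag S)" "finite R" and Q: "Q \<subseteq> Tag S"
    and P: "P = (\<lambda>b b'. of_bool (b \<in> Q \<and> b = b'))"
    and X: "X \<in> ops ((Msg S \<times> Tag S) \<times> R) ((Msg S \<times> Tag S) \<times> R)"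
  shows "measured S R P X ((a, b), r) ((a', b'), r') = of_bool (b \<in> Q \<and> b' \<in> Q) * X ((a, b), r) ((a', b'), r')"
proof -
  let ?I = "{((a, b), r) | a b r. a \<in> Msg S \<and> b \<in> Q \<and> r \<in> R}"
  have K: "tensor (tensor (id_op (Msg S)) P) (id_op R) = (\<lambda>i p. of_bool (i \<in> ?I \<and> p = i))"
    by (auto simp: tensor_def id_op_def P fun_eq_iff)
  have "measured S R P X = (\<lambda>i j. of_bool (i \<in> ?I \<and> j \<in> ?I) * X i j)"
    unfolding measured_def conj_op_eq_sandwich K
    using fin Q by (intro ext, subst sandwich_select[where g = "\<lambda>i. i"]) auto
  then have eq: "measured S R P X ((a, b), r) ((a', b'), r')
      = of_bool (((a, b), r) \<in> ?I \<and> ((a', b'), r') \<in> ?I) * X ((a, b), r) ((a', b'), r')" by simp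
  show ?thesis
  proof (cases "((a, b), r) \<in> (Msg S \<times> Tag S) \<times> R \<and> ((a', b'), r') \<in> (Msg S \<times> Tag S) \<times> R")
    case True
    then show ?thesis unfolding eq by auto
  next
    case False
    then have "X ((a, b), r) ((a', b'), r') = 0" using X unfolding ops_def by blast
    then show ?thesis unfolding eq by simp
  qed
qed

lemma ops_zero: "X \<in> ops A B \<Longrightarrow> i \<notin> A \<or> j \<notin> B \<Longrightarrow> X i j = 0"
  unfolding ops_def by blast

lemma ops_sum: "(\<And>s. Y s \<in> ops A B) \<Longrightarrow> (\<lambda>i j. \<Sum>s\<in>S. Y s i j) \<in> ops A B"
  by (auto simp: ops_def)

lemma sandwich_opsI: "(\<And>i a. i \<notin> B \<Longrightarrow> F i a = 0) \<Longrightarrow> sandwich A F X \<in> ops B B"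
  by (auto simp: sandwich2_def ops_def)

lemma sum_epr_tag_ket:
  assumes fin: "finite M" "finite T" and z: "z \<in> T"
  shows "(\<Sum>p\<in>M \<times> (M \<times> T). epr_tag_ket M (basis_ket z) p * f (fst p) (snd p))
    = (\<Sum>a\<in>M. (1 / complex_of_real (sqrt (card M))) * f a (a, z))"
proof -
  let ?c = "1 / complex_of_real (sqrt (card M))"
  have "(\<Sum>p\<in>M \<times> (M \<times> T). epr_tag_ket M (basis_ket z) p * f (fst p) (snd p))
      = (\<Sum>a\<in>M. \<Sum>b\<in>M. of_bool (b = a) * (\<Sum>c\<in>T. of_bool (c = z) * (?c * f a (b, c))))"
    unfolding sum.cartesian_product' sum_distrib_left
    by (intro sum.cong refl) (auto simp: epr_tag_ket_def epr_def basis_ket_def)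
  also have "\<dots> = (\<Sum>a\<in>M. ?c * f a (a, z))"
    by (intro sum.cong refl) (simp only: sum_pick[OF fin(2) z] sum_pick[OF fin(1)])
  finally show ?thesis .
qed

text \<open>Fixing the indices of the reference copy at \<open>m\<close> and \<open>m'\<close> turns
  the EPR projector into a matrix unit on the other copy, divided by the dimension.\<close>

lemma sandwich_epr_block:
  assumes fin: "finite M" "finite T" and z: "z \<in> T" and m: "m \<in> M" "m' \<in> M"
  shows "sandwich ((M \<times> T) \<times> R) G
      (\<lambda>(x, r) (x', r'). ketbra (epr_tag_ket M (basis_ket z)) (m, x) (m', x') * \<rho> r r') i j
    = (1 / card M) * (\<Sum>s\<in>R. \<Sum>s'\<in>R. G i ((m, z), s) * \<rho> s s' * cnj (G j ((m', z), s')))"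
proof -
  let ?c = "complex_of_real (sqrt (card M))"
  have cc: "1 / ?c * (1 / ?c) = 1 / complex_of_real (card M)"
    by (simp flip: of_real_mult)
  have "sandwich ((M \<times> T) \<times> R) G
      (\<lambda>(x, r) (x', r'). ketbra (epr_tag_ket M (basis_ket z)) (m, x) (m', x') * \<rho> r r') i j
      = (\<Sum>a\<in>M. of_bool (a = m) * (\<Sum>b\<in>T. of_bool (b = z) * (\<Sum>s\<in>R. \<Sum>a'\<in>M. of_bool (a' = m') *
         (\<Sum>b'\<in>T. of_bool (b' = z) *
          (\<Sum>s'\<in>R. (1 / ?c * (1 / ?c)) * (G i ((a, b), s) * \<rho> s s' * cnj (G j ((a', b'), s'))))))))"
    unfolding sandwich2_def sum.cartesian_product' sum_distrib_left
    by (intro sum.cong refl) (auto simp: ketbra_def epr_tag_ket_def epr_def basis_ket_def)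
  also have "\<dots> = (\<Sum>s\<in>R. \<Sum>s'\<in>R. (1 / complex_of_real (card M)) * (G i ((m, z), s) * \<rho> s s' * cnj (G j ((m', z), s'))))"
    by (simp only: sum_pick[OF fin(2) z] sum_pick[OF fin(1) m(1)] sum_pick[OF fin(1) m(2)] cc)
  finally show ?thesis by (simp add: sum_distrib_left)
qed

subsection \<open>The real and the ideal channel of the canonical construction\<close>

locale attacked_code =
  fixes m t d ne :: nat and K :: "'k set" and V :: "'k \<Rightarrow> (bool list, bool list) opr"
    and \<A> :: "((bool list \<times> bool list) \<times> nat, (bool list \<times> bool list) \<times> nat) superop"
    and Kr :: "nat \<Rightarrow> ((bool list \<times> bool list) \<times> nat, (bool list \<times> bool list) \<times> nat) opr"
  assumes finite_K: "finite K" and K_nonempty: "K \<noteq> {}"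
    and codes: "\<And>k. k \<in> K \<Longrightarrow> pauli_code m t (V k)"
    and Kr_ops: "\<And>e. Kr e \<in> ops ((bits m \<times> bits t) \<times> {..<d}) ((bits m \<times> bits t) \<times> {..<d})"
    and kraus: "\<And>X. X \<in> ops ((bits m \<times> bits t) \<times> {..<d}) ((bits m \<times> bits t) \<times> {..<d}) \<Longrightarrow>
      \<A> X = (\<lambda>i j. \<Sum>e<ne. sandwich ((bits m \<times> bits t) \<times> {..<d}) (Kr e) X i j)"
    and kraus_tp: "\<And>p q. p \<in> (bits m \<times> bits t) \<times> {..<d} \<Longrightarrow> q \<in> (bits m \<times> bits t) \<times> {..<d} \<Longrightarrow>
      (\<Sum>e<ne. \<Sum>i\<in>(bits m \<times> bits t) \<times> {..<d}. Kr e i p * cnj (Kr e i q)) = of_bool (p = q)"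
begin

abbreviation "B \<equiv> bits m \<times> bits t"
abbreviation "MTR \<equiv> B \<times> {..<d}"
abbreviation "SP l \<equiv> split_reg m t (pauli (m + t) l)"
abbreviation "z \<equiv> replicate t False"
abbreviation "S \<equiv> canonical_scheme m t K V"

text \<open>The partial trace over message and tag of the Kraus operator multiplied by the adjoint
  Pauli, divided by the dimension.\<close>

definition E :: "nat \<Rightarrow> bool list \<Rightarrow> (nat, nat) opr" where
  "E e l = (\<lambda>r s. if r < d \<and> s < d
     then (\<Sum>w\<in>B \<times> B. cnj (SP l (fst w) (snd w)) * Kr e (fst w, r) (snd w, s)) / 2 ^ (m + t) else 0)"

lemma E_in_ops: "E e l \<in> ops {..<d} {..<d}"
  by (auto simp: E_def ops_def)

lemma Kr_expansion: "Kr e = (\<lambda>p q. \<Sum>l\<in>bits (2 * (m + t)). tensor (SP l) (E e l) p q)"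
proof (intro ext)
  fix p q :: "(bool list \<times> bool list) \<times> nat"
  obtain x r y s where pq: "p = (x, r)" "q = (y, s)" by (metis surj_pair)
  show "Kr e p q = (\<Sum>l\<in>bits (2 * (m + t)). tensor (SP l) (E e l) p q)"
  proof (cases "(x, y) \<in> B \<times> B \<and> r < d \<and> s < d")
    case True
    let ?g = "\<lambda>w. Kr e (fst w, r) (snd w, s)"
    have "(\<Sum>l\<in>bits (2 * (m + t)). SP l (fst (x, y)) (snd (x, y)) * (\<Sum>w\<in>B \<times> B. cnj (SP l (fst w) (snd w)) * ?g w))
        = 2 ^ (m + t) * ?g (x, y)"
      using True by (intro frame_inversion split_pauli_frame) auto
    then show ?thesis
      using True by (simp add: pq tensor_def E_def field_simps flip: sum_divide_distrib)
  next
    case False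
    then have "Kr e p q = 0" unfolding pq by (intro ops_zero[OF Kr_ops]) auto
    moreover have "tensor (SP l) (E e l) p q = 0" for l
      unfolding pq using False
      by (intro ops_zero[OF tensor_ops[OF split_reg_ops E_in_ops]]) auto
    ultimately show ?thesis by simp
  qed
qed

text \<open>By Parseval the sum over Paulis is the sum over all message and tag entries, divided by
  the dimension. Trace preservation of the attack gives one for each column \<open>y\<close> of
  these registers, and there are as many columns as the dimension.\<close>

lemma E_isometric:
  assumes s: "s < d" "s' < d"
  shows "(\<Sum>e<ne. \<Sum>l\<in>bits (2 * (m + t)). \<Sum>r<d. E e l r s * cnj (E e l r s')) = of_bool (s = s')"
proof -
  let ?N = "2 ^ (m + t) :: complex" and ?L = "bits (2 * (m + t))"
  have parseval: "(\<Sum>l\<in>?L. E e l r s * cnj (E e l r s'))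
      = (\<Sum>x\<in>B. \<Sum>y\<in>B. Kr e (x, r) (y, s) * cnj (Kr e (x, r) (y, s'))) / ?N" if "r < d" for e r
  proof -
    let ?F = "\<lambda>l s. \<Sum>w\<in>B \<times> B. cnj (SP l (fst w) (snd w)) * Kr e (fst w, r) (snd w, s)"
    have "(\<Sum>l\<in>?L. E e l r s * cnj (E e l r s')) = (\<Sum>l\<in>?L. ?F l s * cnj (?F l s') / (?N * ?N))"
      using that s by (intro sum.cong refl) (simp add: E_def)
    also have "\<dots> = (\<Sum>l\<in>?L. ?F l s * cnj (?F l s')) / (?N * ?N)"
      by (rule sum_divide_distrib[symmetric])
    also have "(\<Sum>l\<in>?L. ?F l s * cnj (?F l s'))
        = ?N * (\<Sum>w\<in>B \<times> B. Kr e (fst w, r) (snd w, s) * cnj (Kr e (fst w, r) (snd w, s')))"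
      by (intro frame_parseval split_pauli_frame) auto
    finally show ?thesis by (simp add: sum.cartesian_product case_prod_unfold)
  qed
  have "(\<Sum>e<ne. \<Sum>l\<in>?L. \<Sum>r<d. E e l r s * cnj (E e l r s')) = (\<Sum>e<ne. \<Sum>r<d. \<Sum>l\<in>?L. E e l r s * cnj (E e l r s'))"
    by (rule sum.cong[OF refl], rule sum.swap)
  also have "\<dots> = (\<Sum>e<ne. \<Sum>r<d. (\<Sum>x\<in>B. \<Sum>y\<in>B. Kr e (x, r) (y, s) * cnj (Kr e (x, r) (y, s'))) / ?N)"
    by (intro sum.cong refl parseval) auto
  also have "\<dots> = (\<Sum>e<ne. \<Sum>r<d. \<Sum>x\<in>B. \<Sum>y\<in>B. Kr e (x, r) (y, s) * cnj (Kr e (x, r) (y, s'))) / ?N"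
    by (simp add: sum_divide_distrib)
  also have "(\<Sum>e<ne. \<Sum>r<d. \<Sum>x\<in>B. \<Sum>y\<in>B. Kr e (x, r) (y, s) * cnj (Kr e (x, r) (y, s')))
      = (\<Sum>e<ne. \<Sum>x\<in>B. \<Sum>r<d. \<Sum>y\<in>B. Kr e (x, r) (y, s) * cnj (Kr e (x, r) (y, s')))"
    by (rule sum.cong[OF refl], rule sum.swap)
  also have "\<dots> = (\<Sum>e<ne. \<Sum>i\<in>MTR. \<Sum>y\<in>B. Kr e i (y, s) * cnj (Kr e i (y, s')))"
    by (simp only: sum.cartesian_product')
  also have "\<dots> = (\<Sum>e<ne. \<Sum>y\<in>B. \<Sum>i\<in>MTR. Kr e i (y, s) * cnj (Kr e i (y, s')))"
    by (rule sum.cong[OF refl], rule sum.swap)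
  also have "\<dots> = (\<Sum>y\<in>B. \<Sum>e<ne. \<Sum>i\<in>MTR. Kr e i (y, s) * cnj (Kr e i (y, s')))" by (rule sum.swap)
  also have "\<dots> = (\<Sum>y\<in>B. of_bool (s = s'))"
    using s by (intro sum.cong refl) (subst kraus_tp, auto)
  also have "\<dots> = ?N * of_bool (s = s')" by (simp only: sum_constant card_split) simp
  finally show ?thesis by simp
qed

sublocale purity_setup m t d ne K V E
  by unfold_locales (use finite_K K_nonempty codes E_in_ops E_isometric in auto)

section \<open>The attack between encryption and decryption\<close>

definition C :: "'k \<Rightarrow> bool list \<Rightarrow> (bool list \<times> bool list, bool list \<times> bool list) opr" where
  "C k l = split_reg m t (code_conj (m + t) (V k) l)"

lemma C_ops: "C k l \<in> ops B B"
  unfolding C_def by (rule split_reg_ops)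

lemma W_eq_C: "W k l a b = C k l (a, z) (b, z)"
  by (simp add: W_def C_def split_reg_def)

definition G :: "'k \<Rightarrow> bool list \<Rightarrow> nat \<Rightarrow> ((bool list \<times> bool list) \<times> nat, (bool list \<times> bool list) \<times> nat) opr" where
  "G k l' e = (\<lambda>p q. \<Sum>l\<in>\<Lambda>. csign (m + t) l l' * tensor (C k l) (E e l) p q)"

lemma G_ops: "G k l' e \<in> ops MTR MTR"
proof -
  have "tensor (C k l) (E e l) \<in> ops MTR MTR" for l
    by (intro tensor_ops C_ops E_ops)
  then have "(\<lambda>p q. csign (m + t) l l' * tensor (C k l) (E e l) p q) \<in> ops MTR MTR" for l
    by (simp add: ops_def)
  then show ?thesis unfolding G_def by (rule ops_sum)
qed

lemma Enc_eq: "Enc S (k, l') = split_reg m t (mul (bits (m + t)) (pauli (m + t) l') (V k))"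
  by (simp add: canonical_scheme_def)

text \<open>Common to both channels: the real one feeds it the tagged message, the ideal accepting
  map the blocks of the EPR state.\<close>

definition Att :: "'k \<Rightarrow> bool list \<Rightarrow> ((bool list \<times> bool list) \<times> nat, (bool list \<times> bool list) \<times> nat) superop" where
  "Att k l' X = (let U = tensor (Enc S (k, l')) (id_op R) in
     conj_op MTR (dagger U) (\<A> (conj_op MTR U X)))"

lemma U_ops: "tensor (Enc S (k, l')) (id_op R) \<in> ops MTR MTR"
  unfolding Enc_eq by (intro tensor_ops split_reg_ops) (auto simp: id_op_def ops_def)

lemma conjugated_kraus:
  "mul MTR (dagger (tensor (Enc S (k, l')) (id_op R))) (mul MTR (Kr e) (tensor (Enc S (k, l')) (id_op R))) = G k l' e"
proof -
  let ?U = "tensor (Enc S (k, l')) (id_op R)"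
  have conj: "mul MTR (dagger ?U) (mul MTR (tensor (SP l) (E e l)) ?U) = (\<lambda>p q. csign (m + t) l l' * tensor (C k l) (E e l) p q)" for l
  proof -
    have "mul MTR (dagger ?U) (mul MTR (tensor (SP l) (E e l)) ?U)
        = tensor (mul B (dagger (Enc S (k, l'))) (mul B (SP l) (Enc S (k, l')))) (mul R (id_op R) (mul R (E e l) (id_op R)))"
      unfolding dagger_tensor mul_tensor by simp
    also have "mul R (id_op R) (mul R (E e l) (id_op R)) = E e l"
      by (simp add: mul_id_right[OF _ E_ops] mul_id_left[OF _ E_ops])
    also have "mul B (dagger (Enc S (k, l'))) (mul B (SP l) (Enc S (k, l'))) = scale (csign (m + t) l l') (C k l)"
      unfolding Enc_eq dagger_split_reg mul_split_reg encryption_conj split_reg_scale C_def ..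
    finally show ?thesis by (simp add: tensor_scale)
  qed
  show ?thesis
    unfolding G_def \<Lambda>_def Kr_expansion[of e] mul_sum_left mul_sum_right conj ..
qed

lemma Att_eq:
  assumes X: "X \<in> ops MTR MTR"
  shows "Att k l' X = (\<lambda>i j. \<Sum>e<ne. sandwich MTR (G k l' e) X i j)"
proof -
  have "\<A> (sandwich MTR (tensor (Enc S (k, l')) (id_op R)) X)
      = (\<lambda>i j. \<Sum>e<ne. sandwich MTR (Kr e) (sandwich MTR (tensor (Enc S (k, l')) (id_op R)) X) i j)"
    by (intro kraus sandwich_ops U_ops)
  then show ?thesis
    unfolding Att_def Let_def conj_op_eq_sandwich
    by (simp add: sandwich_sum_arg sandwich_sandwich conjugated_kraus)
qed

lemma tag_state_eq: "tag_state S k = ketbra (basis_ket z)"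
  by (simp add: tag_state_def canonical_scheme_def)

lemma proj_acc_eq: "proj_acc S k = (\<lambda>b b'. of_bool (b \<in> {z} \<and> b = b'))"
  unfolding proj_acc_def tag_state_eq
  by (subst support_proj_basis) (auto simp: canonical_scheme_def ketbra_basis fun_eq_iff)

lemma proj_rej_eq: "proj_rej S k = (\<lambda>b b'. of_bool (b \<in> bits t - {z} \<and> b = b'))"
  unfolding proj_rej_def proj_acc_eq
  by (auto simp: canonical_scheme_def id_op_def fun_eq_iff)

lemma S_simps [simp]: "Msg S = M" "Tag S = bits t" "Keys S = K \<times> \<Lambda>"
  by (simp_all add: canonical_scheme_def \<Lambda>_def)

lemma attacked_eq:
  assumes \<rho>: "\<rho> \<in> ops (M \<times> R) (M \<times> R)"
  shows "attacked S R \<A> (k, l') \<rho>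
    = (\<lambda>i j. \<Sum>e<ne. sandwich (M \<times> R) (\<lambda>i p. G k l' e i ((fst p, z), snd p)) \<rho> i j)"
proof -
  have "attacked S R \<A> (k, l') \<rho> = Att k l' (add_tag (ketbra (basis_ket z)) \<rho>)"
    unfolding attacked_def Att_def tag_state_eq Let_def by simp
  moreover have "add_tag (ketbra (basis_ket z)) \<rho> \<in> ops MTR MTR"
    using \<rho> by (auto simp: add_tag_def ops_def ketbra_basis)
  ultimately show ?thesis by (simp add: Att_eq sandwich_add_tag)
qed

lemma attacked_ops:
  assumes "\<rho> \<in> ops (M \<times> R) (M \<times> R)"
  shows "attacked S R \<A> (k, l') \<rho> \<in> ops MTR MTR"
proof -
  have "G k l' e i q = 0" if "i \<notin> MTR" for e i q
    using that by (intro ops_zero[OF G_ops]) simp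
  then show ?thesis unfolding attacked_eq[OF assms] by (intro ops_sum sandwich_opsI)
qed

lemma G_restricted: "G k l' e ((a, z), r) ((a', z), s) = (\<Sum>l\<in>\<Lambda>. csign (m + t) l l' * tensor (W k l) (E e l) (a, r) (a', s))"
  by (simp add: G_def tensor_def W_eq_C)

lemma accepted_eq:
  assumes \<rho>: "\<rho> \<in> ops (M \<times> R) (M \<times> R)"
  shows "ptrace_tag (bits t) (measured S R (proj_acc S (k, l')) (attacked S R \<A> (k, l') \<rho>)) = acc_real k l' \<rho>"
proof (intro ext)
  fix i j :: "bool list \<times> nat"
  obtain a r a' r' where ij: "i = (a, r)" "j = (a', r')" by (metis surj_pair)
  let ?X = "attacked S R \<A> (k, l') \<rho>"
  have X: "?X \<in> ops ((Msg S \<times> Tag S) \<times> R) ((Msg S \<times> Tag S) \<times> R)" using attacked_ops[OF \<rho>] by simp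
  have "ptrace_tag (bits t) (measured S R (proj_acc S (k, l')) ?X) i j
      = (\<Sum>b\<in>bits t. of_bool (b = z) * ?X ((a, b), r) ((a', b), r'))"
    unfolding ij ptrace_tag_def using measured_tag[OF _ _ _ _ proj_acc_eq X] by simp
  also have "\<dots> = ?X ((a, z), r) ((a', z), r')" by (subst sum_pick) auto
  also have "\<dots> = acc_real k l' \<rho> i j"
    unfolding attacked_eq[OF \<rho>] acc_real_def ij sandwich2_def
    by (simp add: sum.cartesian_product' G_restricted)
  finally show "ptrace_tag (bits t) (measured S R (proj_acc S (k, l')) ?X) i j = acc_real k l' \<rho> i j" .
qed

text \<open>The conjugated error is unitary, so a column has norm one; its part with zero tag has
  squared norm equal to the acceptance indicator, and the rejected tags carry the rest.\<close>

lemma C_columns: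
  assumes k: "k \<in> K" and l: "l \<in> \<Lambda>" and a: "a \<in> M" "a' \<in> M"
  shows "(\<Sum>x\<in>M \<times> (bits t - {z}). C k l x (a, z) * cnj (C k l x (a', z))) = complex_of_real (1 - pass k l) * of_bool (a = a')"
proof -
  let ?f = "\<lambda>x. C k l x (a, z) * cnj (C k l x (a', z))"
  have "unitary_op B (C k l)"
    unfolding C_def by (intro unitary_split_reg code_conj_unitary V_unitary k)
  from unitary_columns[OF this, of "(a', z)" "(a, z)"]
  have "(\<Sum>x\<in>B. ?f x) = of_bool (a = a')" using a by (simp add: mult.commute eq_commute[of a a'])
  also have "(\<Sum>x\<in>B. ?f x) = (\<Sum>x\<in>M \<times> (bits t - {z}). ?f x) + (\<Sum>x\<in>M \<times> {z}. ?f x)"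
    by (subst sum.union_disjoint[symmetric]) (auto intro!: sum.cong)
  also have "(\<Sum>x\<in>M \<times> {z}. ?f x) = (\<Sum>x\<in>M. W k l x a * cnj (W k l x a'))"
    by (simp add: sum.cartesian_product' W_eq_C)
  also have "\<dots> = complex_of_real (pass k l) * of_bool (a = a')" by (rule W_columns[OF k l a])
  finally show ?thesis by (simp add: algebra_simps)
qed

text \<open>The recycled key does not reveal \<open>l'\<close>, so the sum over it acts on the
  operators themselves. Tracing out the rejected message and tag then replaces each error by its
  rejection indicator.\<close>

lemma rejected_eq:
  assumes \<rho>: "\<rho> \<in> ops (M \<times> R) (M \<times> R)" and k: "k \<in> K"
  shows "(\<Sum>l'\<in>\<Lambda>. ptrace1 B (measured S R (proj_rej S (k, l')) (attacked S R \<A> (k, l') \<rho>)) r r')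
    = 4 ^ (m + t) * rej_real k (ptrace1 M \<rho>) r r'"
proof -
  let ?T = "M \<times> (bits t - {z})"
  let ?C = "\<lambda>l x a. C k l x (a, z)"
  have tr: "ptrace1 B (measured S R (proj_rej S (k, l')) (attacked S R \<A> (k, l') \<rho>)) r r'
      = (\<Sum>x\<in>?T. \<Sum>e<ne. sandwich (M \<times> R) (\<lambda>i p. \<Sum>l\<in>\<Lambda>. csign (m + t) l l' * tensor (?C l) (E e l) i p) \<rho> (x, r) (x, r'))" for l'
  proof -
    let ?X = "attacked S R \<A> (k, l') \<rho>"
    have X: "?X \<in> ops ((Msg S \<times> Tag S) \<times> R) ((Msg S \<times> Tag S) \<times> R)" using attacked_ops[OF \<rho>] by simp
    have "ptrace1 B (measured S R (proj_rej S (k, l')) ?X) r r'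
        = (\<Sum>x\<in>B. if x \<in> ?T then ?X (x, r) (x, r') else 0)"
      unfolding ptrace1_def
    proof (intro sum.cong refl)
      fix x assume "x \<in> B"
      then show "measured S R (proj_rej S (k, l')) ?X (x, r) (x, r') = (if x \<in> ?T then ?X (x, r) (x, r') else 0)"
        using measured_tag[OF _ _ _ _ proj_rej_eq X] by (cases x) auto
    qed
    also have "\<dots> = (\<Sum>x\<in>?T. ?X (x, r) (x, r'))"
      by (rule sum.mono_neutral_cong_right) auto
    finally show ?thesis
      unfolding attacked_eq[OF \<rho>] by (simp add: G_def tensor_def case_prod_unfold)
  qed
  have "(\<Sum>l'\<in>\<Lambda>. ptrace1 B (measured S R (proj_rej S (k, l')) (attacked S R \<A> (k, l') \<rho>)) r r')
      = (\<Sum>x\<in>?T. \<Sum>l'\<in>\<Lambda>. \<Sum>e<ne. sandwich (M \<times> R) (\<lambda>i p. \<Sum>l\<in>\<Lambda>. csign (m + t) l l' * tensor (?C l) (E e l) i p) \<rho> (x, r) (x, r'))"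
    unfolding tr by (rule sum.swap)
  also have "\<dots> = (\<Sum>x\<in>?T. \<Sum>e<ne. \<Sum>l'\<in>\<Lambda>. sandwich (M \<times> R) (\<lambda>i p. \<Sum>l\<in>\<Lambda>. csign (m + t) l l' * tensor (?C l) (E e l) i p) \<rho> (x, r) (x, r'))"
    by (rule sum.cong[OF refl], rule sum.swap)
  also have "\<dots> = (\<Sum>x\<in>?T. \<Sum>e<ne. 4 ^ (m + t) * (\<Sum>l\<in>\<Lambda>. sandwich (M \<times> R) (tensor (?C l) (E e l)) \<rho> (x, r) (x, r')))"
    by (simp only: twirl[OF subset_refl])
  also have "\<dots> = 4 ^ (m + t) * (\<Sum>x\<in>?T. \<Sum>e<ne. \<Sum>l\<in>\<Lambda>. sandwich (M \<times> R) (tensor (?C l) (E e l)) \<rho> (x, r) (x, r'))"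
    by (simp only: sum_distrib_left)
  also have "(\<Sum>x\<in>?T. \<Sum>e<ne. \<Sum>l\<in>\<Lambda>. sandwich (M \<times> R) (tensor (?C l) (E e l)) \<rho> (x, r) (x, r'))
      = (\<Sum>e<ne. \<Sum>x\<in>?T. \<Sum>l\<in>\<Lambda>. sandwich (M \<times> R) (tensor (?C l) (E e l)) \<rho> (x, r) (x, r'))" by (rule sum.swap)
  also have "\<dots> = (\<Sum>e<ne. \<Sum>l\<in>\<Lambda>. \<Sum>x\<in>?T. sandwich (M \<times> R) (tensor (?C l) (E e l)) \<rho> (x, r) (x, r'))"
    by (rule sum.cong[OF refl], rule sum.swap)
  also have "\<dots> = rej_real k (ptrace1 M \<rho>) r r'"
    unfolding rej_real_def
    by (intro sum.cong refl sandwich_tensor_ptrace C_columns[OF k] finite_bits)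
  finally show ?thesis .
qed

end

lemma tensor_average:
  "tensor X (\<lambda>i j. (\<Sum>k\<in>Ks. Y k i j) / c) p q = (\<Sum>k\<in>Ks. tensor X (Y k) p q) / c"
  by (auto simp: tensor_def sum_distrib_left split: prod.splits)

context attacked_code
begin

section \<open>The ideal accepting map in the Pauli expansion\<close>

lemma ampl_kraus:
  assumes X: "X \<in> ops (M \<times> MTR) (M \<times> MTR)"
  shows "ampl \<A> X \<in> ops (M \<times> MTR) (M \<times> MTR)"
proof -
  have "ampl \<A> X = (\<lambda>p q. \<Sum>e<ne. ampl (sandwich MTR (Kr e)) X p q)"
    using kraus[OF ops_block[OF X]] by (auto simp: ampl_def)
  also have "\<dots> = (\<lambda>p q. \<Sum>e<ne. sandwich (M \<times> MTR) (tensor (id_op M) (Kr e)) X p q)"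
    by (simp only: ampl_sandwich[OF finite_bits X])
  finally show ?thesis
    by (simp only:) (intro ops_sum sandwich_ops tensor_ops Kr_ops id_op_in_ops)
qed

text \<open>Encryption and attack leave the reference copy of the message alone, so they act on each
  of its blocks separately.\<close>

lemma sim_block:
  assumes X: "X \<in> ops (M \<times> MTR) (M \<times> MTR)"
  defines "U \<equiv> \<lambda>k l'. tensor (id_op M) (tensor (Enc S (k, l')) (id_op R))"
  shows "conj_op (M \<times> MTR) (dagger (U k l')) (ampl \<A> (conj_op (M \<times> MTR) (U k l') X)) (a, i) (b, j)
    = Att k l' (\<lambda>p q. X (a, p) (b, q)) i j"
proof -
  let ?u = "tensor (Enc S (k, l')) (id_op R)"
  have 1: "conj_op (M \<times> MTR) (U k l') X = ampl (sandwich MTR ?u) X"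
    unfolding U_def conj_op_eq_sandwich by (rule ampl_sandwich[OF finite_bits X, symmetric])
  have "conj_op (M \<times> MTR) (U k l') X \<in> ops (M \<times> MTR) (M \<times> MTR)"
    unfolding U_def conj_op_eq_sandwich by (intro sandwich_ops tensor_ops[OF id_op_in_ops U_ops])
  note 2 = ampl_kraus[OF this]
  have "conj_op (M \<times> MTR) (dagger (U k l')) (ampl \<A> (conj_op (M \<times> MTR) (U k l') X))
      = ampl (sandwich MTR (dagger ?u)) (ampl \<A> (ampl (sandwich MTR ?u) X))"
    using ampl_sandwich[OF finite_bits 2, of "dagger ?u"]
    unfolding 1 by (simp add: U_def conj_op_eq_sandwich dagger_tensor)
  then show ?thesis by (simp add: ampl_def Att_def Let_def conj_op_eq_sandwich)
qed

lemma diagonal_average: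
  "(\<Sum>a\<in>M. (1 / complex_of_nat (card M)) * G k l' e ((a, z), r) ((a, z), s))
    = (\<Sum>l\<in>\<Lambda>. csign (m + t) l l' * (overlap k l * E e l r s))"
proof -
  have "(\<Sum>a\<in>M. (1 / complex_of_nat (card M)) * G k l' e ((a, z), r) ((a, z), s))
      = (\<Sum>a\<in>M. \<Sum>l\<in>\<Lambda>. csign (m + t) l l' * (W k l a a / 2 ^ m * E e l r s))"
    unfolding G_restricted by (simp add: tensor_def sum_distrib_left sum_divide_distrib card_bits)
  also have "\<dots> = (\<Sum>l\<in>\<Lambda>. \<Sum>a\<in>M. csign (m + t) l l' * (W k l a a / 2 ^ m * E e l r s))" by (rule sum.swap)
  finally show ?thesis by (simp add: overlap_def sum_divide_distrib sum_distrib_left sum_distrib_right)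
qed

text \<open>Projecting onto the EPR state averages the diagonal message entries of each Kraus
  operator, on both of its sides independently; the average of \<open>W\<close> is its
  overlap.\<close>

lemma sim_acc_term_eq:
  assumes \<rho>: "\<rho> \<in> ops R R"
  shows "sim_acc_term S R \<A> (k, l') (basis_ket z) \<rho> r r'
    = (\<Sum>e<ne. sandwich R (\<lambda>r s. \<Sum>l\<in>\<Lambda>. csign (m + t) l l' * (overlap k l * E e l r s)) \<rho> r r')"
proof -
  let ?\<psi> = "epr_tag_ket M (basis_ket z)" and ?c = "1 / complex_of_real (sqrt (card M))"
    and ?N = "complex_of_nat (card M)"
  let ?\<rho>0 = "\<lambda>(m2, x, r) (m2', x', r'). ketbra ?\<psi> (m2, x) (m2', x') * \<rho> r r'"
  let ?b = "\<lambda>a b. (\<lambda>(x, r) (x', r'). ketbra ?\<psi> (a, x) (b, x') * \<rho> r r')"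
  let ?F = "\<lambda>e a r s. G k l' e ((a, z), r) ((a, z), s)"
  have \<rho>0: "?\<rho>0 \<in> ops (M \<times> MTR) (M \<times> MTR)"
    using \<rho> by (auto simp: ops_def ketbra_def epr_tag_ket_def epr_def basis_ket_def)
  have block: "(\<lambda>p q. ?\<rho>0 (a, p) (b, q)) = ?b a b" for a b
    by (auto simp: fun_eq_iff)
  have cnj\<psi>: "cnj (?\<psi> p) = ?\<psi> p" for p
    by (cases p) (simp add: epr_tag_ket_def epr_def basis_ket_def split: prod.split)
  have att: "Att k l' (?b a b) ((a, z), r) ((b, z), r') = (1 / ?N) * (\<Sum>e<ne. sandwich2 R (?F e a) (?F e b) \<rho> r r')"
    if "a \<in> M" "b \<in> M" for a b
  proof -
    have "?b a b \<in> ops MTR MTR" using ops_block[OF \<rho>0, of a b] unfolding block .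
    then have "Att k l' (?b a b) ((a, z), r) ((b, z), r') = (\<Sum>e<ne. sandwich MTR (G k l' e) (?b a b) ((a, z), r) ((b, z), r'))"
      by (simp only: Att_eq)
    also have "\<dots> = (\<Sum>e<ne. (1 / ?N) * sandwich2 R (?F e a) (?F e b) \<rho> r r')"
      using that by (intro sum.cong refl) (subst sandwich_epr_block, auto simp: sandwich2_def)
    finally show ?thesis by (simp only: sum_distrib_left)
  qed
  have "sim_acc_term S R \<A> (k, l') (basis_ket z) \<rho> r r'
      = (\<Sum>(m2, x)\<in>M \<times> B. \<Sum>(m2', x')\<in>M \<times> B.
          cnj (?\<psi> (m2, x)) * Att k l' (?b m2 m2') (x, r) (x', r') * ?\<psi> (m2', x'))"
    unfolding sim_acc_term_def Let_def S_simps
    by (simp only: sim_block[OF \<rho>0] block)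
  also have "\<dots> = (\<Sum>p\<in>M \<times> B. \<Sum>q\<in>M \<times> B. cnj (?\<psi> p) * Att k l' (?b (fst p) (fst q)) (snd p, r) (snd q, r') * ?\<psi> q)"
    by (simp only: case_prod_unfold prod.collapse)
  also have "\<dots> = (\<Sum>p\<in>M \<times> B. ?\<psi> p * (\<Sum>q\<in>M \<times> B. ?\<psi> q * Att k l' (?b (fst p) (fst q)) (snd p, r) (snd q, r')))"
    unfolding cnj\<psi> by (simp only: sum_distrib_left mult_ac)
  also have "\<dots> = (\<Sum>a\<in>M. ?c * (\<Sum>b\<in>M. ?c * Att k l' (?b a b) ((a, z), r) ((b, z), r')))"
    by (simp only: sum_epr_tag_ket[OF finite_bits finite_bits replicate_in_bits,
        where f = "\<lambda>a x. \<Sum>q\<in>M \<times> B. ?\<psi> q * Att k l' (?b a (fst q)) (x, r) (snd q, r')"]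
      sum_epr_tag_ket[OF finite_bits finite_bits replicate_in_bits, where f = "\<lambda>b y. Att k l' (?b a b) ((a, z), r) (y, r')" for a])
  also have "\<dots> = (\<Sum>a\<in>M. \<Sum>b\<in>M. (?c * ?c) * Att k l' (?b a b) ((a, z), r) ((b, z), r'))"
    by (simp only: sum_distrib_left mult.assoc)
  also have "?c * ?c = 1 / ?N" by (simp flip: of_real_mult)
  \<comment> \<open>One factor \<open>1 / ?N\<close> stems from the prepared EPR state and one from
    the projection onto it. The conjugate lets \<open>sandwich_sum\<close> assign one factor to each
    side.\<close>
  also have "(\<Sum>a\<in>M. \<Sum>b\<in>M. 1 / ?N * Att k l' (?b a b) ((a, z), r) ((b, z), r'))
      = (\<Sum>a\<in>M. \<Sum>b\<in>M. \<Sum>e<ne. 1 / ?N * cnj (1 / ?N) * sandwich2 R (?F e a) (?F e b) \<rho> r r')"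
    by (intro sum.cong refl) (simp add: att sum_distrib_left)
  also have "\<dots> = (\<Sum>a\<in>M. \<Sum>e<ne. \<Sum>b\<in>M. 1 / ?N * cnj (1 / ?N) * sandwich2 R (?F e a) (?F e b) \<rho> r r')"
    by (rule sum.cong[OF refl], rule sum.swap)
  also have "\<dots> = (\<Sum>e<ne. \<Sum>a\<in>M. \<Sum>b\<in>M. 1 / ?N * cnj (1 / ?N) * sandwich2 R (?F e a) (?F e b) \<rho> r r')"
    by (rule sum.swap)
  also have "\<dots> = (\<Sum>e<ne. sandwich R (\<lambda>r s. \<Sum>a\<in>M. (1 / ?N) * ?F e a r s) \<rho> r r')"
    unfolding sandwich_sum ..
  finally show ?thesis unfolding diagonal_average .
qed

lemma card_keys: "complex_of_nat (card (K \<times> \<Lambda>)) = of_nat (card K) * 4 ^ (m + t)"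
  by (simp add: card_cartesian_product card_\<Lambda>)

text \<open>The accepting simulator averages over its own key, which is kept nowhere, so the twirl
  applies to it directly and leaves the squared moduli of the overlaps.\<close>

lemma sim_acc_eq:
  assumes \<rho>: "\<rho> \<in> ops R R"
  shows "sim_acc S R \<A> \<rho> = (\<lambda>i j. \<Sum>e<ne. \<Sum>l\<in>\<Lambda>. complex_of_real (sim_prob l) * sandwich R (E e l) \<rho> i j)"
proof (intro ext)
  fix i j
  let ?s = "\<lambda>e l. sandwich R (E e l) \<rho> i j"
  let ?N = "4 ^ (m + t) :: complex"
  have twirled: "(\<Sum>l'\<in>\<Lambda>. sim_acc_term S R \<A> (k, l') (basis_ket z) \<rho> i j)
      = ?N * (\<Sum>e<ne. \<Sum>l\<in>\<Lambda>. complex_of_real ((cmod (overlap k l))\<^sup>2) * ?s e l)" for k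
  proof -
    have "(\<Sum>l'\<in>\<Lambda>. sim_acc_term S R \<A> (k, l') (basis_ket z) \<rho> i j)
        = (\<Sum>e<ne. \<Sum>l'\<in>\<Lambda>. sandwich R (\<lambda>r s. \<Sum>l\<in>\<Lambda>. csign (m + t) l l' * (overlap k l * E e l r s)) \<rho> i j)"
      unfolding sim_acc_term_eq[OF \<rho>] by (rule sum.swap)
    also have "\<dots> = (\<Sum>e<ne. ?N * (\<Sum>l\<in>\<Lambda>. sandwich R (\<lambda>r s. overlap k l * E e l r s) \<rho> i j))"
      by (simp only: twirl[OF subset_refl, where F = "\<lambda>l r s. overlap k l * E e l r s" for e])
    finally show ?thesis by (simp only: sandwich_scale_op sum_distrib_left)
  qed
  have "sim_acc S R \<A> \<rho> i j
      = (\<Sum>k\<in>K. \<Sum>l'\<in>\<Lambda>. sim_acc_term S R \<A> (k, l') (basis_ket z) \<rho> i j) / of_nat (card (K \<times> \<Lambda>))"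
    unfolding sim_acc_def S_simps sum.cartesian_product' by (simp add: canonical_scheme_def)
  also have "\<dots> = (\<Sum>k\<in>K. \<Sum>e<ne. \<Sum>l\<in>\<Lambda>. complex_of_real ((cmod (overlap k l))\<^sup>2) * ?s e l) / of_nat (card K)"
    unfolding twirled card_keys by (simp flip: sum_distrib_left)
  also have "(\<Sum>k\<in>K. \<Sum>e<ne. \<Sum>l\<in>\<Lambda>. complex_of_real ((cmod (overlap k l))\<^sup>2) * ?s e l)
      = (\<Sum>e<ne. \<Sum>k\<in>K. \<Sum>l\<in>\<Lambda>. complex_of_real ((cmod (overlap k l))\<^sup>2) * ?s e l)" by (rule sum.swap)
  also have "\<dots> = (\<Sum>e<ne. \<Sum>l\<in>\<Lambda>. \<Sum>k\<in>K. complex_of_real ((cmod (overlap k l))\<^sup>2) * ?s e l)"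
    by (rule sum.cong[OF refl], rule sum.swap)
  finally show "sim_acc S R \<A> \<rho> i j = (\<Sum>e<ne. \<Sum>l\<in>\<Lambda>. complex_of_real (sim_prob l) * ?s e l)"
    by (simp add: sim_prob_def sum_divide_distrib sum_distrib_right)
qed

lemma ampl_sim_acc_eq:
  assumes \<rho>: "\<rho> \<in> ops (M \<times> R) (M \<times> R)"
  shows "ampl (sim_acc S R \<A>) \<rho> = acc_ideal \<rho>"
proof (intro ext)
  fix i j :: "bool list \<times> nat"
  obtain a r a' r' where ij: "i = (a, r)" "j = (a', r')" by (metis surj_pair)
  have "ampl (sim_acc S R \<A>) \<rho> i j
      = (\<Sum>e<ne. \<Sum>l\<in>\<Lambda>. complex_of_real (sim_prob l) * ampl (sandwich R (E e l)) \<rho> i j)"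
    by (simp add: ampl_def ij sim_acc_eq[OF ops_block[OF \<rho>]])
  then show "ampl (sim_acc S R \<A>) \<rho> i j = acc_ideal \<rho> i j"
    by (simp add: acc_ideal_def ampl_sandwich[OF finite_bits \<rho>])
qed

section \<open>Assembling the two channels and their difference\<close>

lemma real_channel_eq:
  assumes \<rho>: "\<rho> \<in> ops (M \<times> R) (M \<times> R)"
  shows "real_channel S (\<lambda>(k1, k2). k1) R \<A> \<rho> i j = (\<Sum>k\<in>K.
     (\<Sum>l\<in>\<Lambda>. acc_flag (k, l) (acc_real k l \<rho>) i j) + 4 ^ (m + t) * rej_flag k (rej_real k (ptrace1 M \<rho>)) i j)
     / (of_nat (card K) * 4 ^ (m + t))"
proof -
  let ?r = "\<lambda>k l. ptrace1 B (measured S R (proj_rej S (k, l)) (attacked S R \<A> (k, l) \<rho>))"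
  have rej: "(\<Sum>l\<in>\<Lambda>. rej_flag k (?r k l) i j) = 4 ^ (m + t) * rej_flag k (rej_real k (ptrace1 M \<rho>)) i j" if "k \<in> K" for k
  proof -
    have "(\<Sum>l\<in>\<Lambda>. rej_flag k (?r k l) i j) = rej_flag k (\<lambda>r r'. \<Sum>l\<in>\<Lambda>. ?r k l r r') i j"
      by (rule rej_flag_sum[symmetric])
    also have "\<dots> = 4 ^ (m + t) * rej_flag k (rej_real k (ptrace1 M \<rho>)) i j"
      unfolding rejected_eq[OF \<rho> that] by (rule rej_flag_mult)
    finally show ?thesis .
  qed
  have "real_channel S (\<lambda>(k1, k2). k1) R \<A> \<rho> i j
      = (\<Sum>k\<in>K. \<Sum>l\<in>\<Lambda>. acc_flag (k, l) (acc_real k l \<rho>) i j + rej_flag k (?r k l) i j) / of_nat (card (K \<times> \<Lambda>))"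
    unfolding real_channel_def S_simps sum.cartesian_product' accepted_eq[OF \<rho>] acc_flag_def rej_flag_def by simp
  also have "(\<Sum>k\<in>K. \<Sum>l\<in>\<Lambda>. acc_flag (k, l) (acc_real k l \<rho>) i j + rej_flag k (?r k l) i j)
      = (\<Sum>k\<in>K. (\<Sum>l\<in>\<Lambda>. acc_flag (k, l) (acc_real k l \<rho>) i j) + 4 ^ (m + t) * rej_flag k (rej_real k (ptrace1 M \<rho>)) i j)"
    by (intro sum.cong refl) (simp add: sum.distrib rej)
  finally show ?thesis unfolding card_keys .
qed

lemma ideal_channel_eq:
  assumes \<rho>: "\<rho> \<in> ops (M \<times> R) (M \<times> R)"
  shows "ideal_channel S (\<lambda>(k1, k2). k1) R (sim_acc S R \<A>) rej_ideal \<rho> i j = (\<Sum>k\<in>K.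
     (\<Sum>l\<in>\<Lambda>. acc_flag (k, l) (acc_ideal \<rho>) i j) + 4 ^ (m + t) * rej_flag k (rej_ideal (ptrace1 M \<rho>)) i j)
     / (of_nat (card K) * 4 ^ (m + t))"
proof -
  have "ideal_channel S (\<lambda>(k1, k2). k1) R (sim_acc S R \<A>) rej_ideal \<rho> i j
      = (\<Sum>k\<in>K. \<Sum>l\<in>\<Lambda>. acc_flag (k, l) (acc_ideal \<rho>) i j) / of_nat (card (K \<times> \<Lambda>))
      + (\<Sum>k\<in>K. \<Sum>l\<in>\<Lambda>. rej_flag k (rej_ideal (ptrace1 M \<rho>)) i j) / of_nat (card (K \<times> \<Lambda>))"
    unfolding ideal_channel_def Let_def S_simps ampl_sim_acc_eq[OF \<rho>] tensor_average
    unfolding sum.cartesian_product' acc_flag_def rej_flag_def by simp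
  also have "\<dots> = (\<Sum>k\<in>K. (\<Sum>l\<in>\<Lambda>. acc_flag (k, l) (acc_ideal \<rho>) i j)
      + (\<Sum>l\<in>\<Lambda>. rej_flag k (rej_ideal (ptrace1 M \<rho>)) i j)) / of_nat (card (K \<times> \<Lambda>))"
    by (simp only: sum.distrib add_divide_distrib)
  finally show ?thesis unfolding card_keys by (simp add: card_\<Lambda>)
qed

lemma channel_difference:
  assumes \<rho>: "\<rho> \<in> ops (M \<times> R) (M \<times> R)"
  shows "real_channel S (\<lambda>(k1, k2). k1) R \<A> \<rho> i j
    - ideal_channel S (\<lambda>(k1, k2). k1) R (sim_acc S R \<A>) rej_ideal \<rho> i j = diff_channel \<rho> i j"
proof -
  let ?N = "4 ^ (m + t) :: complex"
  let ?a = "\<lambda>k. (\<Sum>l\<in>\<Lambda>. acc_flag (k, l) (acc_real k l \<rho>) i j) - (\<Sum>l\<in>\<Lambda>. acc_flag (k, l) (acc_ideal \<rho>) i j)"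
  let ?b = "\<lambda>k. rej_flag k (rej_real k (ptrace1 M \<rho>)) i j - rej_flag k (rej_ideal (ptrace1 M \<rho>)) i j"
  have avg: "(\<Sum>k\<in>K. P k) / c - (\<Sum>k\<in>K. Q k) / c = (\<Sum>k\<in>K. P k - Q k) / c" for P Q and c :: complex
    by (simp add: sum_subtractf diff_divide_distrib)
  have "real_channel S (\<lambda>(k1, k2). k1) R \<A> \<rho> i j
      - ideal_channel S (\<lambda>(k1, k2). k1) R (sim_acc S R \<A>) rej_ideal \<rho> i j
      = (\<Sum>k\<in>K. ?a k + ?N * ?b k) / (of_nat (card K) * ?N)"
    unfolding real_channel_eq[OF \<rho>] ideal_channel_eq[OF \<rho>] avg
    by (intro arg_cong2[where f = divide] sum.cong refl) (simp add: algebra_simps)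
  also have "\<dots> = (\<Sum>k\<in>K. (1 / of_nat (card K)) * ((1 / ?N) * ?a k + ?b k))"
    unfolding sum_divide_distrib by (intro sum.cong refl) (simp add: field_simps)
  also have "\<dots> = diff_channel \<rho> i j"
    unfolding diff_channel_def acc_flag_diff rej_flag_diff
    by (simp add: sum_distrib_left sum_subtractf sum_divide_distrib diff_divide_distrib)
  finally show ?thesis .
qed

lemma out_reg_eq: "out_reg S (\<lambda>(k1, k2). k1) R = out"
proof -
  have "(\<lambda>(k1, k2). k1) ` (K \<times> \<Lambda>) = K" using l0_in by force
  then show ?thesis by (simp add: out_reg_def)
qed

theorem diamond_dist_le:
  assumes "0 < d" "0 < \<delta>" "\<And>l. l \<in> \<Lambda> \<Longrightarrow> l \<noteq> l0 \<Longrightarrow> pass_prob l \<le> \<delta>"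
  shows "diamond_dist (M \<times> R) (out_reg S (\<lambda>(k1, k2). k1) R)
    (real_channel S (\<lambda>(k1, k2). k1) R \<A>)
    (ideal_channel S (\<lambda>(k1, k2). k1) R (sim_acc S R \<A>) rej_ideal) \<le> sqrt \<delta> / 2 + 2 * \<delta>"
proof -
  have "diamond_norm (M \<times> R) out (\<lambda>X i j. real_channel S (\<lambda>(k1, k2). k1) R \<A> X i j
      - ideal_channel S (\<lambda>(k1, k2). k1) R (sim_acc S R \<A>) rej_ideal X i j)
      = diamond_norm (M \<times> R) out diff_channel"
    by (rule diamond_norm_cong) (simp add: channel_difference fun_eq_iff)
  then show ?thesis
    using diamond_diff_le[OF assms] unfolding diamond_dist_def out_reg_eq by simp
qed

lemma rej_ideal_cp: "cp_map R R rej_ideal"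
proof -
  have E0: "i \<notin> R \<Longrightarrow> E e l i a = 0" for e l i a
    using E_ops[of e l] by (auto simp: ops_def)
  \<comment> \<open>Complete positivity requires nonnegative weights; the ideal accepting weight is
    at most an acceptance probability.\<close>
  have nonneg: "0 \<le> 1 - sim_prob l" if "l \<in> \<Lambda>" for l
    using sim_prob_le[OF that] pass_prob_le_1[of l] by simp
  \<comment> \<open>The factor \<open>1\<close> gives the outer sum the shape required by
    \<open>linear_superop_scale_sum\<close>.\<close>
  have eq: "rej_ideal = (\<lambda>X i j. \<Sum>e<ne. 1 * (\<Sum>l\<in>\<Lambda>. complex_of_real (1 - sim_prob l) * sandwich R (E e l) X i j))"
    by (simp add: rej_ideal_def fun_eq_iff)
  have "linear_superop R R rej_ideal"
    unfolding eq by (intro linear_superop_scale_sum linear_superop_sandwich E0)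
  moreover have "cpos R R rej_ideal"
    unfolding rej_ideal_def by (intro cpos_sum cpos_scale cpos_sandwich nonneg E0)
  ultimately show ?thesis by (simp add: cp_map_def cpos_def)
qed

lemma simulator_trace_preserving:
  "trace_preserving R R (\<lambda>\<rho> i j. sim_acc S R \<A> \<rho> i j + rej_ideal \<rho> i j)"
  unfolding trace_preserving_def
proof
  fix \<rho> assume \<rho>: "\<rho> \<in> ops R R"
  have "(\<lambda>i j. sim_acc S R \<A> \<rho> i j + rej_ideal \<rho> i j) = (\<lambda>i j. \<Sum>e<ne. \<Sum>l\<in>\<Lambda>. sandwich R (E e l) \<rho> i j)"
    unfolding sim_acc_eq[OF \<rho>] rej_ideal_def by (simp add: algebra_simps flip: sum.distrib)
  then show "trace_op R (\<lambda>i j. sim_acc S R \<A> \<rho> i j + rej_ideal \<rho> i j) = trace_op R \<rho>"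
    by (simp only: trace_op_sum trace_preserved)
qed

end

lemma canonical_encryption_scheme:
  assumes "finite K" "K \<noteq> {}" "\<And>k. k \<in> K \<Longrightarrow> pauli_code m t (V k)"
  shows "encryption_scheme (canonical_scheme m t K V)"
proof -
  have "unitary_op (bits m \<times> bits t) (split_reg m t (mul (bits (m + t)) (pauli (m + t) l) (V k)))" if "k \<in> K" for k l
    using assms(3)[OF that] by (intro unitary_split_reg unitary_mul pauli_unitary finite_bits) (simp add: pauli_code_def)
  moreover have "bits n \<noteq> {}" for n using replicate_in_bits by blast
  moreover have "inner_ket (bits t) (basis_ket (replicate t False)) (basis_ket (replicate t False)) = 1"
    by (simp add: inner_ket_basis(1)) (simp add: basis_ket_def)
  ultimately show ?thesis
    using assms(1,2) by (auto simp: encryption_scheme_def canonical_scheme_def kets_def basis_ket_def)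
qed

theorem theorem9:
  fixes m t :: nat
    and K :: "'k set"
    and V :: "'k \<Rightarrow> (bool list, bool list) opr"
    and \<epsilon> :: real
  assumes "finite K" and "K \<noteq> {}"
    and "0 \<le> \<epsilon>"
    and "\<And>k. k \<in> K \<Longrightarrow> pauli_code m t (V k)"
    and "strong_purity_testing m t K V \<epsilon>"
  shows "qca_r (canonical_scheme m t K V) (\<lambda>(k1, k2). k1) (sqrt \<epsilon> + 3 / 2 * \<epsilon>)"
  unfolding qca_r_def Let_def
proof (intro conjI allI impI)
  let ?S = "canonical_scheme m t K V"
  show "encryption_scheme ?S"
    using assms(1,2,4) by (rule canonical_encryption_scheme)
  fix d :: nat and \<A> :: "((bool list \<times> bool list) \<times> nat, (bool list \<times> bool list) \<times> nat) superop"
  let ?R = "{..<d}" and ?MTR = "(bits m \<times> bits t) \<times> {..<d}"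
  assume d: "0 < d" and "cptp_map ((Msg ?S \<times> Tag ?S) \<times> ?R) ((Msg ?S \<times> Tag ?S) \<times> ?R) \<A>"
  then have cp: "cp_map ?MTR ?MTR \<A>" and tp: "trace_preserving ?MTR ?MTR \<A>"
    by (simp_all add: cptp_map_def canonical_scheme_def)
  have fin: "finite ?MTR" by simp
  obtain ne :: nat and Kr where Kr: "\<And>e. Kr e \<in> ops ?MTR ?MTR"
    and kraus: "\<And>X. X \<in> ops ?MTR ?MTR \<Longrightarrow> \<A> X = (\<lambda>i j. \<Sum>e<ne. sandwich ?MTR (Kr e) X i j)"
    by (rule kraus_representation[OF fin fin cp]) (rule that)
  interpret attacked_code m t d ne K V \<A> Kr
    by unfold_locales (use assms(1,2,4) Kr kraus kraus_trace_preserving[OF fin tp kraus] in auto)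
  have pass_le: "pass_prob l \<le> \<epsilon>" if "l \<in> \<Lambda>" "l \<noteq> l0" for l
  proof -
    have "(\<Sum>k\<in>K. pass k l) = real (card {k \<in> K. passes m t (V k) l})"
      using assms(1) by (simp add: pass_def sum.If_cases of_bool_def Int_def)
    then show ?thesis
      using assms(5) that by (simp add: strong_purity_testing_def pass_prob_def passes_def code_conj_def \<Lambda>_def l0_def)
  qed
  let ?dist = "diamond_dist (bits m \<times> ?R) (out_reg ?S (\<lambda>(k1, k2). k1) ?R) (real_channel ?S (\<lambda>(k1, k2). k1) ?R \<A>)
      (ideal_channel ?S (\<lambda>(k1, k2). k1) ?R (sim_acc ?S ?R \<A>) rej_ideal)"
  have dist: "?dist \<le> sqrt \<delta> / 2 + 2 * \<delta>" if "0 < \<delta>" "\<And>l. l \<in> \<Lambda> \<Longrightarrow> l \<noteq> l0 \<Longrightarrow> pass_prob l \<le> \<delta>" for \<delta>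
    using d that by (rule diamond_dist_le)
  have bound: "?dist \<le> sqrt \<epsilon> + 3 / 2 * \<epsilon>"
  proof -
    \<comment> \<open>The distance bound is available for positive errors only, since its parameter
      \<open>c\<close> is inverted.\<close>
    consider "1 \<le> \<epsilon>" | "0 < \<epsilon>" "\<epsilon> < 1" | "\<epsilon> = 0" using assms(3) by linarith
    then show ?thesis
    proof cases
      case 1
      \<comment> \<open>Probabilities are at most one, and at error one the available bound and the
        claimed one agree at \<open>5 / 2\<close>.\<close>
      have "?dist \<le> sqrt 1 / 2 + 2 * 1" by (intro dist pass_prob_le_1) simp
      also have "\<dots> = 5 / 2" by simp
      also have "\<dots> \<le> sqrt \<epsilon> + 3 / 2 * \<epsilon>"
      proof -
        have "1 \<le> sqrt \<epsilon>" using 1 by simp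
        then show ?thesis using 1 by linarith
      qed
      finally show ?thesis .
    next
      case 2
      have "sqrt \<epsilon> * sqrt \<epsilon> \<le> 1 * sqrt \<epsilon>" using 2 by (intro mult_right_mono) auto
      then have "\<epsilon> \<le> sqrt \<epsilon>" using 2 by simp
      moreover have "?dist \<le> sqrt \<epsilon> / 2 + 2 * \<epsilon>" by (intro dist pass_le 2)
      ultimately show ?thesis by simp
    next
      case 3
      have "?dist \<le> 0"
      proof (rule field_le_epsilon)
        fix \<eta> :: real assume \<eta>: "0 < \<eta>"
        \<comment> \<open>With error \<open>s * s\<close> and \<open>s \<le> 1\<close> the bound is
          at most \<open>5 / 2 * s\<close>, hence below \<open>3 * s \<le> \<eta>\<close>.\<close>
        define s where "s = min 1 (\<eta> / 3)"
        have s: "0 < s" "s \<le> 1" "3 * s \<le> \<eta>" using \<eta> by (auto simp: s_def)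
        have "?dist \<le> sqrt (s * s) / 2 + 2 * (s * s)"
          using s pass_le 3 by (intro dist) (auto intro: order_trans[OF _ less_imp_le[OF mult_pos_pos]])
        moreover have "sqrt (s * s) = s" using s by simp
        moreover have "s * s \<le> s" using s mult_left_le_one_le[of s s] by simp
        ultimately show "?dist \<le> 0 + \<eta>" using s by linarith
      qed
      then show ?thesis using 3 by simp
    qed
  qed
  show "\<exists>S_rej. cp_map ?R ?R S_rej \<and>
      trace_preserving ?R ?R (\<lambda>\<rho> i j. sim_acc ?S ?R \<A> \<rho> i j + S_rej \<rho> i j) \<and>
      diamond_dist (Msg ?S \<times> ?R) (out_reg ?S (\<lambda>(k1, k2). k1) ?R)
        (real_channel ?S (\<lambda>(k1, k2). k1) ?R \<A>) (ideal_channel ?S (\<lambda>(k1, k2). k1) ?R (sim_acc ?S ?R \<A>) S_rej)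
      \<le> sqrt \<epsilon> + 3 / 2 * \<epsilon>"
    unfolding S_simps(1)
    by (intro exI[of _ rej_ideal] conjI rej_ideal_cp simulator_trace_preserving bound)
qed

end
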